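(* Let $\iota:R\to A$ be a Frobenius extension, $T$ a left $R$-module, $U=A\otimes_RT$, $S=\operatorname{End}_R(T)$, $B=\operatorname{End}_A(U)$, and assume that $U\in\operatorname{add}_R(T)$ as an $R$-module. Let $\rho:S\to B$, $\rho(s)=1_A\otimes s$, be the natural ring homomorphism. Then extension of scalars is compatible with the equivalences $T\otimes_S-:S\text{-}\mathrm{proj}\rightleftarrows\operatorname{add}_R(T):\operatorname{Hom}_R(T,-)$ and $U\otimes_B-:B\text{-}\mathrm{proj}\rightleftarrows\operatorname{add}_A(U):\operatorname{Hom}_A(U,-)$. More precisely, the following natural isomorphisms hold: (i) for every $P\in S\text{-}\mathrm{proj}$, $A\otimes_R(T\otimes_S P)\cong U\otimes_B(B\otimes_S P)$ as left $A$-modules; (ii) for every $X\in \operatorname{add}_A(U)$, $\operatorname{Hom}_R(T, \operatorname{Res} X)\cong \operatorname{Res}\operatorname{Hom}_A(U,X)$ as left $S$-modules, where the restriction on the right-hand side is along $\rho:S\to B$; (iii) for every $M\in\operatorname{add}_R(T)$, $B\otimes_S\operatorname{Hom}_R(T,M)\cong \operatorname{Hom}_A(U,A\otimes_R M)$ as left $B$-modules; (iv) for every $Q\in B\text{-}\mathrm{proj}$, $T\otimes_S \operatorname{Res} Q\cong \operatorname{Res}(U\otimes_B Q)$ as left $R$-modules, where on the left $\operatorname{Res}$ is along $\rho$ and on the right it is along $\iota$.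
   Context: All rings are associative with unit; modules are left modules unless otherwise specified. A ring extension $\iota:R\to A$ is a unital ring homomorphism, and $\operatorname{Res}$ denotes restriction of scalars (along $\iota$ for $A$-modules, along $\rho$ for $B$-modules). $\iota$ is a Frobenius extension if $A$ is finitely generated projective as a left $R$-module and $A\cong\operatorname{Hom}_R(A,R)$ as $A$-$R$-bimodules, where $(af)(x)=f(xa)$ and $(fr)(x)=f(x)r$. For an $R$-module $M$, $\operatorname{add}_R(M)$ is the full subcategory of direct summands of finite direct sums of copies of $M$. $S\text{-}\mathrm{proj}$ and $B\text{-}\mathrm{proj}$ denote the categories of finitely generated projective left $S$- and $B$-modules. Endomorphism rings use the right-action convention: for $s_1,s_2\in S$, $t(s_1s_2)=(ts_1)s_2$, i.e. $s_1s_2=s_2\circ s_1$. Thus $T$ is an $R$-$S$-bimodule via $ts=s(t)$, and similarly $U$ is an $A$-$B$-bimodule. Explicitly, $(a\otimes t)\rho(s)=a\otimes ts$. The left $S$-action on $\operatorname{Hom}_R(T,M)$ is $(sf)(t)=f(ts)$, and similarly $B$ acts on the left on $\operatorname{Hom}_A(U,X)$. *)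

theory Defs
  imports
    "HOL-Algebra.Free_Abelian_Groups"
    "HOL-Algebra.Generated_Groups"
    "HOL-Algebra.QuotRing"
    "HOL-Algebra.Module"
begin

section \<open>Left modules and bimodules over arbitrary rings\<close>

text \<open>
  The locale \<^locale>\<open>module\<close> of the library requires a commutative ring of scalars.  We keep
  its record type, whose fields \<^const>\<open>mult\<close> and \<^const>\<open>one\<close> play no role for modules.
\<close>

locale left_module = R?: ring R + M?: abelian_group M
  for R :: "('r, 'c) ring_scheme" (structure)
  and M :: "('r, 'm, 'd) module_scheme" (structure) +
  assumes smult_closed:
      "\<lbrakk>a \<in> carrier R; x \<in> carrier M\<rbrakk> \<Longrightarrow> a \<odot>\<^bsub>M\<^esub> x \<in> carrier M"
    and smult_l_distr:
      "\<lbrakk>a \<in> carrier R; b \<in> carrier R; x \<in> carrier M\<rbrakk>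
        \<Longrightarrow> (a \<oplus>\<^bsub>R\<^esub> b) \<odot>\<^bsub>M\<^esub> x = a \<odot>\<^bsub>M\<^esub> x \<oplus>\<^bsub>M\<^esub> b \<odot>\<^bsub>M\<^esub> x"
    and smult_r_distr:
      "\<lbrakk>a \<in> carrier R; x \<in> carrier M; y \<in> carrier M\<rbrakk>
        \<Longrightarrow> a \<odot>\<^bsub>M\<^esub> (x \<oplus>\<^bsub>M\<^esub> y) = a \<odot>\<^bsub>M\<^esub> x \<oplus>\<^bsub>M\<^esub> a \<odot>\<^bsub>M\<^esub> y"
    and smult_assoc:
      "\<lbrakk>a \<in> carrier R; b \<in> carrier R; x \<in> carrier M\<rbrakk>
        \<Longrightarrow> (a \<otimes>\<^bsub>R\<^esub> b) \<odot>\<^bsub>M\<^esub> x = a \<odot>\<^bsub>M\<^esub> (b \<odot>\<^bsub>M\<^esub> x)"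
    and smult_one:
      "x \<in> carrier M \<Longrightarrow> \<one>\<^bsub>R\<^esub> \<odot>\<^bsub>M\<^esub> x = x"

text \<open>The right action is written \<open>rsmult M x s\<close> for \<open>x s\<close>.\<close>

record ('r, 's, 'm) bimodule = "('r, 'm) module" +
  rsmult :: "'m \<Rightarrow> 's \<Rightarrow> 'm"

definition with_right_action ::
    "('r, 'm, 'd) module_scheme \<Rightarrow> ('m \<Rightarrow> 's \<Rightarrow> 'm) \<Rightarrow> ('r, 's, 'm) bimodule"
  where "with_right_action M act =
    \<lparr>carrier = carrier M, mult = mult M, one = one M, zero = zero M, add = add M,
     smult = smult M, rsmult = act\<rparr>"

definition regular_module :: "('r, 'c) ring_scheme \<Rightarrow> ('r, 'r) module"
  where "regular_module R =
    \<lparr>carrier = carrier R, mult = mult R, one = one R, zero = zero R, add = add R,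
     smult = mult R\<rparr>"

definition restrict_scalars ::
    "('r \<Rightarrow> 'a) \<Rightarrow> ('a, 'm, 'd) module_scheme \<Rightarrow> ('r, 'm) module"
  where "restrict_scalars h M =
    \<lparr>carrier = carrier M, mult = mult M, one = one M, zero = zero M, add = add M,
     smult = (\<lambda>r. smult M (h r))\<rparr>"

text \<open>
  A ring homomorphism \<open>h : R \<rightarrow> A\<close> makes \<open>A\<close> an \<open>A\<close>-\<open>R\<close>-bimodule and an \<open>R\<close>-\<open>A\<close>-bimodule.
\<close>

definition right_extension_bimodule ::
    "('r \<Rightarrow> 'a) \<Rightarrow> ('a, 'c) ring_scheme \<Rightarrow> ('a, 'r, 'a) bimodule"
  where "right_extension_bimodule h A =
    with_right_action (regular_module A) (\<lambda>x r. x \<otimes>\<^bsub>A\<^esub> h r)"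

definition left_extension_bimodule ::
    "('r \<Rightarrow> 'a) \<Rightarrow> ('a, 'c) ring_scheme \<Rightarrow> ('r, 'a, 'a) bimodule"
  where "left_extension_bimodule h A =
    with_right_action (restrict_scalars h (regular_module A)) (mult A)"

section \<open>Homomorphisms\<close>

text \<open>
  Homomorphisms are extensional, so that equality of homomorphisms is equality on the carrier.
\<close>

definition module_homs ::
    "('r, 'c) ring_scheme \<Rightarrow> ('r, 'm, 'd) module_scheme \<Rightarrow> ('r, 'n, 'e) module_scheme
      \<Rightarrow> ('m \<Rightarrow> 'n) set"
  where "module_homs R M N =
    {f \<in> carrier M \<rightarrow>\<^sub>E carrier N.
      (\<forall>x\<in>carrier M. \<forall>y\<in>carrier M. f (x \<oplus>\<^bsub>M\<^esub> y) = f x \<oplus>\<^bsub>N\<^esub> f y) \<and>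
      (\<forall>r\<in>carrier R. \<forall>x\<in>carrier M. f (r \<odot>\<^bsub>M\<^esub> x) = r \<odot>\<^bsub>N\<^esub> f x)}"

definition module_isos ::
    "('r, 'c) ring_scheme \<Rightarrow> ('r, 'm, 'd) module_scheme \<Rightarrow> ('r, 'n, 'e) module_scheme
      \<Rightarrow> ('m \<Rightarrow> 'n) set"
  where "module_isos R M N = {f \<in> module_homs R M N. bij_betw f (carrier M) (carrier N)}"

definition bimodule_isos ::
    "('r, 'c) ring_scheme \<Rightarrow> ('s, 'd) ring_scheme
      \<Rightarrow> ('r, 's, 'm, 'e) bimodule_scheme \<Rightarrow> ('r, 's, 'n, 'f) bimodule_scheme
      \<Rightarrow> ('m \<Rightarrow> 'n) set"
  where "bimodule_isos R S M N =
    {f \<in> module_isos R M N.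
      \<forall>s\<in>carrier S. \<forall>x\<in>carrier M. f (rsmult M x s) = rsmult N (f x) s}"

text \<open>
  For an \<open>R\<close>-\<open>S\<close>-bimodule \<open>T\<close>, \<open>Hom\<^sub>R(T, M)\<close> is a left \<open>S\<close>-module via \<open>(s f)(t) = f(t s)\<close>.
  If \<open>M\<close> is an \<open>R\<close>-\<open>Q\<close>-bimodule, it is an \<open>S\<close>-\<open>Q\<close>-bimodule via \<open>(f q)(t) = f(t) q\<close>.
\<close>

definition hom_module ::
    "('r, 'c) ring_scheme \<Rightarrow> ('r, 's, 't, 'd) bimodule_scheme \<Rightarrow> ('r, 'm, 'e) module_scheme
      \<Rightarrow> ('s, 't \<Rightarrow> 'm) module"
  where "hom_module R T M =
    \<lparr>carrier = module_homs R T M, mult = undefined, one = undefined,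
     zero = (\<lambda>t\<in>carrier T. \<zero>\<^bsub>M\<^esub>),
     add = (\<lambda>f g. \<lambda>t\<in>carrier T. f t \<oplus>\<^bsub>M\<^esub> g t),
     smult = (\<lambda>s f. \<lambda>t\<in>carrier T. f (rsmult T t s))\<rparr>"

definition hom_bimodule ::
    "('r, 'c) ring_scheme \<Rightarrow> ('r, 's, 't, 'd) bimodule_scheme
      \<Rightarrow> ('r, 'q, 'm, 'e) bimodule_scheme \<Rightarrow> ('s, 'q, 't \<Rightarrow> 'm) bimodule"
  where "hom_bimodule R T M =
    with_right_action (hom_module R T M) (\<lambda>f q. \<lambda>t\<in>carrier T. rsmult M (f t) q)"

text \<open>The endomorphism ring acting on the right: the product \<open>f g\<close> is \<open>g \<circ> f\<close>.\<close>

definition End_ring ::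
    "('r, 'c) ring_scheme \<Rightarrow> ('r, 't, 'd) module_scheme \<Rightarrow> ('t \<Rightarrow> 't) ring"
  where "End_ring R T =
    \<lparr>carrier = module_homs R T T,
     mult = (\<lambda>f g. compose (carrier T) g f), one = (\<lambda>t\<in>carrier T. t),
     zero = (\<lambda>t\<in>carrier T. \<zero>\<^bsub>T\<^esub>), add = (\<lambda>f g. \<lambda>t\<in>carrier T. f t \<oplus>\<^bsub>T\<^esub> g t)\<rparr>"

text \<open>A left \<open>R\<close>-module as a bimodule over \<open>R\<close> and its endomorphism ring.\<close>

definition End_bimodule :: "('r, 't, 'd) module_scheme \<Rightarrow> ('r, 't \<Rightarrow> 't, 't) bimodule"
  where "End_bimodule T = with_right_action T (\<lambda>t s. s t)"

section \<open>Finitely generated projective modules and \<open>add(M)\<close>\<close>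

text \<open>The direct sum of copies of \<open>M\<close> indexed by \<open>I\<close>.\<close>

definition direct_sum_copies ::
    "'i set \<Rightarrow> ('r, 'm, 'd) module_scheme \<Rightarrow> ('r, 'i \<Rightarrow> 'm) module"
  where "direct_sum_copies I M =
    \<lparr>carrier = {f \<in> I \<rightarrow>\<^sub>E carrier M. finite {i\<in>I. f i \<noteq> \<zero>\<^bsub>M\<^esub>}},
     mult = undefined, one = undefined,
     zero = (\<lambda>i\<in>I. \<zero>\<^bsub>M\<^esub>), add = (\<lambda>f g. \<lambda>i\<in>I. f i \<oplus>\<^bsub>M\<^esub> g i),
     smult = (\<lambda>r f. \<lambda>i\<in>I. r \<odot>\<^bsub>M\<^esub> f i)\<rparr>"

text \<open>\<open>N\<close> is isomorphic to a direct summand \<open>K\<close> of \<open>L = K \<oplus> K'\<close> (internal direct sum).\<close>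

definition is_direct_summand ::
    "('r, 'c) ring_scheme \<Rightarrow> ('r, 'n, 'd) module_scheme \<Rightarrow> ('r, 'l, 'e) module_scheme \<Rightarrow> bool"
  where "is_direct_summand R N L \<longleftrightarrow>
    (\<exists>K K'. submodule K R L \<and> submodule K' R L \<and>
      K <+>\<^bsub>L\<^esub> K' = carrier L \<and> K \<inter> K' = {\<zero>\<^bsub>L\<^esub>} \<and>
      module_isos R N (L\<lparr>carrier := K\<rparr>) \<noteq> {})"

text \<open>The objects of \<open>add\<^sub>R(M)\<close> whose elements have type \<^typ>\<open>'n\<close>.\<close>

definition add_cat ::
    "('r, 'c) ring_scheme \<Rightarrow> ('r, 'm, 'd) module_scheme \<Rightarrow> ('r, 'n) module set"
  where "add_cat R M =
    {N. left_module R N \<and> (\<exists>n::nat. is_direct_summand R N (direct_sum_copies {..<n} M))}"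

definition finitely_generated ::
    "('r, 'c) ring_scheme \<Rightarrow> ('r, 'm, 'd) module_scheme \<Rightarrow> bool"
  where "finitely_generated R M \<longleftrightarrow>
    (\<exists>X. finite X \<and> X \<subseteq> carrier M \<and> (\<forall>H. submodule H R M \<and> X \<subseteq> H \<longrightarrow> H = carrier M))"

text \<open>
  Projective modules are the direct summands of free modules.  Every module is a quotient of
  the free module on its own carrier, so index sets contained in the type of its elements suffice.
\<close>

definition projective ::
    "('r, 'c) ring_scheme \<Rightarrow> ('r, 'm, 'd) module_scheme \<Rightarrow> bool"
  where "projective R M \<longleftrightarrow>
    (\<exists>I :: 'm set. is_direct_summand R M (direct_sum_copies I (regular_module R)))"

definition proj_cat :: "('r, 'c) ring_scheme \<Rightarrow> ('r, 'm) module set"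
  where "proj_cat R = {P. left_module R P \<and> finitely_generated R P \<and> projective R P}"

section \<open>Frobenius extensions\<close>

text \<open>
  \<open>Hom\<^sub>R(A, R)\<close> is formed from the \<open>R\<close>-\<open>A\<close>-bimodule \<open>A\<close> and the \<open>R\<close>-\<open>R\<close>-bimodule \<open>R\<close>,
  which gives the actions \<open>(a f)(x) = f(x a)\<close> and \<open>(f r)(x) = f(x) r\<close>.
\<close>

definition frobenius_extension ::
    "('r, 'c) ring_scheme \<Rightarrow> ('a, 'd) ring_scheme \<Rightarrow> ('r \<Rightarrow> 'a) \<Rightarrow> bool"
  where "frobenius_extension R A h \<longleftrightarrow>
    ring R \<and> ring A \<and> h \<in> ring_hom R A \<and>
    restrict_scalars h (regular_module A) \<in> proj_cat R \<and>
    bimodule_isos A R (right_extension_bimodule h A)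
      (hom_bimodule R (left_extension_bimodule h A) (right_extension_bimodule (\<lambda>r. r) R)) \<noteq> {}"

section \<open>Tensor products\<close>

text \<open>
  \<open>M \<otimes>\<^sub>R N\<close> is the quotient of the free abelian group on \<open>M \<times> N\<close> by the usual relations; only
  the right action on \<open>M\<close> and the left action on \<open>N\<close> are used for the underlying group.
\<close>

definition tensor_relations ::
    "('r, 'c) ring_scheme \<Rightarrow> ('a, 'r, 'm, 'd) bimodule_scheme \<Rightarrow> ('r, 'n, 'e) module_scheme
      \<Rightarrow> ('m \<times> 'n \<Rightarrow>\<^sub>0 int) set"
  where "tensor_relations R M N =
    {frag_of (x \<oplus>\<^bsub>M\<^esub> x', y) - frag_of (x, y) - frag_of (x', y) | x x' y.
       x \<in> carrier M \<and> x' \<in> carrier M \<and> y \<in> carrier N} \<union>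
    {frag_of (x, y \<oplus>\<^bsub>N\<^esub> y') - frag_of (x, y) - frag_of (x, y') | x y y'.
       x \<in> carrier M \<and> y \<in> carrier N \<and> y' \<in> carrier N} \<union>
    {frag_of (rsmult M x r, y) - frag_of (x, r \<odot>\<^bsub>N\<^esub> y) | x r y.
       x \<in> carrier M \<and> r \<in> carrier R \<and> y \<in> carrier N}"

abbreviation free_pairs ::
    "('a, 'r, 'm, 'd) bimodule_scheme \<Rightarrow> ('r, 'n, 'e) module_scheme
      \<Rightarrow> ('m \<times> 'n \<Rightarrow>\<^sub>0 int) monoid"
  where "free_pairs M N \<equiv> free_Abelian_group (carrier M \<times> carrier N)"

definition tensor_kernel ::
    "('r, 'c) ring_scheme \<Rightarrow> ('a, 'r, 'm, 'd) bimodule_scheme \<Rightarrow> ('r, 'n, 'e) module_scheme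
      \<Rightarrow> ('m \<times> 'n \<Rightarrow>\<^sub>0 int) set"
  where "tensor_kernel R M N = generate (free_pairs M N) (tensor_relations R M N)"

definition tensor_group ::
    "('r, 'c) ring_scheme \<Rightarrow> ('a, 'r, 'm, 'd) bimodule_scheme \<Rightarrow> ('r, 'n, 'e) module_scheme
      \<Rightarrow> ('m \<times> 'n \<Rightarrow>\<^sub>0 int) set monoid"
  where "tensor_group R M N = free_pairs M N Mod tensor_kernel R M N"

text \<open>
  The map \<open>f \<otimes> g : M \<otimes>\<^sub>R N \<rightarrow> M' \<otimes>\<^sub>R N'\<close>.  The union is over representatives \<open>c\<close> of the
  class \<open>X\<close>; for homomorphisms \<open>f\<close> and \<open>g\<close> they all yield the same coset.
\<close>

definition tensor_map ::
    "('r, 'c) ring_scheme \<Rightarrow>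
      ('a, 'r, 'm, 'd) bimodule_scheme \<Rightarrow> ('r, 'n, 'e) module_scheme \<Rightarrow>
      ('b, 'r, 'k, 'f) bimodule_scheme \<Rightarrow> ('r, 'l, 'g) module_scheme \<Rightarrow>
      ('m \<Rightarrow> 'k) \<Rightarrow> ('n \<Rightarrow> 'l) \<Rightarrow>
      ('m \<times> 'n \<Rightarrow>\<^sub>0 int) set \<Rightarrow> ('k \<times> 'l \<Rightarrow>\<^sub>0 int) set"
  where "tensor_map R M N M' N' f g =
    (\<lambda>X\<in>carrier (tensor_group R M N).
      \<Union>c\<in>X. tensor_kernel R M' N' #>\<^bsub>free_pairs M' N'\<^esub>
        frag_extend (\<lambda>(x, y). frag_of (f x, g y)) c)"

text \<open>The left module structure of \<open>M \<otimes>\<^sub>R N\<close> for an \<open>A\<close>-\<open>R\<close>-bimodule \<open>M\<close>.\<close>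

definition tensor ::
    "('r, 'c) ring_scheme \<Rightarrow> ('a, 'r, 'm, 'd) bimodule_scheme \<Rightarrow> ('r, 'n, 'e) module_scheme
      \<Rightarrow> ('a, ('m \<times> 'n \<Rightarrow>\<^sub>0 int) set) module"
  where "tensor R M N =
    \<lparr>carrier = carrier (tensor_group R M N), mult = undefined, one = undefined,
     zero = one (tensor_group R M N), add = mult (tensor_group R M N),
     smult = (\<lambda>a. tensor_map R M N M N (\<lambda>x. a \<odot>\<^bsub>M\<^esub> x) (\<lambda>y. y))\<rparr>"

section \<open>Functors between module categories and natural isomorphisms\<close>

text \<open>\<open>mor F M N f\<close> is the image of the morphism \<open>f : M \<rightarrow> N\<close>.\<close>

record ('r, 'm, 's, 'n) mod_functor =
  obj :: "('r, 'm) module \<Rightarrow> ('s, 'n) module"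
  mor :: "('r, 'm) module \<Rightarrow> ('r, 'm) module \<Rightarrow> ('m \<Rightarrow> 'm) \<Rightarrow> 'n \<Rightarrow> 'n"

definition tensor_functor ::
    "('r, 'c) ring_scheme \<Rightarrow> ('a, 'r, 'm, 'd) bimodule_scheme
      \<Rightarrow> ('r, 'n, 'a, ('m \<times> 'n \<Rightarrow>\<^sub>0 int) set) mod_functor"
  where "tensor_functor R M =
    \<lparr>obj = tensor R M, mor = (\<lambda>N N' g. tensor_map R M N M N' (\<lambda>x. x) g)\<rparr>"

definition hom_functor ::
    "('r, 'c) ring_scheme \<Rightarrow> ('r, 's, 't, 'd) bimodule_scheme
      \<Rightarrow> ('r, 'm, 's, 't \<Rightarrow> 'm) mod_functor"
  where "hom_functor R T =
    \<lparr>obj = hom_module R T,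
     mor = (\<lambda>M N f. \<lambda>h\<in>module_homs R T M. compose (carrier T) f h)\<rparr>"

definition res_functor :: "('r \<Rightarrow> 'a) \<Rightarrow> ('a, 'm, 'r, 'm) mod_functor"
  where "res_functor h = \<lparr>obj = restrict_scalars h, mor = (\<lambda>M N f. f)\<rparr>"

definition comp_functor ::
    "('s, 'n, 'q, 'k) mod_functor \<Rightarrow> ('r, 'm, 's, 'n) mod_functor
      \<Rightarrow> ('r, 'm, 'q, 'k) mod_functor"  (infixr \<open>\<circ>\<^sub>F\<close> 55)
  where "G \<circ>\<^sub>F F =
    \<lparr>obj = (\<lambda>M. obj G (obj F M)),
     mor = (\<lambda>M N f. mor G (obj F M) (obj F N) (mor F M N f))\<rparr>"

text \<open>
  \<open>F\<close> and \<open>G\<close> are naturally isomorphic as functors from the full subcategory \<open>C\<close> of left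
  \<open>R\<close>-modules to left \<open>S\<close>-modules.  The type \<^typ>\<open>'m\<close> of elements of the objects plays the
  role of a universe; it is arbitrary, and any two types embed into their sum type.
\<close>

definition naturally_isomorphic ::
    "('r, 'c) ring_scheme \<Rightarrow> ('r, 'm) module set \<Rightarrow> ('s, 'd) ring_scheme
      \<Rightarrow> ('r, 'm, 's, 'n) mod_functor \<Rightarrow> ('r, 'm, 's, 'k) mod_functor \<Rightarrow> bool"
  where "naturally_isomorphic R C S F G \<longleftrightarrow>
    (\<exists>\<eta> :: ('r, 'm) module \<Rightarrow> 'n \<Rightarrow> 'k.
      (\<forall>M\<in>C. \<eta> M \<in> module_isos S (obj F M) (obj G M)) \<and>
      (\<forall>M\<in>C. \<forall>N\<in>C. \<forall>f\<in>module_homs R M N. \<forall>x\<in>carrier (obj F M).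
        \<eta> N (mor F M N f x) = mor G M N f (\<eta> M x)))"

end

(*
  Both sides of (i) represent U tensored over S with P, and (ii) is the adjunction between
  extension and restriction of scalars.  For (iii) and (iv), membership of N in add(M) gives finitely
  many maps i_k : M -> N and p_k : N -> M with sum_k i_k p_k = id.  With these the canonical map
  b (x) f |-> (1 (x) f) b of (iii) has the inverse g |-> sum_k (1 (x) p_k) g (x) i_k.  In (iv), take
  N = U and M = T; then t (x) q |-> (1 (x) t) (x) q has the inverse
  u (x) q |-> sum_k p_k(u) (x) beta_k q, where beta_k in B is the A-linear extension of i_k.
*)
theory Submission
  imports Defs
begin

text \<open>Each canonical map is given by a formula without choices, so naturality is checked on
  generators; a dual basis enters only when an inverse is needed. What differs is the cost of that
  inverse. In (iii) it starts at a Hom group, so any formula defines it. In (iv) it starts at a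
  tensor product over B, and the formula must be shown B-balanced although the maps p_k are only
  R-linear. The way out is to transpose the dual basis: for R-linear h : T -> U the composites p_k h
  lie in S, and the A-linear extension of h is the sum of the products \<rho>(p_k h) beta_k in B, so
  a scalar from B can be traded for scalars from S. In (i) the tensor product of U and P over S is
  never formed; the inverse comes from regarding Hom_A(U, X), with X = A (x) (T (x) P), as a left
  B-module and mapping B (x) P into it. Equalities of A-linear maps out of A (x) M are tested on the
  elements 1 (x) x. Products in S and B are reversed composites, so b s in B is \<rho>(s) after
  b.\<close>

lemma with_right_action_simps [simp]:
  "carrier (with_right_action M act) = carrier M"
  "zero (with_right_action M act) = zero M"
  "add (with_right_action M act) = add M"
  "smult (with_right_action M act) = smult M"
  "rsmult (with_right_action M act) = act"
  by (simp_all add: with_right_action_def)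

lemma regular_module_simps [simp]:
  "carrier (regular_module R) = carrier R"
  "zero (regular_module R) = zero R"
  "add (regular_module R) = add R"
  "smult (regular_module R) = mult R"
  by (simp_all add: regular_module_def)

lemma restrict_scalars_simps [simp]:
  "carrier (restrict_scalars h M) = carrier M"
  "zero (restrict_scalars h M) = zero M"
  "add (restrict_scalars h M) = add M"
  "smult (restrict_scalars h M) r = smult M (h r)"
  by (simp_all add: restrict_scalars_def)

lemma right_extension_bimodule_simps [simp]:
  "carrier (right_extension_bimodule h A) = carrier A"
  "zero (right_extension_bimodule h A) = zero A"
  "add (right_extension_bimodule h A) = add A"
  "smult (right_extension_bimodule h A) = mult A"
  "rsmult (right_extension_bimodule h A) x r = x \<otimes>\<^bsub>A\<^esub> h r"
  by (simp_all add: right_extension_bimodule_def)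

lemma hom_module_simps [simp]:
  "carrier (hom_module R T M) = module_homs R T M"
  "zero (hom_module R T M) = (\<lambda>t\<in>carrier T. \<zero>\<^bsub>M\<^esub>)"
  "add (hom_module R T M) f g = (\<lambda>t\<in>carrier T. f t \<oplus>\<^bsub>M\<^esub> g t)"
  "smult (hom_module R T M) s f = (\<lambda>t\<in>carrier T. f (rsmult T t s))"
  by (simp_all add: hom_module_def)

lemma End_ring_simps [simp]:
  "carrier (End_ring R T) = module_homs R T T"
  "zero (End_ring R T) = (\<lambda>t\<in>carrier T. \<zero>\<^bsub>T\<^esub>)"
  "one (End_ring R T) = (\<lambda>t\<in>carrier T. t)"
  "add (End_ring R T) f g = (\<lambda>t\<in>carrier T. f t \<oplus>\<^bsub>T\<^esub> g t)"
  "mult (End_ring R T) f g = compose (carrier T) g f"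
  by (simp_all add: End_ring_def)

lemma End_bimodule_simps [simp]:
  "carrier (End_bimodule T) = carrier T"
  "zero (End_bimodule T) = zero T"
  "add (End_bimodule T) = add T"
  "smult (End_bimodule T) = smult T"
  "rsmult (End_bimodule T) t s = s t"
  by (simp_all add: End_bimodule_def)

lemma direct_sum_copies_simps [simp]:
  "carrier (direct_sum_copies I M) =
    {f \<in> I \<rightarrow>\<^sub>E carrier M. finite {i\<in>I. f i \<noteq> \<zero>\<^bsub>M\<^esub>}}"
  "zero (direct_sum_copies I M) = (\<lambda>i\<in>I. \<zero>\<^bsub>M\<^esub>)"
  "add (direct_sum_copies I M) f g = (\<lambda>i\<in>I. f i \<oplus>\<^bsub>M\<^esub> g i)"
  "smult (direct_sum_copies I M) r f = (\<lambda>i\<in>I. r \<odot>\<^bsub>M\<^esub> f i)"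
  by (simp_all add: direct_sum_copies_def)

lemma tensor_simps:
  "carrier (tensor R M N) = carrier (tensor_group R M N)"
  "zero (tensor R M N) = one (tensor_group R M N)"
  "add (tensor R M N) = mult (tensor_group R M N)"
  "smult (tensor R M N) a = tensor_map R M N M N (\<lambda>x. a \<odot>\<^bsub>M\<^esub> x) (\<lambda>y. y)"
  by (simp_all add: tensor_def)

section \<open>Additive and linear maps\<close>

text \<open>Additivity is kept apart from linearity: the maps below are linear over different rings,
  and finite sums and pure tensors only see the additive structure. No extensionality is imposed, so
  composites written as lambda terms qualify.\<close>

abbreviation add_hom :: "('a, 'c) ring_scheme \<Rightarrow> ('b, 'd) ring_scheme \<Rightarrow> ('a \<Rightarrow> 'b) set"
  where "add_hom M N \<equiv> hom (add_monoid M) (add_monoid N)"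

lemma add_homI:
  assumes "\<And>x. x \<in> carrier M \<Longrightarrow> f x \<in> carrier N"
    and "\<And>x y. \<lbrakk>x \<in> carrier M; y \<in> carrier M\<rbrakk> \<Longrightarrow> f (x \<oplus>\<^bsub>M\<^esub> y) = f x \<oplus>\<^bsub>N\<^esub> f y"
  shows "f \<in> add_hom M N"
  using assms by (auto intro: homI)

lemma add_hom_closed: "f \<in> add_hom M N \<Longrightarrow> x \<in> carrier M \<Longrightarrow> f x \<in> carrier N"
  by (auto simp: hom_def)

lemma add_hom_add:
  "\<lbrakk>f \<in> add_hom M N; x \<in> carrier M; y \<in> carrier M\<rbrakk> \<Longrightarrow> f (x \<oplus>\<^bsub>M\<^esub> y) = f x \<oplus>\<^bsub>N\<^esub> f y"
  by (auto simp: hom_def)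

lemma add_hom_zero:
  assumes "f \<in> add_hom M N" "abelian_group M" "abelian_group N"
  shows "f \<zero>\<^bsub>M\<^esub> = \<zero>\<^bsub>N\<^esub>"
  using hom_one[OF assms(1)] assms(2,3)[THEN abelian_group.a_group] by simp

lemma add_hom_compose:
  "\<lbrakk>f \<in> add_hom L M; g \<in> add_hom M N\<rbrakk> \<Longrightarrow> (\<lambda>x. g (f x)) \<in> add_hom L N"
  by (intro add_homI) (simp_all add: add_hom_closed add_hom_add)

lemma add_hom_finsum:
  assumes f: "f \<in> add_hom M N" and M: "abelian_group M" and N: "abelian_group N"
    and "finite I" and "\<And>i. i \<in> I \<Longrightarrow> g i \<in> carrier M"
  shows "f (finsum M g I) = finsum N (\<lambda>i. f (g i)) I"
proof -
  interpret M: abelian_group M by fact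
  interpret N: abelian_group N by fact
  show ?thesis
    using assms(4,5)
  proof (induction I rule: finite_induct)
    case empty
    then show ?case using add_hom_zero[OF f M N] by simp
  next
    case (insert i I)
    then show ?case
      by (simp add: Pi_def add_hom_add[OF f] add_hom_closed[OF f])
  qed
qed

text \<open>Inverses built from a dual basis are finite sums of additive maps; this gives their
  additivity.\<close>

lemma finsum_add_hom:
  assumes "abelian_group N" and "\<And>i. i \<in> I \<Longrightarrow> f i \<in> add_hom M N"
  shows "(\<lambda>x. finsum N (\<lambda>i. f i x) I) \<in> add_hom M N"
proof -
  interpret N: abelian_group N by fact
  have closed: "f i x \<in> carrier N" if "i \<in> I" "x \<in> carrier M" for i x
    using assms(2)[OF that(1)] that(2) by (rule add_hom_closed)
  have add: "f i (x \<oplus>\<^bsub>M\<^esub> y) = f i x \<oplus>\<^bsub>N\<^esub> f i y" if "i \<in> I" "x \<in> carrier M" "y \<in> carrier M" for i x y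
    using assms(2)[OF that(1)] that(2,3) by (rule add_hom_add)
  show ?thesis
  proof (rule add_homI)
    show "finsum N (\<lambda>i. f i x) I \<in> carrier N" if "x \<in> carrier M" for x
      using that closed by (intro N.finsum_closed) auto
    show "finsum N (\<lambda>i. f i (x \<oplus>\<^bsub>M\<^esub> y)) I = finsum N (\<lambda>i. f i x) I \<oplus>\<^bsub>N\<^esub> finsum N (\<lambda>i. f i y) I"
      if "x \<in> carrier M" "y \<in> carrier M" for x y
    proof -
      have "finsum N (\<lambda>i. f i (x \<oplus>\<^bsub>M\<^esub> y)) I = finsum N (\<lambda>i. f i x \<oplus>\<^bsub>N\<^esub> f i y) I"
        using that closed add by (intro N.finsum_cong') auto
      also have "\<dots> = finsum N (\<lambda>i. f i x) I \<oplus>\<^bsub>N\<^esub> finsum N (\<lambda>i. f i y) I"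
        using that closed by (intro N.finsum_addf) auto
      finally show ?thesis .
    qed
  qed
qed

lemma module_homsI:
  assumes "f \<in> add_hom M N" "f \<in> extensional (carrier M)"
    and "\<And>r x. \<lbrakk>r \<in> carrier R; x \<in> carrier M\<rbrakk> \<Longrightarrow> f (r \<odot>\<^bsub>M\<^esub> x) = r \<odot>\<^bsub>N\<^esub> f x"
  shows "f \<in> module_homs R M N"
  using assms by (auto simp: module_homs_def hom_def PiE_def)

lemma module_homs_add_hom: "f \<in> module_homs R M N \<Longrightarrow> f \<in> add_hom M N"
  by (auto simp: module_homs_def hom_def PiE_def)

lemma module_homs_extensional: "f \<in> module_homs R M N \<Longrightarrow> f \<in> extensional (carrier M)"
  by (auto simp: module_homs_def PiE_def)

lemma module_homs_smult:
  "\<lbrakk>f \<in> module_homs R M N; r \<in> carrier R; x \<in> carrier M\<rbrakk> \<Longrightarrow> f (r \<odot>\<^bsub>M\<^esub> x) = r \<odot>\<^bsub>N\<^esub> f x"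
  by (auto simp: module_homs_def)

lemmas module_homs_closed = add_hom_closed[OF module_homs_add_hom]
  and module_homs_add = add_hom_add[OF module_homs_add_hom]

lemma module_homs_eqI:
  assumes "f \<in> module_homs R M N" "g \<in> module_homs R M N"
    and "\<And>x. x \<in> carrier M \<Longrightarrow> f x = g x"
  shows "f = g"
  using assms module_homs_extensional by (blast intro: extensionalityI)

lemma module_homs_compose:
  assumes f: "f \<in> module_homs R L M" and g: "g \<in> module_homs R M N" and "left_module R L"
  shows "compose (carrier L) g f \<in> module_homs R L N"
proof -
  interpret L: left_module R L by fact
  show ?thesis
    using f g by (intro module_homsI add_homI)
      (auto simp: compose_def module_homs_closed module_homs_add module_homs_smult L.smult_closed)
qed

text \<open>The inverse \<open>g\<close> is only a map between the carriers, since its linearity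
  follows from that of \<open>f\<close>. An inverse is thus only asked to be well defined and
  two-sided.\<close>

lemma module_isosI:
  assumes f: "f \<in> module_homs R M N" and "\<And>y. y \<in> carrier N \<Longrightarrow> g y \<in> carrier M"
    and "\<And>x. x \<in> carrier M \<Longrightarrow> g (f x) = x" "\<And>y. y \<in> carrier N \<Longrightarrow> f (g y) = y"
  shows "f \<in> module_isos R M N"
  unfolding module_isos_def
  using assms module_homs_closed[OF f] by (auto intro!: bij_betwI[of _ _ _ g])

section \<open>Bimodules and tensor products\<close>

text \<open>The bimodule records carry no laws. The compatibility \<open>smult_rsmult\<close> of the
  two actions is what makes the left action descend to tensor products, and what makes f(t s) linear
  in t for a linear f.\<close>

locale bimod = left_module A M + S: ring S
  for A :: "('a, 'c) ring_scheme" and S :: "('s, 'd) ring_scheme"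
    and M :: "('a, 's, 'm, 'e) bimodule_scheme" (structure) +
  assumes rsmult_closed: "\<lbrakk>x \<in> carrier M; s \<in> carrier S\<rbrakk> \<Longrightarrow> rsmult M x s \<in> carrier M"
    and rsmult_l_distr: "\<lbrakk>x \<in> carrier M; y \<in> carrier M; s \<in> carrier S\<rbrakk>
      \<Longrightarrow> rsmult M (x \<oplus>\<^bsub>M\<^esub> y) s = rsmult M x s \<oplus>\<^bsub>M\<^esub> rsmult M y s"
    and rsmult_r_distr: "\<lbrakk>x \<in> carrier M; s \<in> carrier S; t \<in> carrier S\<rbrakk>
      \<Longrightarrow> rsmult M x (s \<oplus>\<^bsub>S\<^esub> t) = rsmult M x s \<oplus>\<^bsub>M\<^esub> rsmult M x t"
    and rsmult_assoc: "\<lbrakk>x \<in> carrier M; s \<in> carrier S; t \<in> carrier S\<rbrakk>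
      \<Longrightarrow> rsmult M x (s \<otimes>\<^bsub>S\<^esub> t) = rsmult M (rsmult M x s) t"
    and rsmult_one: "x \<in> carrier M \<Longrightarrow> rsmult M x \<one>\<^bsub>S\<^esub> = x"
    and smult_rsmult: "\<lbrakk>a \<in> carrier A; x \<in> carrier M; s \<in> carrier S\<rbrakk>
      \<Longrightarrow> a \<odot>\<^bsub>M\<^esub> rsmult M x s = rsmult M (a \<odot>\<^bsub>M\<^esub> x) s"

definition tens ::
    "('r, 'c) ring_scheme \<Rightarrow> ('a, 'r, 'm, 'd) bimodule_scheme \<Rightarrow> ('r, 'n, 'e) module_scheme
      \<Rightarrow> 'm \<Rightarrow> 'n \<Rightarrow> ('m \<times> 'n \<Rightarrow>\<^sub>0 int) set"
  where "tens R M N x y = tensor_kernel R M N #>\<^bsub>free_pairs M N\<^esub> frag_of (x, y)"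

definition balanced_maps ::
    "('r, 'c) ring_scheme \<Rightarrow> ('a, 'r, 'm, 'd) bimodule_scheme \<Rightarrow> ('r, 'n, 'e) module_scheme
      \<Rightarrow> ('h, 'f) ring_scheme \<Rightarrow> ('m \<Rightarrow> 'n \<Rightarrow> 'h) set"
  where "balanced_maps R M N H = {\<beta>.
    (\<forall>y\<in>carrier N. (\<lambda>x. \<beta> x y) \<in> add_hom M H) \<and> (\<forall>x\<in>carrier M. \<beta> x \<in> add_hom N H) \<and>
    (\<forall>x\<in>carrier M. \<forall>r\<in>carrier R. \<forall>y\<in>carrier N. \<beta> (rsmult M x r) y = \<beta> x (r \<odot>\<^bsub>N\<^esub> y))}"

text \<open>For balanced \<open>\<beta>\<close> the choice is unambiguous: additive maps that agree
  on pure tensors agree, and extensionality fixes the values elsewhere. Extensionality also lets a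
  linear lift be an element of \<open>module_homs\<close>.\<close>

definition tensor_lift ::
    "('r, 'c) ring_scheme \<Rightarrow> ('a, 'r, 'm, 'd) bimodule_scheme \<Rightarrow> ('r, 'n, 'e) module_scheme
      \<Rightarrow> ('h, 'f) ring_scheme \<Rightarrow> ('m \<Rightarrow> 'n \<Rightarrow> 'h) \<Rightarrow> ('m \<times> 'n \<Rightarrow>\<^sub>0 int) set \<Rightarrow> 'h"
  where "tensor_lift R M N H \<beta> = (SOME h. h \<in> add_hom (tensor R M N) H \<and>
    h \<in> extensional (carrier (tensor R M N)) \<and>
    (\<forall>x\<in>carrier M. \<forall>y\<in>carrier N. h (tens R M N x y) = \<beta> x y))"

lemma balanced_mapsI:
  assumes "\<And>x y. \<lbrakk>x \<in> carrier M; y \<in> carrier N\<rbrakk> \<Longrightarrow> \<beta> x y \<in> carrier H"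
    and "\<And>x x' y. \<lbrakk>x \<in> carrier M; x' \<in> carrier M; y \<in> carrier N\<rbrakk>
      \<Longrightarrow> \<beta> (x \<oplus>\<^bsub>M\<^esub> x') y = \<beta> x y \<oplus>\<^bsub>H\<^esub> \<beta> x' y"
    and "\<And>x y y'. \<lbrakk>x \<in> carrier M; y \<in> carrier N; y' \<in> carrier N\<rbrakk>
      \<Longrightarrow> \<beta> x (y \<oplus>\<^bsub>N\<^esub> y') = \<beta> x y \<oplus>\<^bsub>H\<^esub> \<beta> x y'"
    and "\<And>x r y. \<lbrakk>x \<in> carrier M; r \<in> carrier R; y \<in> carrier N\<rbrakk>
      \<Longrightarrow> \<beta> (rsmult M x r) y = \<beta> x (r \<odot>\<^bsub>N\<^esub> y)"
  shows "\<beta> \<in> balanced_maps R M N H"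
  using assms by (auto simp: balanced_maps_def intro!: add_homI)

lemma balanced_maps_closed:
  "\<lbrakk>\<beta> \<in> balanced_maps R M N H; x \<in> carrier M; y \<in> carrier N\<rbrakk> \<Longrightarrow> \<beta> x y \<in> carrier H"
  by (auto simp: balanced_maps_def dest: add_hom_closed)

lemma
  assumes "\<beta> \<in> balanced_maps R M N H"
  shows balanced_maps_add_left: "\<lbrakk>x \<in> carrier M; x' \<in> carrier M; y \<in> carrier N\<rbrakk>
      \<Longrightarrow> \<beta> (x \<oplus>\<^bsub>M\<^esub> x') y = \<beta> x y \<oplus>\<^bsub>H\<^esub> \<beta> x' y"
    and balanced_maps_add_right: "\<lbrakk>x \<in> carrier M; y \<in> carrier N; y' \<in> carrier N\<rbrakk>
      \<Longrightarrow> \<beta> x (y \<oplus>\<^bsub>N\<^esub> y') = \<beta> x y \<oplus>\<^bsub>H\<^esub> \<beta> x y'"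
    and balanced_maps_balanced: "\<lbrakk>x \<in> carrier M; r \<in> carrier R; y \<in> carrier N\<rbrakk>
      \<Longrightarrow> \<beta> (rsmult M x r) y = \<beta> x (r \<odot>\<^bsub>N\<^esub> y)"
  using assms by (auto simp: balanced_maps_def hom_def)

section \<open>Generators and universal property of the tensor product\<close>

locale tensor_product = M: bimod A R M + N: left_module R N
  for A :: "('a, 'c) ring_scheme" and R :: "('r, 'd) ring_scheme"
    and M :: "('a, 'r, 'm, 'e) bimodule_scheme" and N :: "('r, 'n, 'f) module_scheme"
begin

lemma tensor_relations_subset: "tensor_relations R M N \<subseteq> carrier (free_pairs M N)"
proof -
  have diff: "a - b \<in> carrier (free_pairs M N)"
    if "a \<in> carrier (free_pairs M N)" "b \<in> carrier (free_pairs M N)" for a b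
    using that keys_diff[of a b] by auto
  show ?thesis
    unfolding tensor_relations_def
    by (auto intro!: diff simp del: carrier_free_Abelian_group_iff
        simp: M.rsmult_closed N.smult_closed)
qed

lemma tensor_kernel_subgroup: "subgroup (tensor_kernel R M N) (free_pairs M N)"
  unfolding tensor_kernel_def
  by (rule group.generate_is_subgroup[OF group_free_Abelian_group tensor_relations_subset])

lemma tensor_kernel_normal: "tensor_kernel R M N \<lhd> free_pairs M N"
  using tensor_kernel_subgroup comm_group.normal_iff_subgroup[OF abelian_free_Abelian_group] by blast

lemma comm_group_tensor: "comm_group (tensor_group R M N)"
  unfolding tensor_group_def
  by (rule comm_group.abelian_FactGroup[OF abelian_free_Abelian_group tensor_kernel_subgroup])

sublocale T: abelian_group "tensor R M N"
proof -
  interpret comm_group "tensor_group R M N" by (rule comm_group_tensor)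
  show "abelian_group (tensor R M N)"
    by (rule abelian_groupI) (auto simp: tensor_simps m_ac intro: l_inv_ex)
qed

abbreviation coset where "coset c \<equiv> tensor_kernel R M N #>\<^bsub>free_pairs M N\<^esub> c"

lemma coset_closed: "c \<in> carrier (free_pairs M N) \<Longrightarrow> coset c \<in> carrier (tensor R M N)"
  by (auto simp: tensor_simps tensor_group_def FactGroup_def RCOSETS_def)

lemma coset_add:
  "\<lbrakk>c \<in> carrier (free_pairs M N); d \<in> carrier (free_pairs M N)\<rbrakk>
    \<Longrightarrow> coset (c + d) = coset c \<oplus>\<^bsub>tensor R M N\<^esub> coset d"
  using normal.rcos_sum[OF tensor_kernel_normal, of c d]
  by (simp add: tensor_simps tensor_group_def FactGroup_def del: carrier_free_Abelian_group_iff)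

lemma coset_cases:
  assumes "w \<in> carrier (tensor R M N)"
  obtains c where "c \<in> carrier (free_pairs M N)" "w = coset c"
  using assms by (auto simp: tensor_simps tensor_group_def FactGroup_def RCOSETS_def)

lemma coset_eqI:
  assumes "c \<in> carrier (free_pairs M N)" "d \<in> carrier (free_pairs M N)"
    and "c - d \<in> tensor_kernel R M N"
  shows "coset c = coset d"
proof -
  have "c \<in> coset d"
    using assms(3) unfolding r_coset_def by (auto intro!: bexI[of _ "c - d"])
  then show ?thesis
    using group.repr_independence[OF group_free_Abelian_group _ assms(2) tensor_kernel_subgroup]
    by metis
qed

lemma relation_in_kernel: "c \<in> tensor_relations R M N \<Longrightarrow> c \<in> tensor_kernel R M N"
  unfolding tensor_kernel_def by (rule generate.incl)

lemma frag_of_add_closed: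
  "\<lbrakk>x \<in> carrier M; y \<in> carrier N; x' \<in> carrier M; y' \<in> carrier N\<rbrakk>
    \<Longrightarrow> frag_of (x, y) + frag_of (x', y') \<in> carrier (free_pairs M N)"
  using keys_add[of "frag_of (x, y)" "frag_of (x', y')"] by auto

lemma tens_closed [simp]:
  "\<lbrakk>x \<in> carrier M; y \<in> carrier N\<rbrakk> \<Longrightarrow> tens R M N x y \<in> carrier (tensor R M N)"
  unfolding tens_def by (rule coset_closed) auto

lemma tens_add_left:
  assumes "x \<in> carrier M" "x' \<in> carrier M" "y \<in> carrier N"
  shows "tens R M N (x \<oplus>\<^bsub>M\<^esub> x') y = tens R M N x y \<oplus>\<^bsub>tensor R M N\<^esub> tens R M N x' y"
proof -
  have "coset (frag_of (x \<oplus>\<^bsub>M\<^esub> x', y)) = coset (frag_of (x, y) + frag_of (x', y))"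
    using assms
    by (intro coset_eqI relation_in_kernel frag_of_add_closed)
      (auto simp: tensor_relations_def diff_diff_eq[symmetric])
  also have "\<dots> = coset (frag_of (x, y)) \<oplus>\<^bsub>tensor R M N\<^esub> coset (frag_of (x', y))"
    using assms by (intro coset_add) auto
  finally show ?thesis by (simp add: tens_def)
qed

lemma tens_add_right:
  assumes "x \<in> carrier M" "y \<in> carrier N" "y' \<in> carrier N"
  shows "tens R M N x (y \<oplus>\<^bsub>N\<^esub> y') = tens R M N x y \<oplus>\<^bsub>tensor R M N\<^esub> tens R M N x y'"
proof -
  have "coset (frag_of (x, y \<oplus>\<^bsub>N\<^esub> y')) = coset (frag_of (x, y) + frag_of (x, y'))"
    using assms
    by (intro coset_eqI relation_in_kernel frag_of_add_closed)
      (auto simp: tensor_relations_def diff_diff_eq[symmetric])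
  also have "\<dots> = coset (frag_of (x, y)) \<oplus>\<^bsub>tensor R M N\<^esub> coset (frag_of (x, y'))"
    using assms by (intro coset_add) auto
  finally show ?thesis by (simp add: tens_def)
qed

lemma tens_balanced:
  assumes "x \<in> carrier M" "r \<in> carrier R" "y \<in> carrier N"
  shows "tens R M N (rsmult M x r) y = tens R M N x (r \<odot>\<^bsub>N\<^esub> y)"
  unfolding tens_def
  using assms M.rsmult_closed N.smult_closed
  by (intro coset_eqI relation_in_kernel) (auto simp: tensor_relations_def)

lemma tens_left_add_hom: "y \<in> carrier N \<Longrightarrow> (\<lambda>x. tens R M N x y) \<in> add_hom M (tensor R M N)"
  by (intro add_homI) (simp_all add: tens_add_left)

lemma tens_right_add_hom: "x \<in> carrier M \<Longrightarrow> tens R M N x \<in> add_hom N (tensor R M N)"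
  by (intro add_homI) (simp_all add: tens_add_right)

lemma tens_zero_left: "y \<in> carrier N \<Longrightarrow> tens R M N \<zero>\<^bsub>M\<^esub> y = \<zero>\<^bsub>tensor R M N\<^esub>"
  using add_hom_zero[OF tens_left_add_hom] M.abelian_group_axioms T.abelian_group_axioms by blast

text \<open>No case for zero or negatives is needed, because 0 = 0 (x) 0 and -(x (x) y) = (-x) (x)
  y: every element is a nonempty finite sum of pure tensors.\<close>

lemma tensor_induct [consumes 1, case_names tens add]:
  assumes "w \<in> carrier (tensor R M N)"
    and tens: "\<And>x y. \<lbrakk>x \<in> carrier M; y \<in> carrier N\<rbrakk> \<Longrightarrow> P (tens R M N x y)"
    and add: "\<And>v w. \<lbrakk>v \<in> carrier (tensor R M N); w \<in> carrier (tensor R M N); P v; P w\<rbrakk>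
      \<Longrightarrow> P (v \<oplus>\<^bsub>tensor R M N\<^esub> w)"
  shows "P w"
proof -
  have closed: "c - d \<in> carrier (free_pairs M N)" "- c \<in> carrier (free_pairs M N)"
    if "c \<in> carrier (free_pairs M N)" "d \<in> carrier (free_pairs M N)" for c d
    using that keys_diff[of c d] by auto
  have coset0: "coset 0 = \<zero>\<^bsub>tensor R M N\<^esub>"
    using coset_add[of 0 0] coset_closed[of 0] by auto
  have P0: "P (coset 0)"
    unfolding coset0
    using tens[of "\<zero>\<^bsub>M\<^esub>" "\<zero>\<^bsub>N\<^esub>"] tens_zero_left[of "\<zero>\<^bsub>N\<^esub>"] by auto
  \<comment> \<open>Induction on the free abelian group builds elements by differences, whereas
    \<open>P\<close> is closed only under sums; so the claim is carried for \<open>c\<close> and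
    \<open>- c\<close> together.\<close>
  have "P (coset c) \<and> P (coset (- c))"
    if "Poly_Mapping.keys c \<subseteq> carrier M \<times> carrier N" for c
    using that
  proof (induction c rule: free_Abelian_group_induct[consumes 1, case_names zero diff frag_of])
    case zero
    then show ?case using P0 by simp
  next
    case (diff c d)
    have "coset (c - d) = coset c \<oplus>\<^bsub>tensor R M N\<^esub> coset (- d)"
      "coset (- (c - d)) = coset d \<oplus>\<^bsub>tensor R M N\<^esub> coset (- c)"
      using coset_add[of c "- d"] coset_add[of d "- c"] diff by simp_all
    then show ?case
      using diff by (auto intro!: add coset_closed)
  next
    case (frag_of p)
    then obtain x y where p: "p = (x, y)" and x: "x \<in> carrier M" and y: "y \<in> carrier N" by auto
    have *: "frag_of p \<in> carrier (free_pairs M N)" using x y p by simp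
    \<comment> \<open>Both (-x) (x) y and the class of the negated generator are additive inverses
      of x (x) y, hence equal; so the negated generator is again a pure tensor.\<close>
    have "tens R M N (\<ominus>\<^bsub>M\<^esub> x) y \<oplus>\<^bsub>tensor R M N\<^esub> tens R M N x y = \<zero>\<^bsub>tensor R M N\<^esub>"
      using x y by (simp add: tens_add_left[symmetric] M.l_neg tens_zero_left)
    moreover have "coset (- frag_of p) \<oplus>\<^bsub>tensor R M N\<^esub> tens R M N x y = \<zero>\<^bsub>tensor R M N\<^esub>"
      unfolding tens_def p[symmetric] using closed(2)[OF * *] *
      by (subst coset_add[symmetric]) (simp_all add: coset0)
    ultimately have "coset (- frag_of p) = tens R M N (\<ominus>\<^bsub>M\<^esub> x) y"
      using x y coset_closed[OF closed(2)[OF * *]] T.add.inv_equality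
      by (metis M.a_inv_closed tens_closed)
    then show ?case
      using x y tens[of x y] tens[of "\<ominus>\<^bsub>M\<^esub> x" y] by (simp add: p tens_def)
  qed
  then show ?thesis
    using assms(1) by (elim coset_cases) auto
qed

text \<open>Only additivity is asked, so that the test on pure tensors also applies to inverses
  about which no linearity has been shown.\<close>

lemma tensor_add_hom_eq:
  assumes "f \<in> add_hom (tensor R M N) H" "g \<in> add_hom (tensor R M N) H"
    and "\<And>x y. \<lbrakk>x \<in> carrier M; y \<in> carrier N\<rbrakk> \<Longrightarrow> f (tens R M N x y) = g (tens R M N x y)"
    and "w \<in> carrier (tensor R M N)"
  shows "f w = g w"
  using assms(4)
  by (induction rule: tensor_induct) (simp_all add: assms(3) add_hom_add[OF assms(1)] add_hom_add[OF assms(2)])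

text \<open>Freeness extends \<open>\<beta>\<close> to the free abelian group. That
  \<open>\<beta>\<close> is balanced says that this extension kills the three families of relations,
  hence the subgroup they generate, and so it factors through the quotient.\<close>

lemma tensor_universal:
  assumes H: "abelian_group H" and \<beta>: "\<beta> \<in> balanced_maps R M N H"
  obtains h where "h \<in> add_hom (tensor R M N) H"
    "\<And>x y. \<lbrakk>x \<in> carrier M; y \<in> carrier N\<rbrakk> \<Longrightarrow> h (tens R M N x y) = \<beta> x y"
proof -
  interpret H: abelian_group H by fact
  have "(\<lambda>(x, y). \<beta> x y) ` (carrier M \<times> carrier N) \<subseteq> carrier (add_monoid H)"
    using balanced_maps_closed[OF \<beta>] by auto
  from comm_group.free_Abelian_group_universal[OF H.a_comm_group this]
  obtain h where h: "h \<in> hom (free_pairs M N) (add_monoid H)"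
    and h_of: "\<And>p. p \<in> carrier M \<times> carrier N \<Longrightarrow> h (frag_of p) = (\<lambda>(x, y). \<beta> x y) p"
    by metis
  interpret h: group_hom "free_pairs M N" "add_monoid H" h
    by (intro group_hom.intro group_hom_axioms.intro h H.a_group) simp
  have h_diff: "h (a - b) = h a \<ominus>\<^bsub>H\<^esub> h b"
    if "a \<in> carrier (free_pairs M N)" "b \<in> carrier (free_pairs M N)" for a b
  proof -
    have "a - b \<in> carrier (free_pairs M N)" using that keys_diff[of a b] by auto
    then have "h (a - b + b) = h (a - b) \<oplus>\<^bsub>H\<^esub> h b"
      using h.hom_mult[of "a - b" b] that by simp
    moreover have "h (a - b) \<in> carrier H" "h a \<in> carrier H" "h b \<in> carrier H"
      using that h.hom_closed \<open>a - b \<in> _\<close> by auto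
    ultimately show ?thesis by (simp add: H.minus_eq H.add.inv_solve_right)
  qed
  have diff: "a - b \<in> carrier (free_pairs M N)"
    if "a \<in> carrier (free_pairs M N)" "b \<in> carrier (free_pairs M N)" for a b
    using that keys_diff[of a b] by auto
  have cancel: "a \<oplus>\<^bsub>H\<^esub> b \<ominus>\<^bsub>H\<^esub> a \<ominus>\<^bsub>H\<^esub> b = \<zero>\<^bsub>H\<^esub>" if "a \<in> carrier H" "b \<in> carrier H" for a b
    using that by (simp add: H.minus_eq H.a_assoc H.a_lcomm[of b "\<ominus>\<^bsub>H\<^esub> a"] H.r_neg)
  have zero: "h c = \<zero>\<^bsub>H\<^esub>" if "c \<in> tensor_relations R M N" for c
    using that unfolding tensor_relations_def
    by (auto simp: h_diff diff h_of balanced_maps_add_left[OF \<beta>] balanced_maps_add_right[OF \<beta>]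
        balanced_maps_balanced[OF \<beta>] balanced_maps_closed[OF \<beta>] M.rsmult_closed N.smult_closed
        cancel H.minus_eq[of x x for x] H.r_neg simp del: carrier_free_Abelian_group_iff)
  have "tensor_kernel R M N \<subseteq> kernel (free_pairs M N) (add_monoid H) h"
    unfolding tensor_kernel_def
    using h.subgroup_kernel tensor_relations_subset zero
    by (intro group.generate_subgroup_incl group_free_Abelian_group) (auto simp: kernel_def simp del: carrier_free_Abelian_group_iff)
  from h.FactGroup_universal_kernel[OF tensor_kernel_normal this]
  obtain g where "g \<in> hom (free_pairs M N Mod tensor_kernel R M N) (add_monoid H)"
    and g: "\<And>c. c \<in> carrier (free_pairs M N) \<Longrightarrow> g (coset c) = h c" by metis
  then have "g \<in> add_hom (tensor R M N) H"
    by (simp add: hom_def tensor_simps tensor_group_def)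
  then show thesis
    using g h_of by (intro that[of g]) (auto simp: tens_def)
qed

lemma
  assumes H: "abelian_group H" and \<beta>: "\<beta> \<in> balanced_maps R M N H"
  shows tensor_lift_add_hom: "tensor_lift R M N H \<beta> \<in> add_hom (tensor R M N) H"
    and tensor_lift_extensional: "tensor_lift R M N H \<beta> \<in> extensional (carrier (tensor R M N))"
    and tensor_lift_tens: "\<lbrakk>x \<in> carrier M; y \<in> carrier N\<rbrakk>
      \<Longrightarrow> tensor_lift R M N H \<beta> (tens R M N x y) = \<beta> x y"
proof -
  obtain h where h: "h \<in> add_hom (tensor R M N) H"
    "\<And>x y. \<lbrakk>x \<in> carrier M; y \<in> carrier N\<rbrakk> \<Longrightarrow> h (tens R M N x y) = \<beta> x y"
    using tensor_universal[OF assms] by blast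
  let ?h = "restrict h (carrier (tensor R M N))"
  have "?h \<in> add_hom (tensor R M N) H"
    using h(1) by (intro add_homI) (auto simp: add_hom_closed add_hom_add)
  then have "\<exists>h. h \<in> add_hom (tensor R M N) H \<and> h \<in> extensional (carrier (tensor R M N)) \<and>
    (\<forall>x\<in>carrier M. \<forall>y\<in>carrier N. h (tens R M N x y) = \<beta> x y)"
    using h(2) by (intro exI[of _ ?h]) auto
  from someI_ex[OF this, folded tensor_lift_def]
  show "tensor_lift R M N H \<beta> \<in> add_hom (tensor R M N) H"
    "tensor_lift R M N H \<beta> \<in> extensional (carrier (tensor R M N))"
    "\<lbrakk>x \<in> carrier M; y \<in> carrier N\<rbrakk> \<Longrightarrow> tensor_lift R M N H \<beta> (tens R M N x y) = \<beta> x y"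
    by blast+
qed

end

section \<open>Functoriality of the tensor product\<close>

lemma tensor_relationsI:
  "\<lbrakk>x \<in> carrier M; x' \<in> carrier M; y \<in> carrier N\<rbrakk>
    \<Longrightarrow> frag_of (x \<oplus>\<^bsub>M\<^esub> x', y) - frag_of (x, y) - frag_of (x', y) \<in> tensor_relations R M N"
  "\<lbrakk>x \<in> carrier M; y \<in> carrier N; y' \<in> carrier N\<rbrakk>
    \<Longrightarrow> frag_of (x, y \<oplus>\<^bsub>N\<^esub> y') - frag_of (x, y) - frag_of (x, y') \<in> tensor_relations R M N"
  "\<lbrakk>x \<in> carrier M; r \<in> carrier R; y \<in> carrier N\<rbrakk>
    \<Longrightarrow> frag_of (rsmult M x r, y) - frag_of (x, r \<odot>\<^bsub>N\<^esub> y) \<in> tensor_relations R M N"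
  unfolding tensor_relations_def by blast+

text \<open>The content is that the union over representatives in \<open>tensor_map\<close>
  collapses to a single coset. The induced map of free groups sends relations to relations, as
  \<open>f\<close> and \<open>g\<close> respect addition and the action of \<open>R\<close>, and
  therefore kernel into kernel.\<close>

lemma
  fixes M :: "('a, 'r, 'm, 'e) bimodule_scheme" and N :: "('r, 'n, 'f) module_scheme"
    and M' :: "('b, 'r, 'k, 'g) bimodule_scheme" and N' :: "('r, 'l, 'h) module_scheme"
  assumes "tensor_product A R M N" and "tensor_product A' R M' N'"
    and f: "f \<in> add_hom M M'" and g: "g \<in> add_hom N N'"
    and f_rsmult: "\<And>x r. \<lbrakk>x \<in> carrier M; r \<in> carrier R\<rbrakk> \<Longrightarrow> f (rsmult M x r) = rsmult M' (f x) r"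
    and g_smult: "\<And>r y. \<lbrakk>r \<in> carrier R; y \<in> carrier N\<rbrakk> \<Longrightarrow> g (r \<odot>\<^bsub>N\<^esub> y) = r \<odot>\<^bsub>N'\<^esub> g y"
  shows tensor_map_add_hom: "tensor_map R M N M' N' f g \<in> add_hom (tensor R M N) (tensor R M' N')"
    and tensor_map_tens: "\<lbrakk>x \<in> carrier M; y \<in> carrier N\<rbrakk>
      \<Longrightarrow> tensor_map R M N M' N' f g (tens R M N x y) = tens R M' N' (f x) (g y)"
proof -
  interpret P: tensor_product A R M N by fact
  interpret P': tensor_product A' R M' N' by fact
  define \<phi> where "\<phi> = frag_extend (\<lambda>(x, y). frag_of (f x, g y))"
  have \<phi>_of [simp]: "\<phi> (frag_of (x, y)) = frag_of (f x, g y)" for x y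
    by (simp add: \<phi>_def)
  have closed: "\<phi> c \<in> carrier (free_pairs M' N')" if "c \<in> carrier (free_pairs M N)" for c
  proof -
    have "Poly_Mapping.keys (\<phi> c) \<subseteq> (\<Union>(x, y)\<in>Poly_Mapping.keys c. Poly_Mapping.keys (frag_of (f x, g y)))"
      using keys_frag_extend[of "\<lambda>(x, y). frag_of (f x, g y)" c] by (simp add: \<phi>_def case_prod_unfold)
    also have "\<dots> \<subseteq> (\<Union>(x, y)\<in>carrier M \<times> carrier N. {(f x, g y)})"
      using that by auto
    also have "\<dots> \<subseteq> carrier M' \<times> carrier N'"
      using add_hom_closed[OF f] add_hom_closed[OF g] by auto
    finally show ?thesis by simp
  qed
  have rel: "\<phi> c \<in> tensor_relations R M' N'" if "c \<in> tensor_relations R M N" for c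
  proof -
    have \<phi>_diff: "\<phi> (c - d) = \<phi> c - \<phi> d" for c d by (simp add: \<phi>_def frag_extend_diff)
    show ?thesis
      using that unfolding tensor_relations_def[of R M N]
      by (auto simp: \<phi>_diff add_hom_add[OF f] add_hom_add[OF g] f_rsmult g_smult
          add_hom_closed[OF f] add_hom_closed[OF g] intro!: tensor_relationsI)
  qed
  have ker: "\<phi> c \<in> tensor_kernel R M' N'" if "c \<in> tensor_kernel R M N" for c
    using that unfolding tensor_kernel_def
  proof (induction rule: generate.induct)
    case one
    then show ?case using generate.one[of "free_pairs M' N'"] by (simp add: \<phi>_def)
  next
    case (incl c)
    then show ?case by (intro generate.incl rel)
  next
    case (inv c)
    have "c \<in> carrier (free_pairs M N)" "\<phi> c \<in> carrier (free_pairs M' N')"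
      using inv P.tensor_relations_subset closed by blast+
    then show ?case
      using generate.inv[OF rel[OF inv], of "free_pairs M' N'"]
      by (simp add: \<phi>_def frag_extend_minus)
  next
    case (eng c d)
    then show ?case
      using generate.eng[of "\<phi> c" "free_pairs M' N'" _ "\<phi> d"]
      by (simp add: \<phi>_def frag_extend_add)
  qed
  have val: "tensor_map R M N M' N' f g (P.coset c) = P'.coset (\<phi> c)"
    if c: "c \<in> carrier (free_pairs M N)" for c
  proof -
    have const: "P'.coset (\<phi> d) = P'.coset (\<phi> c)" if d: "d \<in> P.coset c" for d
    proof -
      obtain k where k: "k \<in> tensor_kernel R M N" "d = k + c"
        using d by (auto simp: r_coset_def)
      have kc: "k \<in> carrier (free_pairs M N)"
        using k(1) subgroup.subset[OF P.tensor_kernel_subgroup] by blast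
      have "\<phi> d - \<phi> c \<in> tensor_kernel R M' N'"
        using ker[OF k(1)] by (simp add: k(2) \<phi>_def frag_extend_add)
      moreover have "d \<in> carrier (free_pairs M N)"
        using kc c keys_add[of k c] by (auto simp: k(2))
      ultimately show ?thesis
        using c by (intro P'.coset_eqI closed)
    qed
    \<comment> \<open>The class is not empty, so the union of the constant family over it is that
      constant and not the empty set.\<close>
    have "c \<in> P.coset c"
      using subgroup.one_closed[OF P.tensor_kernel_subgroup]
      by (auto simp: r_coset_def intro!: bexI[of _ 0])
    then have "(\<Union>d\<in>P.coset c. P'.coset (\<phi> d)) = P'.coset (\<phi> c)"
      using const by (intro SUP_eq_const) blast+
    moreover have "P.coset c \<in> carrier (tensor_group R M N)"
      using P.coset_closed[OF c] by (simp add: tensor_simps)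
    ultimately show ?thesis
      unfolding tensor_map_def \<phi>_def[symmetric] by (simp only: restrict_apply if_True)
  qed
  show "tensor_map R M N M' N' f g \<in> add_hom (tensor R M N) (tensor R M' N')"
  proof (rule add_homI)
    show "tensor_map R M N M' N' f g v \<in> carrier (tensor R M' N')"
      if "v \<in> carrier (tensor R M N)" for v
      using that by (elim P.coset_cases) (simp add: val P'.coset_closed closed del: carrier_free_Abelian_group_iff)
    show "tensor_map R M N M' N' f g (v \<oplus>\<^bsub>tensor R M N\<^esub> w) =
      tensor_map R M N M' N' f g v \<oplus>\<^bsub>tensor R M' N'\<^esub> tensor_map R M N M' N' f g w"
      if v: "v \<in> carrier (tensor R M N)" and w: "w \<in> carrier (tensor R M N)" for v w
    proof -
      obtain c d where c: "c \<in> carrier (free_pairs M N)" "v = P.coset c"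
        and d: "d \<in> carrier (free_pairs M N)" "w = P.coset d"
        using v w by (metis P.coset_cases)
      have "c + d \<in> carrier (free_pairs M N)" using c d keys_add[of c d] by auto
      then show ?thesis
        using c d closed
        by (simp add: val P.coset_add[symmetric] P'.coset_add[symmetric] del: carrier_free_Abelian_group_iff)
          (simp add: \<phi>_def frag_extend_add)
    qed
  qed
  show "tensor_map R M N M' N' f g (tens R M N x y) = tens R M' N' (f x) (g y)"
    if "x \<in> carrier M" "y \<in> carrier N"
    unfolding tens_def using that by (subst val) auto
qed

lemma tensor_map_extensional: "tensor_map R M N M' N' f g \<in> extensional (carrier (tensor R M N))"
  by (simp add: tensor_map_def tensor_simps)

context tensor_product
begin

lemma tensor_smult_add_hom: "a \<in> carrier A \<Longrightarrow> smult (tensor R M N) a \<in> add_hom (tensor R M N) (tensor R M N)"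
  unfolding tensor_simps(4)
  by (rule tensor_map_add_hom[OF tensor_product_axioms tensor_product_axioms])
    (auto intro!: add_homI simp: M.smult_closed M.smult_r_distr M.smult_rsmult)

lemma smult_tens: "\<lbrakk>a \<in> carrier A; x \<in> carrier M; y \<in> carrier N\<rbrakk>
    \<Longrightarrow> a \<odot>\<^bsub>tensor R M N\<^esub> tens R M N x y = tens R M N (a \<odot>\<^bsub>M\<^esub> x) y"
  unfolding tensor_simps(4)
  by (rule tensor_map_tens[OF tensor_product_axioms tensor_product_axioms])
    (auto intro!: add_homI simp: M.smult_closed M.smult_r_distr M.smult_rsmult)

sublocale T: left_module A "tensor R M N"
proof (intro left_module.intro left_module_axioms.intro M.R.ring_axioms T.abelian_group_axioms)
  note [simp] = add_hom_closed[OF tensor_smult_add_hom] add_hom_add[OF tensor_smult_add_hom]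
  fix a b w assume a: "a \<in> carrier A" and w: "w \<in> carrier (tensor R M N)"
  show "a \<odot>\<^bsub>tensor R M N\<^esub> w \<in> carrier (tensor R M N)"
    using a w by simp
  show "a \<odot>\<^bsub>tensor R M N\<^esub> (w \<oplus>\<^bsub>tensor R M N\<^esub> v) = a \<odot>\<^bsub>tensor R M N\<^esub> w \<oplus>\<^bsub>tensor R M N\<^esub> a \<odot>\<^bsub>tensor R M N\<^esub> v"
    if "v \<in> carrier (tensor R M N)" for v
    using a w that by simp
  show "(a \<oplus>\<^bsub>A\<^esub> b) \<odot>\<^bsub>tensor R M N\<^esub> w = a \<odot>\<^bsub>tensor R M N\<^esub> w \<oplus>\<^bsub>tensor R M N\<^esub> b \<odot>\<^bsub>tensor R M N\<^esub> w"
    if b: "b \<in> carrier A"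
    using w
    by (induction rule: tensor_induct)
      (simp_all add: a b smult_tens tens_add_left M.smult_l_distr M.smult_closed T.a_ac)
  show "(a \<otimes>\<^bsub>A\<^esub> b) \<odot>\<^bsub>tensor R M N\<^esub> w = a \<odot>\<^bsub>tensor R M N\<^esub> (b \<odot>\<^bsub>tensor R M N\<^esub> w)"
    if b: "b \<in> carrier A"
    using w
    by (induction rule: tensor_induct) (simp_all add: a b smult_tens M.smult_assoc M.smult_closed)
next
  note [simp] = add_hom_add[OF tensor_smult_add_hom]
  show "\<one>\<^bsub>A\<^esub> \<odot>\<^bsub>tensor R M N\<^esub> w = w" if "w \<in> carrier (tensor R M N)" for w
    using that by (induction rule: tensor_induct) (simp_all add: smult_tens M.smult_one)
qed

lemma tensor_module_homsI:
  assumes h: "h \<in> add_hom (tensor R M N) H" "h \<in> extensional (carrier (tensor R M N))"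
    and H: "left_module A H"
    and lin: "\<And>a x y. \<lbrakk>a \<in> carrier A; x \<in> carrier M; y \<in> carrier N\<rbrakk>
      \<Longrightarrow> h (tens R M N (a \<odot>\<^bsub>M\<^esub> x) y) = a \<odot>\<^bsub>H\<^esub> h (tens R M N x y)"
  shows "h \<in> module_homs A (tensor R M N) H"
proof (intro module_homsI h)
  interpret H: left_module A H by fact
  fix a w assume a: "a \<in> carrier A" and w: "w \<in> carrier (tensor R M N)"
  show "h (a \<odot>\<^bsub>tensor R M N\<^esub> w) = a \<odot>\<^bsub>H\<^esub> h w"
    using w
    by (induction rule: tensor_induct)
      (simp_all add: a smult_tens lin T.smult_r_distr T.smult_closed H.smult_r_distr
        add_hom_add[OF h(1)] add_hom_closed[OF h(1)])
qed

lemma tensor_lift_module_homs: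
  assumes "left_module A H" and \<beta>: "\<beta> \<in> balanced_maps R M N H"
    and "\<And>a x y. \<lbrakk>a \<in> carrier A; x \<in> carrier M; y \<in> carrier N\<rbrakk>
      \<Longrightarrow> \<beta> (a \<odot>\<^bsub>M\<^esub> x) y = a \<odot>\<^bsub>H\<^esub> \<beta> x y"
  shows "tensor_lift R M N H \<beta> \<in> module_homs A (tensor R M N) H"
proof -
  interpret H: left_module A H by fact
  show ?thesis
    using assms(3)
    by (intro tensor_module_homsI tensor_lift_add_hom tensor_lift_extensional assms)
      (simp_all add: tensor_lift_tens[OF H.abelian_group_axioms \<beta>] H.abelian_group_axioms M.smult_closed)
qed

end

lemma
  assumes N: "tensor_product A R M N" and N': "tensor_product A R M N'" and g: "g \<in> module_homs R N N'"
  shows tensor_map_right_tens: "\<lbrakk>x \<in> carrier M; y \<in> carrier N\<rbrakk>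
      \<Longrightarrow> tensor_map R M N M N' (\<lambda>x. x) g (tens R M N x y) = tens R M N' x (g y)"
    and tensor_map_right_homs: "tensor_map R M N M N' (\<lambda>x. x) g \<in> module_homs A (tensor R M N) (tensor R M N')"
proof -
  interpret N: tensor_product A R M N by fact
  interpret N': tensor_product A R M N' by fact
  have id: "(\<lambda>x. x) \<in> add_hom M M" by (rule add_homI) simp_all
  note assms' = N N' id module_homs_add_hom[OF g] _ module_homs_smult[OF g]
  have tens: "tensor_map R M N M N' (\<lambda>x. x) g (tens R M N x y) = tens R M N' x (g y)"
    if "x \<in> carrier M" "y \<in> carrier N" for x y
    using that by (intro tensor_map_tens[OF assms']) simp_all
  then show "\<lbrakk>x \<in> carrier M; y \<in> carrier N\<rbrakk>
    \<Longrightarrow> tensor_map R M N M N' (\<lambda>x. x) g (tens R M N x y) = tens R M N' x (g y)" .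
  show "tensor_map R M N M N' (\<lambda>x. x) g \<in> module_homs A (tensor R M N) (tensor R M N')"
    by (intro N.tensor_module_homsI tensor_map_extensional N'.T.left_module_axioms tensor_map_add_hom[OF assms'])
      (auto simp: tens N.M.smult_closed N'.smult_tens module_homs_closed[OF g])
qed

section \<open>Constructions of modules and bimodules\<close>

lemma (in left_module) smult_r_null: "r \<in> carrier R \<Longrightarrow> r \<odot>\<^bsub>M\<^esub> \<zero>\<^bsub>M\<^esub> = \<zero>\<^bsub>M\<^esub>"
  using smult_r_distr[of r "\<zero>\<^bsub>M\<^esub>" "\<zero>\<^bsub>M\<^esub>"] smult_closed[of r "\<zero>\<^bsub>M\<^esub>"] by simp

text \<open>Restricting scalars or adding a right action changes the record but not its additive
  group.\<close>

lemma abelian_group_cong: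
  assumes "abelian_group M" "carrier N = carrier M" "zero N = zero M" "add N = add M"
  shows "abelian_group N"
proof -
  interpret M: abelian_group M by fact
  show ?thesis
    by (rule abelian_groupI) (auto simp: assms M.a_ac intro: M.l_neg)
qed

lemma left_module_restrict_scalars:
  assumes "left_module A M" "ring R" "h \<in> ring_hom R A"
  shows "left_module R (restrict_scalars h M)"
proof -
  interpret M: left_module A M by fact
  interpret R: ring R by fact
  note h = ring_hom_closed[OF assms(3)] ring_hom_add[OF assms(3)] ring_hom_mult[OF assms(3)]
    ring_hom_one[OF assms(3)]
  show ?thesis
    by (intro abelian_group_cong[OF M.abelian_group_axioms] left_module.intro left_module_axioms.intro R.ring_axioms)
      (auto simp: h M.smult_closed M.smult_l_distr M.smult_r_distr M.smult_assoc M.smult_one)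
qed

lemma bimod_right_extension:
  assumes "ring A" "ring R" "h \<in> ring_hom R A"
  shows "bimod A R (right_extension_bimodule h A)"
proof -
  interpret A: ring A by fact
  interpret R: ring R by fact
  note h = ring_hom_closed[OF assms(3)] ring_hom_add[OF assms(3)] ring_hom_mult[OF assms(3)]
    ring_hom_one[OF assms(3)]
  show ?thesis
    by (intro abelian_group_cong[OF A.abelian_group_axioms] bimod.intro bimod_axioms.intro left_module.intro left_module_axioms.intro
        R.ring_axioms A.ring_axioms)
      (auto simp: h A.l_distr A.r_distr A.m_assoc)
qed

text \<open>\<open>G\<close> is any record with this additive structure, so that one proof serves
  both Hom modules and endomorphism rings.\<close>

lemma abelian_group_homs:
  assumes "left_module R T" "left_module R M"
    and G: "carrier G = module_homs R T M" "zero G = (\<lambda>t\<in>carrier T. \<zero>\<^bsub>M\<^esub>)"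
      "\<And>f g. add G f g = (\<lambda>t\<in>carrier T. f t \<oplus>\<^bsub>M\<^esub> g t)"
  shows "abelian_group G"
proof -
  interpret T: left_module R T by fact
  interpret M: left_module R M by fact
  \<comment> \<open>Needed for the pointwise negative of a homomorphism to be linear again.\<close>
  have smult_neg: "r \<odot>\<^bsub>M\<^esub> (\<ominus>\<^bsub>M\<^esub> x) = \<ominus>\<^bsub>M\<^esub> (r \<odot>\<^bsub>M\<^esub> x)" if "r \<in> carrier R" "x \<in> carrier M" for r x
    using that M.smult_r_distr[of r "\<ominus>\<^bsub>M\<^esub> x" x] 
    by (intro M.minus_equality[symmetric]) (simp_all add: M.smult_closed M.l_neg M.smult_r_null)
  note closed = module_homs_closed[of _ R T M]
  show ?thesis
  proof (rule abelian_groupI)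
    fix f g assume f: "f \<in> carrier G" and g: "g \<in> carrier G"
    show "f \<oplus>\<^bsub>G\<^esub> g \<in> carrier G"
      using f g unfolding G
      by (intro module_homsI add_homI)
        (auto simp: closed module_homs_add module_homs_smult M.smult_r_distr T.smult_closed M.a_ac)
    show "f \<oplus>\<^bsub>G\<^esub> g = g \<oplus>\<^bsub>G\<^esub> f"
      using f g unfolding G by (auto simp: closed M.a_comm intro!: restrict_ext)
    show "f \<oplus>\<^bsub>G\<^esub> g \<oplus>\<^bsub>G\<^esub> h = f \<oplus>\<^bsub>G\<^esub> (g \<oplus>\<^bsub>G\<^esub> h)" if "h \<in> carrier G" for h
      using f g that unfolding G by (auto simp: closed M.a_assoc intro!: restrict_ext)
  next
    show "\<zero>\<^bsub>G\<^esub> \<in> carrier G"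
      unfolding G by (intro module_homsI add_homI) (auto simp: M.smult_r_null T.smult_closed)
  next
    fix f assume f: "f \<in> carrier G"
    show "\<zero>\<^bsub>G\<^esub> \<oplus>\<^bsub>G\<^esub> f = f"
      using f unfolding G
      by (intro extensionalityI[of _ "carrier T"]) (auto simp: closed module_homs_extensional)
    have "(\<lambda>t\<in>carrier T. \<ominus>\<^bsub>M\<^esub> f t) \<in> carrier G"
      using f unfolding G
      by (intro module_homsI add_homI)
        (auto simp: closed module_homs_add module_homs_smult T.smult_closed smult_neg M.minus_add)
    moreover have "(\<lambda>t\<in>carrier T. \<ominus>\<^bsub>M\<^esub> f t) \<oplus>\<^bsub>G\<^esub> f = \<zero>\<^bsub>G\<^esub>"
      using f unfolding G by (auto simp: closed M.l_neg intro!: restrict_ext)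
    ultimately show "\<exists>g\<in>carrier G. g \<oplus>\<^bsub>G\<^esub> f = \<zero>\<^bsub>G\<^esub>" by blast
  qed
qed

text \<open>Precomposition turns the right action on \<open>T\<close> into a left action: (s s') f
  and s (s' f) both send t to f((t s) s').\<close>

lemma left_module_hom_module:
  assumes "bimod R S T" "left_module R M"
  shows "left_module S (hom_module R T M)"
proof -
  interpret T: bimod R S T by fact
  interpret M: left_module R M by fact
  interpret abelian_group "hom_module R T M"
    by (rule abelian_group_homs[OF T.left_module_axioms assms(2)]) simp_all
  note closed = module_homs_closed[of _ R T M]
  have smult_closed: "s \<odot>\<^bsub>hom_module R T M\<^esub> f \<in> module_homs R T M"
    if "s \<in> carrier S" "f \<in> module_homs R T M" for s f
    using that unfolding hom_module_simps
    by (intro module_homsI add_homI)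
      (auto simp: closed module_homs_add module_homs_smult[symmetric] T.smult_rsmult[symmetric] T.rsmult_l_distr T.rsmult_closed
        T.smult_closed)
  show ?thesis
    by (intro left_module.intro left_module_axioms.intro T.S.ring_axioms abelian_group_axioms)
      (use smult_closed in \<open>auto simp: closed module_homs_add T.rsmult_r_distr T.rsmult_closed T.rsmult_assoc T.rsmult_one
        module_homs_extensional intro!: restrict_ext extensionalityI[of _ "carrier T"]\<close>)
qed

lemma ring_End_ring:
  assumes "left_module R T"
  shows "ring (End_ring R T)"
proof -
  interpret T: left_module R T by fact
  interpret abelian_group "End_ring R T"
    by (rule abelian_group_homs[OF assms assms]) simp_all
  have id: "(\<lambda>t\<in>carrier T. t) \<in> module_homs R T T"
    by (intro module_homsI add_homI) (auto simp: T.smult_closed)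
  note closed = module_homs_closed[of _ R T T]
  show ?thesis
  proof (rule ringI[OF abelian_group_axioms])
    show "monoid (End_ring R T)"
      by (rule monoidI)
        (auto simp: id module_homs_compose[OF _ _ assms, unfolded compose_def] compose_assoc compose_Id Id_compose
          compose_def closed module_homs_extensional intro!: restrict_ext extensionalityI[of _ "carrier T"])
  qed (auto simp: compose_def closed module_homs_add intro!: restrict_ext)
qed

lemma bimod_End_bimodule:
  assumes "left_module R T"
  shows "bimod R (End_ring R T) (End_bimodule T)"
proof -
  interpret T: left_module R T by fact
  interpret S: ring "End_ring R T" by (rule ring_End_ring[OF assms])
  show ?thesis
    by (intro abelian_group_cong[OF T.abelian_group_axioms] bimod.intro bimod_axioms.intro left_module.intro left_module_axioms.intro
        S.ring_axioms T.R.ring_axioms)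
      (auto simp: T.smult_closed T.smult_l_distr T.smult_r_distr T.smult_assoc T.smult_one
        module_homs_closed module_homs_add module_homs_smult compose_def)
qed

lemma (in left_module) left_module_direct_sum_copies: "left_module R (direct_sum_copies I M)"
proof (intro left_module.intro left_module_axioms.intro R.ring_axioms)
  \<comment> \<open>Finite support survives every pointwise operation that yields zero where both
    arguments vanish; unary operations are the case \<open>f = g\<close>.\<close>
  have fin: "finite {i \<in> I. h i \<noteq> \<zero>\<^bsub>M\<^esub>}"
    if "finite {i \<in> I. f i \<noteq> \<zero>\<^bsub>M\<^esub>}" "finite {i \<in> I. g i \<noteq> \<zero>\<^bsub>M\<^esub>}"
      "\<And>i. \<lbrakk>i \<in> I; f i = \<zero>\<^bsub>M\<^esub>; g i = \<zero>\<^bsub>M\<^esub>\<rbrakk> \<Longrightarrow> h i = \<zero>\<^bsub>M\<^esub>" for f g h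
    using that(3) by (intro finite_subset[OF _ finite_UnI[OF that(1,2)]]) auto
  note closed = PiE_mem[of _ I "\<lambda>_. carrier M"]
  show "abelian_group (direct_sum_copies I M)"
  proof (rule abelian_groupI)
    fix f g h assume f: "f \<in> carrier (direct_sum_copies I M)" and g: "g \<in> carrier (direct_sum_copies I M)"
    show "f \<oplus>\<^bsub>direct_sum_copies I M\<^esub> g \<in> carrier (direct_sum_copies I M)"
      using f g by (auto intro: fin[of f g] cong: conj_cong)
    show "f \<oplus>\<^bsub>direct_sum_copies I M\<^esub> g = g \<oplus>\<^bsub>direct_sum_copies I M\<^esub> f"
      using f g by (auto simp: closed M.a_comm intro!: restrict_ext)
    show "f \<oplus>\<^bsub>direct_sum_copies I M\<^esub> g \<oplus>\<^bsub>direct_sum_copies I M\<^esub> h =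
        f \<oplus>\<^bsub>direct_sum_copies I M\<^esub> (g \<oplus>\<^bsub>direct_sum_copies I M\<^esub> h)"
      if "h \<in> carrier (direct_sum_copies I M)"
      using f g that by (auto simp: closed M.a_assoc intro!: restrict_ext)
  next
    fix f assume f: "f \<in> carrier (direct_sum_copies I M)"
    then show "\<zero>\<^bsub>direct_sum_copies I M\<^esub> \<oplus>\<^bsub>direct_sum_copies I M\<^esub> f = f"
      by (auto simp: closed PiE_def intro!: extensionalityI[of _ I])
    have "(\<lambda>i\<in>I. \<ominus>\<^bsub>M\<^esub> f i) \<in> carrier (direct_sum_copies I M)"
      using f by (auto simp: closed intro: fin[of f f] cong: conj_cong)
    moreover have "(\<lambda>i\<in>I. \<ominus>\<^bsub>M\<^esub> f i) \<oplus>\<^bsub>direct_sum_copies I M\<^esub> f = \<zero>\<^bsub>direct_sum_copies I M\<^esub>"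
      using f by (auto simp: closed M.l_neg intro!: restrict_ext)
    ultimately show "\<exists>g\<in>carrier (direct_sum_copies I M). g \<oplus>\<^bsub>direct_sum_copies I M\<^esub> f = \<zero>\<^bsub>direct_sum_copies I M\<^esub>"
      by blast
  qed simp
  show "r \<odot>\<^bsub>direct_sum_copies I M\<^esub> f \<in> carrier (direct_sum_copies I M)"
    if "r \<in> carrier R" "f \<in> carrier (direct_sum_copies I M)" for r f
    using that by (auto simp: closed smult_closed smult_r_null intro: fin[of f f] cong: conj_cong)
  show "\<one> \<odot>\<^bsub>direct_sum_copies I M\<^esub> f = f" if "f \<in> carrier (direct_sum_copies I M)" for f
    using that by (auto simp: closed smult_one PiE_def intro!: extensionalityI[of _ I])
qed (auto simp: PiE_mem[of _ I "\<lambda>_. carrier M"] smult_closed smult_l_distr smult_r_distr smult_assoc intro!: restrict_ext)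

section \<open>Dual bases for objects of add(M)\<close>

lemma direct_sum_decomposition:
  assumes "left_module R M" and "finite I" and l: "l \<in> carrier (direct_sum_copies I M)"
  shows "finsum (direct_sum_copies I M) (\<lambda>k. \<lambda>j\<in>I. if j = k then l k else \<zero>\<^bsub>M\<^esub>) I = l"
proof -
  interpret M: left_module R M by fact
  interpret L: left_module R "direct_sum_copies I M" by (rule M.left_module_direct_sum_copies)
  define e where "e k = (\<lambda>j\<in>I. if j = k then l k else \<zero>\<^bsub>M\<^esub>)" for k
  have l_closed: "l k \<in> carrier M" if "k \<in> I" for k using l that by auto
  have e: "e k \<in> carrier (direct_sum_copies I M)" if "k \<in> I" for k
    using l_closed[OF that] \<open>finite I\<close> by (auto simp: e_def)
  have sum: "finsum (direct_sum_copies I M) e I \<in> carrier (direct_sum_copies I M)"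
    using e by (intro L.finsum_closed) blast
  have "finsum (direct_sum_copies I M) e I j = l j" if j: "j \<in> I" for j
  proof -
    \<comment> \<open>Evaluation at a coordinate is additive, so it passes through the sum, where at
      most the term with index \<open>j\<close> is nonzero.\<close>
    have "(\<lambda>f. f j) \<in> add_hom (direct_sum_copies I M) M"
      using j by (intro add_homI) auto
    from add_hom_finsum[OF this L.abelian_group_axioms M.abelian_group_axioms \<open>finite I\<close> e]
    have "finsum (direct_sum_copies I M) e I j = finsum M (\<lambda>k. e k j) I" .
    also have "\<dots> = finsum M (\<lambda>k. if j = k then l k else \<zero>\<^bsub>M\<^esub>) I"
      using j l_closed by (intro M.finsum_cong') (auto simp: e_def)
    also have "\<dots> = l j"
      using j l_closed \<open>finite I\<close> by (intro M.finsum_singleton) auto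
    finally show ?thesis .
  qed
  then have "finsum (direct_sum_copies I M) e I = l"
    using sum l by (intro extensionalityI[of _ I]) (auto simp: PiE_def)
  then show ?thesis by (simp add: e_def[abs_def])
qed

text \<open>With \<phi> an isomorphism from \<open>N\<close> onto a summand of n copies of
  \<open>M\<close>, take for \<open>p k\<close> the k-th coordinate of \<phi>, and for
  \<open>i k\<close> the k-th inclusion followed by the projection onto the summand and the inverse
  of \<phi>. The identity for the sum is then the decomposition of \<phi>(x) into coordinates. It is
  in this form that membership in add(M) enters (iii) and (iv).\<close>

lemma add_cat_dual_basis:
  assumes "left_module R M" and N: "N \<in> add_cat R M"
  obtains n :: nat and i p where
    "\<And>k. k < n \<Longrightarrow> i k \<in> module_homs R M N" "\<And>k. k < n \<Longrightarrow> p k \<in> module_homs R N M"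
    "\<And>x. x \<in> carrier N \<Longrightarrow> finsum N (\<lambda>k. i k (p k x)) {..<n} = x"
proof -
  obtain n :: nat and K K' \<phi> where "left_module R N"
    and K: "submodule K R (direct_sum_copies {..<n} M)"
    and K': "submodule K' R (direct_sum_copies {..<n} M)"
    and KK': "K <+>\<^bsub>direct_sum_copies {..<n} M\<^esub> K' = carrier (direct_sum_copies {..<n} M)"
      "K \<inter> K' = {\<zero>\<^bsub>direct_sum_copies {..<n} M\<^esub>}"
    and \<phi>: "\<phi> \<in> module_isos R N (direct_sum_copies {..<n} M\<lparr>carrier := K\<rparr>)"
    using N unfolding add_cat_def is_direct_summand_def by fast
  define L where "L = direct_sum_copies {..<n} M"
  interpret M: left_module R M by fact
  interpret N: left_module R N by fact
  interpret L: left_module R L unfolding L_def by (rule M.left_module_direct_sum_copies)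
  interpret K: submodule K R L using K by (simp add: L_def)
  interpret K': submodule K' R L using K' by (simp add: L_def)
  have \<phi>_hom: "\<phi> \<in> module_homs R N (L\<lparr>carrier := K\<rparr>)" and \<phi>_bij: "bij_betw \<phi> (carrier N) K"
    using \<phi> by (auto simp: module_isos_def L_def)
  have \<phi>_K: "\<phi> y \<in> K" if "y \<in> carrier N" for y
    using module_homs_closed[OF \<phi>_hom that] by simp
  then have \<phi>_closed: "\<phi> y \<in> carrier L" if "y \<in> carrier N" for y
    using that K.subset by auto
  have \<phi>_add: "\<phi> (y \<oplus>\<^bsub>N\<^esub> y') = \<phi> y \<oplus>\<^bsub>L\<^esub> \<phi> y'" if "y \<in> carrier N" "y' \<in> carrier N" for y y'
    using module_homs_add[OF \<phi>_hom that] by simp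
  have \<phi>_smult: "\<phi> (r \<odot>\<^bsub>N\<^esub> y) = r \<odot>\<^bsub>L\<^esub> \<phi> y" if "r \<in> carrier R" "y \<in> carrier N" for r y
    using module_homs_smult[OF \<phi>_hom that] by simp
  have K'_closed: "b \<in> carrier L" if "b \<in> K'" for b using that K'.subset by auto

  \<comment> \<open>The projection onto \<open>K\<close> along \<open>K'\<close> followed by the
    inverse of \<phi>. Existence of the value comes from K + K' being everything, uniqueness from K
    and K' meeting in zero and from injectivity of \<phi>.\<close>
  define q where "q l = (THE y. y \<in> carrier N \<and> (\<exists>b\<in>K'. l = \<phi> y \<oplus>\<^bsub>L\<^esub> b))" for l
  have q_eq: "q (\<phi> y \<oplus>\<^bsub>L\<^esub> b) = y" if y: "y \<in> carrier N" and b: "b \<in> K'" for y b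
    unfolding q_def
  proof (rule the_equality)
    show "y \<in> carrier N \<and> (\<exists>b'\<in>K'. \<phi> y \<oplus>\<^bsub>L\<^esub> b = \<phi> y \<oplus>\<^bsub>L\<^esub> b')" using y b by blast
    fix y' assume "y' \<in> carrier N \<and> (\<exists>b'\<in>K'. \<phi> y \<oplus>\<^bsub>L\<^esub> b = \<phi> y' \<oplus>\<^bsub>L\<^esub> b')"
    then obtain b' where y': "y' \<in> carrier N" and b': "b' \<in> K'"
      and eq: "\<phi> y \<oplus>\<^bsub>L\<^esub> b = \<phi> y' \<oplus>\<^bsub>L\<^esub> b'" by blast
    note closed = \<phi>_closed[OF y] \<phi>_closed[OF y'] K'_closed[OF b] K'_closed[OF b']
    \<comment> \<open>For two decompositions of one element, the difference of the parts in
      \<open>K\<close> equals the difference of the parts in \<open>K'\<close>, so it lies in the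
      intersection and vanishes.\<close>
    have "\<phi> y \<oplus>\<^bsub>L\<^esub> \<ominus>\<^bsub>L\<^esub> \<phi> y' = \<phi> y \<oplus>\<^bsub>L\<^esub> b \<oplus>\<^bsub>L\<^esub> (\<ominus>\<^bsub>L\<^esub> b \<oplus>\<^bsub>L\<^esub> \<ominus>\<^bsub>L\<^esub> \<phi> y')"
      using closed by (simp add: L.a_assoc L.r_neg2)
    also have "\<dots> = b' \<oplus>\<^bsub>L\<^esub> \<phi> y' \<oplus>\<^bsub>L\<^esub> (\<ominus>\<^bsub>L\<^esub> \<phi> y' \<oplus>\<^bsub>L\<^esub> \<ominus>\<^bsub>L\<^esub> b)"
      using closed by (simp add: eq L.a_comm)
    also have "\<dots> = b' \<oplus>\<^bsub>L\<^esub> \<ominus>\<^bsub>L\<^esub> b"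
      using closed by (simp add: L.a_assoc L.r_neg2)
    finally have "\<phi> y \<oplus>\<^bsub>L\<^esub> \<ominus>\<^bsub>L\<^esub> \<phi> y' = b' \<oplus>\<^bsub>L\<^esub> \<ominus>\<^bsub>L\<^esub> b" .
    moreover have "\<phi> y \<oplus>\<^bsub>L\<^esub> \<ominus>\<^bsub>L\<^esub> \<phi> y' \<in> K"
      using K.m_closed[OF \<phi>_K[OF y] K.m_inv_closed[OF \<phi>_K[OF y']]] by (simp add: a_inv_def)
    moreover have "b' \<oplus>\<^bsub>L\<^esub> \<ominus>\<^bsub>L\<^esub> b \<in> K'"
      using K'.m_closed[OF b' K'.m_inv_closed[OF b]] by (simp add: a_inv_def)
    ultimately have "\<phi> y \<oplus>\<^bsub>L\<^esub> \<ominus>\<^bsub>L\<^esub> \<phi> y' = \<zero>\<^bsub>L\<^esub>"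
      using KK'(2) unfolding L_def[symmetric] by auto
    then have "\<phi> y = \<phi> y'"
      using closed L.minus_equality[of "\<phi> y" "\<ominus>\<^bsub>L\<^esub> \<phi> y'"] by simp
    then show "y' = y" using \<phi>_bij y y' by (auto simp: bij_betw_def inj_on_def)
  qed
  have q_cases: "\<exists>y b. y \<in> carrier N \<and> b \<in> K' \<and> l = \<phi> y \<oplus>\<^bsub>L\<^esub> b" if "l \<in> carrier L" for l
  proof -
    have "l \<in> (\<Union>a\<in>K. \<Union>b\<in>K'. {a \<oplus>\<^bsub>L\<^esub> b})"
      using that KK'(1) unfolding L_def[symmetric] set_add_def' by simp
    then obtain a b where "a \<in> K" "b \<in> K'" "l = a \<oplus>\<^bsub>L\<^esub> b" by blast
    moreover obtain y where "y \<in> carrier N" "a = \<phi> y"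
      using \<open>a \<in> K\<close> \<phi>_bij unfolding bij_betw_def by blast
    ultimately show ?thesis by blast
  qed
  have q_add: "q (l \<oplus>\<^bsub>L\<^esub> l') = q l \<oplus>\<^bsub>N\<^esub> q l'" if l: "l \<in> carrier L" and l': "l' \<in> carrier L" for l l'
  proof -
    obtain y b y' b' where *: "y \<in> carrier N" "b \<in> K'" "l = \<phi> y \<oplus>\<^bsub>L\<^esub> b"
      "y' \<in> carrier N" "b' \<in> K'" "l' = \<phi> y' \<oplus>\<^bsub>L\<^esub> b'"
      using q_cases l l' by metis
    have "l \<oplus>\<^bsub>L\<^esub> l' = \<phi> (y \<oplus>\<^bsub>N\<^esub> y') \<oplus>\<^bsub>L\<^esub> (b \<oplus>\<^bsub>L\<^esub> b')"
      using * by (simp add: \<phi>_add \<phi>_closed K'_closed L.a_ac)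
    then show ?thesis
      using * K'.m_closed[of b b'] by (simp add: q_eq del: L.a_closed)
  qed
  have q_hom: "q \<in> add_hom L N"
    using q_cases q_eq q_add by (intro add_homI) fastforce+
  have q_smult: "q (r \<odot>\<^bsub>L\<^esub> l) = r \<odot>\<^bsub>N\<^esub> q l" if r: "r \<in> carrier R" and l: "l \<in> carrier L" for r l
  proof -
    obtain y b where *: "y \<in> carrier N" "b \<in> K'" "l = \<phi> y \<oplus>\<^bsub>L\<^esub> b"
      using q_cases l by metis
    have "r \<odot>\<^bsub>L\<^esub> l = \<phi> (r \<odot>\<^bsub>N\<^esub> y) \<oplus>\<^bsub>L\<^esub> r \<odot>\<^bsub>L\<^esub> b"
      using * r by (simp add: \<phi>_smult \<phi>_closed K'_closed L.smult_r_distr)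
    then show ?thesis
      using * r by (simp add: q_eq N.smult_closed)
  qed
  have q_\<phi>: "q (\<phi> y) = y" if "y \<in> carrier N" for y
    using q_eq[OF that K'.one_closed] that by (simp add: \<phi>_closed)

  define e where "e k m = (\<lambda>j\<in>{..<n}. if j = k then m else \<zero>\<^bsub>M\<^esub>)" for k m
  have e_closed: "e k m \<in> carrier L" if "m \<in> carrier M" for k m
    using that by (auto simp: e_def L_def)
  have e_hom: "e k \<in> add_hom M L" for k
    by (intro add_homI e_closed) (auto simp: e_def L_def intro!: restrict_ext)
  have e_smult: "e k (r \<odot>\<^bsub>M\<^esub> m) = r \<odot>\<^bsub>L\<^esub> e k m" if "r \<in> carrier R" "m \<in> carrier M" for k r m
    using that by (auto simp: e_def L_def M.smult_r_null intro!: restrict_ext)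
  show thesis
  proof (rule that[of n "\<lambda>k. \<lambda>m\<in>carrier M. q (e k m)" "\<lambda>k. \<lambda>y\<in>carrier N. \<phi> y k"])
    fix k assume k: "k < n"
    show "(\<lambda>m\<in>carrier M. q (e k m)) \<in> module_homs R M N"
      by (intro module_homsI add_homI)
        (auto simp: add_hom_closed[OF q_hom] add_hom_add[OF e_hom] q_add e_closed e_smult q_smult
          M.smult_closed)
    have "\<phi> y k \<in> carrier M" if "y \<in> carrier N" for y
      using \<phi>_closed[OF that] k by (auto simp: L_def)
    then show "(\<lambda>y\<in>carrier N. \<phi> y k) \<in> module_homs R N M"
      using k by (intro module_homsI add_homI) (auto simp: \<phi>_add \<phi>_smult N.smult_closed L_def)
  next
    fix y assume y: "y \<in> carrier N"
    have closed: "\<phi> y k \<in> carrier M" if "k < n" for k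
      using \<phi>_closed[OF y] that by (auto simp: L_def)
    have "finsum N (\<lambda>k. (\<lambda>m\<in>carrier M. q (e k m)) ((\<lambda>y\<in>carrier N. \<phi> y k) y)) {..<n} =
      finsum N (\<lambda>k. q (e k (\<phi> y k))) {..<n}"
      using y closed e_closed add_hom_closed[OF q_hom] by (intro N.finsum_cong') auto
    \<comment> \<open>Since \<open>q\<close> is additive it can be pulled out of the sum; what
      remains inside is \<phi>(y) written in coordinates, and \<open>q\<close> undoes
      \<phi>.\<close>
    also have "\<dots> = q (finsum L (\<lambda>k. e k (\<phi> y k)) {..<n})"
      using closed e_closed
      by (intro add_hom_finsum[OF q_hom L.abelian_group_axioms N.abelian_group_axioms, symmetric]) auto
    also have "finsum L (\<lambda>k. e k (\<phi> y k)) {..<n} = \<phi> y"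
      using direct_sum_decomposition[OF assms(1) _ \<phi>_closed[OF y, unfolded L_def]]
      by (simp add: e_def L_def)
    finally show "finsum N (\<lambda>k. (\<lambda>m\<in>carrier M. q (e k m)) ((\<lambda>y\<in>carrier N. \<phi> y k) y)) {..<n} = y"
      by (simp add: q_\<phi> y)
  qed
qed

section \<open>Extension of scalars\<close>

lemma module_homs_End_bimodule [simp]:
  "module_homs R (End_bimodule T) M = module_homs R T M"
  "module_homs R M (End_bimodule T) = module_homs R M T"
  by (simp_all add: module_homs_def)

locale scalar_extension = R: ring R + A: ring A
  for R :: "('r, 'c) ring_scheme" and A :: "('a, 'd) ring_scheme" +
  fixes \<iota> :: "'r \<Rightarrow> 'a"
  assumes \<iota>: "\<iota> \<in> ring_hom R A"
begin

abbreviation AR where "AR \<equiv> right_extension_bimodule \<iota> A"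

abbreviation ext_map where "ext_map M N \<equiv> tensor_map R AR M AR N (\<lambda>a. a)"

lemma tensor_product: "left_module R M \<Longrightarrow> tensor_product A R AR M"
  by (intro tensor_product.intro bimod_right_extension A.ring_axioms R.ring_axioms \<iota>)

lemma
  assumes M: "left_module R M" and N: "left_module R N" and f: "f \<in> module_homs R M N"
  shows ext_map_tens: "\<lbrakk>a \<in> carrier A; x \<in> carrier M\<rbrakk> \<Longrightarrow> ext_map M N f (tens R AR M a x) = tens R AR N a (f x)"
    and ext_map_homs: "ext_map M N f \<in> module_homs A (tensor R AR M) (tensor R AR N)"
  using tensor_map_right_tens[OF tensor_product[OF M] tensor_product[OF N] f]
    tensor_map_right_homs[OF tensor_product[OF M] tensor_product[OF N] f]
  by simp_all

lemma
  assumes M: "left_module R M" and x: "x \<in> carrier M"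
  shows unit_tens_smult: "a \<in> carrier A \<Longrightarrow> a \<odot>\<^bsub>tensor R AR M\<^esub> tens R AR M \<one>\<^bsub>A\<^esub> x = tens R AR M a x"
    and unit_tens_linear: "r \<in> carrier R \<Longrightarrow>
      tens R AR M \<one>\<^bsub>A\<^esub> (r \<odot>\<^bsub>M\<^esub> x) = \<iota> r \<odot>\<^bsub>tensor R AR M\<^esub> tens R AR M \<one>\<^bsub>A\<^esub> x"
proof -
  interpret M: tensor_product A R AR M by (rule tensor_product[OF M])
  show "a \<odot>\<^bsub>tensor R AR M\<^esub> tens R AR M \<one>\<^bsub>A\<^esub> x = tens R AR M a x" if "a \<in> carrier A"
    using that x by (simp add: M.smult_tens)
  show "tens R AR M \<one>\<^bsub>A\<^esub> (r \<odot>\<^bsub>M\<^esub> x) = \<iota> r \<odot>\<^bsub>tensor R AR M\<^esub> tens R AR M \<one>\<^bsub>A\<^esub> x" if "r \<in> carrier R"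
    using that x ring_hom_closed[OF \<iota> that] by (simp add: M.smult_tens M.tens_balanced[symmetric])
qed

text \<open>The elements 1 (x) x generate A (x) M as an A-module, because a (x) x = a (1 (x) x).
  Most identities between A-linear maps below are reduced to these elements.\<close>

lemma ext_homs_eqI:
  assumes M: "left_module R M" and X: "left_module A X"
    and f: "f \<in> module_homs A (tensor R AR M) X" and g: "g \<in> module_homs A (tensor R AR M) X"
    and eq: "\<And>x. x \<in> carrier M \<Longrightarrow> f (tens R AR M \<one>\<^bsub>A\<^esub> x) = g (tens R AR M \<one>\<^bsub>A\<^esub> x)"
  shows "f = g"
proof (rule module_homs_eqI[OF f g])
  interpret M: tensor_product A R AR M by (rule tensor_product[OF M])
  interpret X: left_module A X by fact
  fix w assume "w \<in> carrier (tensor R AR M)"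
  then show "f w = g w"
  proof (induction rule: M.tensor_induct)
    case (tens a x)
    have "f (a \<odot>\<^bsub>tensor R AR M\<^esub> tens R AR M \<one>\<^bsub>A\<^esub> x) = g (a \<odot>\<^bsub>tensor R AR M\<^esub> tens R AR M \<one>\<^bsub>A\<^esub> x)"
      using tens by (simp add: module_homs_smult[OF f] module_homs_smult[OF g] eq)
    then show ?case using tens M by (simp add: unit_tens_smult)
  qed (simp add: module_homs_add[OF f] module_homs_add[OF g])
qed

text \<open>The transpose of \<open>f\<close> under the adjunction between extension and restriction
  of scalars; transposing back is restriction to the elements 1 (x) x.\<close>

definition adjunct where
  "adjunct M X f = tensor_lift R AR M X (\<lambda>a x. a \<odot>\<^bsub>X\<^esub> f x)"

lemma
  assumes M: "left_module R M" and X: "left_module A X"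
    and f: "f \<in> module_homs R M (restrict_scalars \<iota> X)"
  shows adjunct_homs: "adjunct M X f \<in> module_homs A (tensor R AR M) X"
    and adjunct_tens: "\<lbrakk>a \<in> carrier A; x \<in> carrier M\<rbrakk> \<Longrightarrow> adjunct M X f (tens R AR M a x) = a \<odot>\<^bsub>X\<^esub> f x"
    and adjunct_unit: "x \<in> carrier M \<Longrightarrow> adjunct M X f (tens R AR M \<one>\<^bsub>A\<^esub> x) = f x"
proof -
  interpret M: tensor_product A R AR M by (rule tensor_product[OF M])
  interpret X: left_module A X by fact
  have closed: "f x \<in> carrier X" if "x \<in> carrier M" for x
    using module_homs_closed[OF f that] by simp
  have bal: "(\<lambda>a x. a \<odot>\<^bsub>X\<^esub> f x) \<in> balanced_maps R AR M X"
    using module_homs_add[OF f] module_homs_smult[OF f] ring_hom_closed[OF \<iota>]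
    by (intro balanced_mapsI)
      (simp_all add: closed X.smult_closed X.smult_l_distr X.smult_r_distr X.smult_assoc)
  show "adjunct M X f \<in> module_homs A (tensor R AR M) X"
    unfolding adjunct_def
    by (rule M.tensor_lift_module_homs[OF X bal]) (simp add: closed X.smult_assoc)
  show tens: "adjunct M X f (tens R AR M a x) = a \<odot>\<^bsub>X\<^esub> f x" if "a \<in> carrier A" "x \<in> carrier M" for a x
    using that unfolding adjunct_def
    by (subst M.tensor_lift_tens[OF X.abelian_group_axioms bal]) simp_all
  show "adjunct M X f (tens R AR M \<one>\<^bsub>A\<^esub> x) = f x" if "x \<in> carrier M"
    using that by (simp add: tens X.smult_one closed)
qed

text \<open>The opposite transpose. It is R-linear because 1 (x) r x = \<iota>(r) (1 (x) x).\<close>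

lemma unit_restrict_homs:
  assumes M: "left_module R M" and X: "left_module A X" and g: "g \<in> module_homs A (tensor R AR M) X"
  shows "(\<lambda>x\<in>carrier M. g (tens R AR M \<one>\<^bsub>A\<^esub> x)) \<in> module_homs R M (restrict_scalars \<iota> X)"
proof -
  interpret M: tensor_product A R AR M by (rule tensor_product[OF M])
  show ?thesis
    using ring_hom_closed[OF \<iota>]
    by (intro module_homsI add_homI)
      (simp_all add: M.N.smult_closed module_homs_closed[OF g] M.tens_add_right module_homs_add[OF g]
        unit_tens_linear[OF M] module_homs_smult[OF g])
qed

end

section \<open>The endomorphism rings S and B and the homomorphism \<rho>\<close>

locale endomorphism_extension = scalar_extension R A \<iota> + T: left_module R T
  for R :: "('r, 'c) ring_scheme" and A :: "('a, 'd) ring_scheme" and \<iota> :: "'r \<Rightarrow> 'a"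
    and T :: "('r, 't, 'e) module_scheme"
begin

abbreviation U where "U \<equiv> tensor R AR T"
abbreviation S where "S \<equiv> End_ring R T"
abbreviation B where "B \<equiv> End_ring A U"
abbreviation \<rho> where "\<rho> \<equiv> \<lambda>s. ext_map T T s"
abbreviation TS where "TS \<equiv> End_bimodule T"
abbreviation UB where "UB \<equiv> End_bimodule U"
abbreviation BS where "BS \<equiv> right_extension_bimodule \<rho> B"
text \<open>Named after the unit of the adjunction between extension and restriction of scalars:
  this is its component at \<open>T\<close>, t |-> 1 (x) t.\<close>

abbreviation unit where "unit \<equiv> tens R AR T \<one>\<^bsub>A\<^esub>"

sublocale U: tensor_product A R AR T
  by (rule tensor_product[OF T.left_module_axioms])

sublocale TS: bimod R S TS
  by (rule bimod_End_bimodule[OF T.left_module_axioms])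

sublocale UB: bimod A B UB
  by (rule bimod_End_bimodule[OF U.T.left_module_axioms])

lemmas T_module = T.left_module_axioms and U_module = U.T.left_module_axioms

lemma \<rho>_unit: "\<lbrakk>s \<in> module_homs R T T; t \<in> carrier T\<rbrakk> \<Longrightarrow> \<rho> s (unit t) = unit (s t)"
  by (simp add: ext_map_tens T_module)

lemma \<rho>_homs: "s \<in> module_homs R T T \<Longrightarrow> \<rho> s \<in> module_homs A U U"
  by (simp add: ext_map_homs T_module)

text \<open>Both sides of each law are A-linear endomorphisms of \<open>U\<close>, so they are
  compared at 1 (x) t, where \<open>\<rho> s\<close> acts as \<open>s\<close>. The order of factors
  is kept because products are reversed composites in both rings.\<close>

lemma \<rho>: "\<rho> \<in> ring_hom S B"
proof (rule ring_hom_memI)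
  fix s s' assume s: "s \<in> carrier S" and s': "s' \<in> carrier S"
  show "\<rho> s \<in> carrier B" using s by (simp add: \<rho>_homs)
  note closed = TS.S.m_closed[OF s s'] TS.S.a_closed[OF s s'] UB.S.m_closed[of "\<rho> s" "\<rho> s'"] UB.S.a_closed[of "\<rho> s" "\<rho> s'"]
  show "\<rho> (s \<otimes>\<^bsub>S\<^esub> s') = \<rho> s \<otimes>\<^bsub>B\<^esub> \<rho> s'"
    using s s' closed
    by (intro ext_homs_eqI[OF T_module U_module]) (simp_all add: \<rho>_homs \<rho>_unit compose_def module_homs_closed)
  show "\<rho> (s \<oplus>\<^bsub>S\<^esub> s') = \<rho> s \<oplus>\<^bsub>B\<^esub> \<rho> s'"
    using s s' closed
    by (intro ext_homs_eqI[OF T_module U_module])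
      (simp_all add: \<rho>_homs \<rho>_unit module_homs_closed U.tens_add_right)
next
  show "\<rho> \<one>\<^bsub>S\<^esub> = \<one>\<^bsub>B\<^esub>"
    using TS.S.one_closed UB.S.one_closed
    by (intro ext_homs_eqI[OF T_module U_module]) (simp_all add: \<rho>_homs \<rho>_unit)
qed

sublocale BS: bimod B S BS
  by (rule bimod_right_extension[OF UB.S.ring_axioms TS.S.ring_axioms \<rho>])

end

section \<open>Functors, natural isomorphisms and finite sums\<close>

lemma mod_functor_simps [simp]:
  "obj (G \<circ>\<^sub>F F) M = obj G (obj F M)"
  "mor (G \<circ>\<^sub>F F) M N f = mor G (obj F M) (obj F N) (mor F M N f)"
  "obj (tensor_functor R K) = tensor R K"
  "mor (tensor_functor R K) M N f = tensor_map R K M K N (\<lambda>x. x) f"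
  "obj (hom_functor R L) = hom_module R L"
  "mor (hom_functor R L) M N f = (\<lambda>h\<in>module_homs R L M. compose (carrier L) f h)"
  "obj (res_functor h) = restrict_scalars h"
  "mor (res_functor h) M N f = f"
  by (simp_all add: comp_functor_def tensor_functor_def hom_functor_def res_functor_def)

lemma naturally_isomorphicI:
  assumes "\<And>M. M \<in> C \<Longrightarrow> \<eta> M \<in> module_isos S (obj F M) (obj G M)"
    and "\<And>M N f x. \<lbrakk>M \<in> C; N \<in> C; f \<in> module_homs R M N; x \<in> carrier (obj F M)\<rbrakk>
      \<Longrightarrow> \<eta> N (mor F M N f x) = mor G M N f (\<eta> M x)"
  shows "naturally_isomorphic R C S F G"
  unfolding naturally_isomorphic_def using assms by blast

lemma module_homs_restrict_scalars:
  assumes "g \<in> module_homs A X Y" "h \<in> ring_hom R A"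
  shows "g \<in> module_homs R (restrict_scalars h X) (restrict_scalars h Y)"
  using module_homs_closed[OF assms(1)] module_homs_add[OF assms(1)] module_homs_smult[OF assms(1)]
    module_homs_extensional[OF assms(1)] ring_hom_closed[OF assms(2)]
  by (intro module_homsI add_homI) simp_all

text \<open>The two sums are formed in different records over one additive group, and the identity
  is additive between them. A dual basis of Res U yields sums in the restricted module, while (iv)
  computes with sums in U.\<close>

lemma finsum_restrict_scalars:
  assumes "abelian_group M" "finite I" "\<And>i. i \<in> I \<Longrightarrow> f i \<in> carrier M"
  shows "finsum (restrict_scalars h M) f I = finsum M f I"
proof -
  have "(\<lambda>x. x) \<in> add_hom (restrict_scalars h M) M" by (rule add_homI) simp_all
  from add_hom_finsum[OF this abelian_group_cong[OF assms(1)] assms(1,2)] assms(3)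
  show ?thesis by simp
qed

text \<open>Evaluation at \<open>t\<close> is an additive map from the Hom module to
  \<open>M\<close>, so it commutes with finite sums.\<close>

lemma hom_module_finsum_apply:
  assumes "bimod R S T" "left_module R M" "finite I" "\<And>i. i \<in> I \<Longrightarrow> f i \<in> module_homs R T M"
    and t: "t \<in> carrier T"
  shows "finsum (hom_module R T M) f I t = finsum M (\<lambda>i. f i t) I"
proof -
  interpret T: bimod R S T by fact
  interpret M: left_module R M by fact
  interpret H: left_module S "hom_module R T M" by (rule left_module_hom_module[OF assms(1,2)])
  have "(\<lambda>f. f t) \<in> add_hom (hom_module R T M) M"
    using t by (intro add_homI) (simp_all add: module_homs_closed)
  from add_hom_finsum[OF this H.abelian_group_axioms M.abelian_group_axioms assms(3)] assms(4)
  show ?thesis by simp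
qed

context endomorphism_extension
begin

section \<open>Compatibility with the Hom functors\<close>

text \<open>Statement (ii). Transposition is S-linear because \<open>\<rho> s\<close> sends 1 (x) t
  to 1 (x) s(t): acting by s before or after transposing gives maps with the same values at 1 (x) t.
  Additivity and naturality are likewise read off there.\<close>

theorem hom_res_natural_iso:
  fixes C :: "('a, 'x) module set"
  assumes C: "\<And>X. X \<in> C \<Longrightarrow> left_module A X"
  shows "naturally_isomorphic A C S (hom_functor R TS \<circ>\<^sub>F res_functor \<iota>) (res_functor \<rho> \<circ>\<^sub>F hom_functor A UB)"
proof (rule naturally_isomorphicI[where \<eta> = "\<lambda>X. \<lambda>f\<in>module_homs R T (restrict_scalars \<iota> X). adjunct T X f"])
  fix X assume "X \<in> C"
  then have X: "left_module A X" by (rule C)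
  then interpret X: left_module A X .
  have rX: "left_module R (restrict_scalars \<iota> X)"
    by (rule left_module_restrict_scalars[OF X R.ring_axioms \<iota>])
  interpret H: left_module S "hom_module R TS (restrict_scalars \<iota> X)"
    by (rule left_module_hom_module[OF TS.bimod_axioms rX])
  interpret H': left_module B "hom_module A UB X"
    by (rule left_module_hom_module[OF UB.bimod_axioms X])
  note adj = adjunct_homs[OF T_module X] adjunct_unit[OF T_module X]
  let ?\<eta> = "\<lambda>f\<in>module_homs R T (restrict_scalars \<iota> X). adjunct T X f"
  have "?\<eta> \<in> module_homs S (hom_module R TS (restrict_scalars \<iota> X)) (restrict_scalars \<rho> (hom_module A UB X))"
  proof (intro module_homsI add_homI)
    fix f g assume f: "f \<in> carrier (hom_module R TS (restrict_scalars \<iota> X))"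
      and g: "g \<in> carrier (hom_module R TS (restrict_scalars \<iota> X))"
    \<comment> \<open>The comparison at 1 (x) t presupposes that both sides are A-linear maps on
      \<open>U\<close>; closure of the two Hom modules under addition provides this.\<close>
    note closed = H.a_closed[OF f g] H'.a_closed[of "?\<eta> f" "?\<eta> g"]
    show "?\<eta> (f \<oplus>\<^bsub>hom_module R TS (restrict_scalars \<iota> X)\<^esub> g) =
      ?\<eta> f \<oplus>\<^bsub>restrict_scalars \<rho> (hom_module A UB X)\<^esub> ?\<eta> g"
      using f g closed by (intro ext_homs_eqI[OF T_module X]) (simp_all add: adj)
  next
    fix s f assume s: "s \<in> carrier S" and f: "f \<in> carrier (hom_module R TS (restrict_scalars \<iota> X))"
    note closed = H.smult_closed[OF s f] H'.smult_closed[of "\<rho> s" "?\<eta> f"]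
    show "?\<eta> (s \<odot>\<^bsub>hom_module R TS (restrict_scalars \<iota> X)\<^esub> f) =
      s \<odot>\<^bsub>restrict_scalars \<rho> (hom_module A UB X)\<^esub> ?\<eta> f"
      using s f closed
      by (intro ext_homs_eqI[OF T_module X]) (simp_all add: adj \<rho>_homs \<rho>_unit module_homs_closed)
  qed (simp_all add: adj)
  then show "?\<eta> \<in> module_isos S (obj (hom_functor R TS \<circ>\<^sub>F res_functor \<iota>) X) (obj (res_functor \<rho> \<circ>\<^sub>F hom_functor A UB) X)"
  proof (intro module_isosI[where g = "\<lambda>g. \<lambda>t\<in>carrier T. g (unit t)"])
    show "(\<lambda>t\<in>carrier T. ?\<eta> f (unit t)) = f"
      if "f \<in> carrier (obj (hom_functor R TS \<circ>\<^sub>F res_functor \<iota>) X)" for f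
      using that module_homs_extensional[of f R T]
      by (intro extensionalityI[of _ "carrier T"]) (simp_all add: adj)
    show "?\<eta> (\<lambda>t\<in>carrier T. g (unit t)) = g"
      if "g \<in> carrier (obj (res_functor \<rho> \<circ>\<^sub>F hom_functor A UB) X)" for g
      using that unit_restrict_homs[OF T_module X, of g]
      by (intro ext_homs_eqI[OF T_module X]) (simp_all add: adj)
  qed (simp_all add: unit_restrict_homs[OF T_module X])
next
  fix X Y g f assume "X \<in> C" "Y \<in> C" and g: "g \<in> module_homs A X Y"
    and "f \<in> carrier (obj (hom_functor R TS \<circ>\<^sub>F res_functor \<iota>) X)"
  then have X: "left_module A X" and Y: "left_module A Y"
    and f: "f \<in> module_homs R T (restrict_scalars \<iota> X)"
    by (simp_all add: C)
  have gf: "compose (carrier T) g f \<in> module_homs R T (restrict_scalars \<iota> Y)"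
    by (rule module_homs_compose[OF f module_homs_restrict_scalars[OF g \<iota>] T_module])
  have "adjunct T Y (compose (carrier T) g f) = compose (carrier U) g (adjunct T X f)"
    using module_homs_compose[OF adjunct_homs[OF T_module X f] g U_module]
    by (intro ext_homs_eqI[OF T_module Y])
      (simp_all add: adjunct_homs[OF T_module Y gf] adjunct_unit[OF T_module Y gf]
        adjunct_unit[OF T_module X f] compose_eq)
  then show "(\<lambda>f\<in>module_homs R T (restrict_scalars \<iota> Y). adjunct T Y f) (mor (hom_functor R TS \<circ>\<^sub>F res_functor \<iota>) X Y g f) =
    mor (res_functor \<rho> \<circ>\<^sub>F hom_functor A UB) X Y g ((\<lambda>f\<in>module_homs R T (restrict_scalars \<iota> X). adjunct T X f) f)"
    using f gf by (simp add: adjunct_homs[OF T_module X])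
qed

section \<open>Statement (iii): the canonical map and its inverse\<close>

lemma ext_map_unit:
  "\<lbrakk>left_module R M; f \<in> module_homs R T M; t \<in> carrier T\<rbrakk> \<Longrightarrow> ext_map T M f (unit t) = tens R AR M \<one>\<^bsub>A\<^esub> (f t)"
  by (simp add: ext_map_tens T_module)

definition ext_hom where
  "ext_hom M = tensor_lift S BS (hom_module R TS M) (hom_module A UB (tensor R AR M))
    (\<lambda>b f. compose (carrier U) (ext_map T M f) b)"

text \<open>Balanced over S: b s is \<rho>(s) after b, and 1 (x) (s f) is 1 (x) f after \<rho>(s),
  so both sides equal (1 (x) f) \<rho>(s) b as a composite. Linearity over B holds because B acts by
  precomposition on source and target alike.\<close>

lemma
  assumes M: "left_module R M"
  shows ext_hom_homs: "ext_hom M \<in> module_homs B (tensor S BS (hom_module R TS M)) (hom_module A UB (tensor R AR M))"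
    and ext_hom_tens: "\<lbrakk>b \<in> module_homs A U U; f \<in> module_homs R T M\<rbrakk>
      \<Longrightarrow> ext_hom M (tens S BS (hom_module R TS M) b f) = compose (carrier U) (ext_map T M f) b"
proof -
  interpret AM: tensor_product A R AR M by (rule tensor_product[OF M])
  note AM = AM.T.left_module_axioms
  interpret H: left_module S "hom_module R TS M" by (rule left_module_hom_module[OF TS.bimod_axioms M])
  interpret H': left_module B "hom_module A UB (tensor R AR M)"
    by (rule left_module_hom_module[OF UB.bimod_axioms AM])
  interpret BH: tensor_product B S BS "hom_module R TS M" ..
  note ext = ext_map_homs[OF T_module M] ext_map_unit[OF M]
  have closed: "compose (carrier U) (ext_map T M f) b \<in> module_homs A U (tensor R AR M)"
    if "b \<in> module_homs A U U" "f \<in> module_homs R T M" for b f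
    using that ext by (intro module_homs_compose U_module)
  have ext_add: "ext_map T M (f \<oplus>\<^bsub>hom_module R TS M\<^esub> g) = ext_map T M f \<oplus>\<^bsub>hom_module A UB (tensor R AR M)\<^esub> ext_map T M g"
    if f: "f \<in> module_homs R T M" and g: "g \<in> module_homs R T M" for f g
    using f g H.a_closed[of f g] H'.a_closed[of "ext_map T M f" "ext_map T M g"]
    by (intro ext_homs_eqI[OF T_module AM]) (simp_all add: ext AM.tens_add_right module_homs_closed)
  have ext_smult: "ext_map T M (s \<odot>\<^bsub>hom_module R TS M\<^esub> f) = \<rho> s \<odot>\<^bsub>hom_module A UB (tensor R AR M)\<^esub> ext_map T M f"
    if s: "s \<in> module_homs R T T" and f: "f \<in> module_homs R T M" for s f
    using s f H.smult_closed[of s f] H'.smult_closed[of "\<rho> s" "ext_map T M f"]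
    by (intro ext_homs_eqI[OF T_module AM]) (simp_all add: ext \<rho>_homs \<rho>_unit module_homs_closed)
  have bal: "(\<lambda>b f. compose (carrier U) (ext_map T M f) b) \<in>
    balanced_maps S BS (hom_module R TS M) (hom_module A UB (tensor R AR M))"
  proof (rule balanced_mapsI)
    fix b b' f f'
    assume b: "b \<in> carrier BS" and f: "f \<in> carrier (hom_module R TS M)"
    show "compose (carrier U) (ext_map T M f) b \<in> carrier (hom_module A UB (tensor R AR M))"
      using b f closed by simp
    show "compose (carrier U) (ext_map T M f) (b \<oplus>\<^bsub>BS\<^esub> b') =
      compose (carrier U) (ext_map T M f) b \<oplus>\<^bsub>hom_module A UB (tensor R AR M)\<^esub> compose (carrier U) (ext_map T M f) b'"
      if "b' \<in> carrier BS"
      using b f that by (auto simp: compose_def module_homs_closed module_homs_add[OF ext(1)] intro!: restrict_ext)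
    show "compose (carrier U) (ext_map T M (f \<oplus>\<^bsub>hom_module R TS M\<^esub> f')) b =
      compose (carrier U) (ext_map T M f) b \<oplus>\<^bsub>hom_module A UB (tensor R AR M)\<^esub> compose (carrier U) (ext_map T M f') b"
      if "f' \<in> carrier (hom_module R TS M)"
      using b f that ext_add[of f f'] by (auto simp: compose_def module_homs_closed intro!: restrict_ext)
    show "compose (carrier U) (ext_map T M f) (rsmult BS b s) =
      compose (carrier U) (ext_map T M (s \<odot>\<^bsub>hom_module R TS M\<^esub> f)) b" if "s \<in> carrier S" for s
      using b f that ext_smult[of s f] by (auto simp: compose_def module_homs_closed intro!: restrict_ext)
  qed
  show "ext_hom M \<in> module_homs B (tensor S BS (hom_module R TS M)) (hom_module A UB (tensor R AR M))"
    unfolding ext_hom_def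
    by (rule BH.tensor_lift_module_homs[OF H'.left_module_axioms bal])
      (auto simp: compose_def module_homs_closed intro!: restrict_ext)
  show "ext_hom M (tens S BS (hom_module R TS M) b f) = compose (carrier U) (ext_map T M f) b"
    if "b \<in> module_homs A U U" "f \<in> module_homs R T M"
    unfolding ext_hom_def using that
    by (subst BH.tensor_lift_tens[OF H'.abelian_group_axioms bal]) simp_all
qed

text \<open>Applying A (x) - to the dual basis identity gives g = sum_k (1 (x) i_k) (1 (x) p_k) g,
  where (1 (x) p_k) g lies in B; this proves surjectivity and dictates the inverse. For the other
  composite, p_k f lies in S and can cross the tensor sign.\<close>

lemma ext_hom_iso:
  assumes M: "left_module R M" and "M \<in> add_cat R T"
  shows "ext_hom M \<in> module_isos B (tensor S BS (hom_module R TS M)) (hom_module A UB (tensor R AR M))"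
proof -
  obtain n :: nat and i p where i: "\<And>k. k < n \<Longrightarrow> i k \<in> module_homs R T M"
    and p: "\<And>k. k < n \<Longrightarrow> p k \<in> module_homs R M T"
    and sum: "\<And>x. x \<in> carrier M \<Longrightarrow> finsum M (\<lambda>k. i k (p k x)) {..<n} = x"
    using add_cat_dual_basis[OF T_module \<open>M \<in> add_cat R T\<close>] by blast
  interpret AM: tensor_product A R AR M by (rule tensor_product[OF M])
  note AM = AM.T.left_module_axioms
  interpret H: left_module S "hom_module R TS M" by (rule left_module_hom_module[OF TS.bimod_axioms M])
  interpret H': left_module B "hom_module A UB (tensor R AR M)"
    by (rule left_module_hom_module[OF UB.bimod_axioms AM])
  interpret BH: tensor_product B S BS "hom_module R TS M" ..
  note ext = ext_map_homs[OF T_module M] ext_map_homs[OF M T_module]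
  define \<theta> where "\<theta> g = finsum (tensor S BS (hom_module R TS M))
    (\<lambda>k. tens S BS (hom_module R TS M) (compose (carrier U) (ext_map M T (p k)) g) (i k)) {..<n}" for g
  have pg: "compose (carrier U) (ext_map M T (p k)) g \<in> module_homs A U U"
    if "k < n" "g \<in> module_homs A U (tensor R AR M)" for k g
    using that ext p by (intro module_homs_compose U_module) auto
  \<comment> \<open>No balancing condition arises, as \<open>\<theta>\<close> starts at a Hom group.
    Additivity is what allows \<open>\<theta>\<close> after \<open>ext_hom\<close> to be tested on
    pure tensors.\<close>
  have \<theta>: "\<theta> \<in> add_hom (hom_module A UB (tensor R AR M)) (tensor S BS (hom_module R TS M))"
    unfolding \<theta>_def
  proof (rule finsum_add_hom[OF BH.T.abelian_group_axioms])
    fix k assume "k \<in> {..<n}"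
    then have k: "k < n" by simp
    show "(\<lambda>g. tens S BS (hom_module R TS M) (compose (carrier U) (ext_map M T (p k)) g) (i k)) \<in>
      add_hom (hom_module A UB (tensor R AR M)) (tensor S BS (hom_module R TS M))"
    proof (rule add_hom_compose[OF _ BH.tens_left_add_hom])
      show "compose (carrier U) (ext_map M T (p k)) \<in> add_hom (hom_module A UB (tensor R AR M)) BS"
        using pg[OF k] ext(2)[OF p[OF k]]
        by (intro add_homI) (auto simp: compose_def module_homs_closed module_homs_add intro!: restrict_ext)
    qed (simp add: i k)
  qed
  show ?thesis
  proof (rule module_isosI[OF ext_hom_homs[OF M], where g = \<theta>])
    show "\<theta> g \<in> carrier (tensor S BS (hom_module R TS M))"
      if "g \<in> carrier (hom_module A UB (tensor R AR M))" for g
      using that by (rule add_hom_closed[OF \<theta>])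
  next
    fix g assume "g \<in> carrier (hom_module A UB (tensor R AR M))"
    then have g: "g \<in> module_homs A U (tensor R AR M)" by simp
    \<comment> \<open>The dual basis identity tensored with \<open>A\<close>. Both sides are
      additive in \<open>w\<close>, so pure tensors suffice, and there the sum moves into the right
      factor.\<close>
    have ext_sum: "finsum (tensor R AR M) (\<lambda>k. ext_map T M (i k) (ext_map M T (p k) w)) {..<n} = w"
      if "w \<in> carrier (tensor R AR M)" for w
    proof (rule AM.tensor_add_hom_eq[OF finsum_add_hom[OF AM.T.abelian_group_axioms] _ _ that])
      show "(\<lambda>w. ext_map T M (i k) (ext_map M T (p k) w)) \<in> add_hom (tensor R AR M) (tensor R AR M)"
        if "k \<in> {..<n}" for k
        using that by (intro add_hom_compose[OF module_homs_add_hom[OF ext(2)[OF p]] module_homs_add_hom[OF ext(1)[OF i]]]) simp_all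
      show "(\<lambda>w. w) \<in> add_hom (tensor R AR M) (tensor R AR M)"
        by (rule add_homI) simp_all
      fix a x assume a: "a \<in> carrier AR" and x: "x \<in> carrier M"
      have "finsum (tensor R AR M) (\<lambda>k. ext_map T M (i k) (ext_map M T (p k) (tens R AR M a x))) {..<n} =
        finsum (tensor R AR M) (\<lambda>k. tens R AR M a (i k (p k x))) {..<n}"
        using a x i p
        by (intro AM.T.finsum_cong')
          (auto simp: ext_map_tens[OF M T_module p] ext_map_tens[OF T_module M i] module_homs_closed[OF i]
            module_homs_closed[OF p] intro!: AM.tens_closed)
      also have "\<dots> = tens R AR M a (finsum M (\<lambda>k. i k (p k x)) {..<n})"
        using a x
        by (intro add_hom_finsum[OF AM.tens_right_add_hom, symmetric] AM.N.abelian_group_axioms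
            AM.T.abelian_group_axioms) (simp_all add: module_homs_closed[OF i] module_homs_closed[OF p])
      finally show "finsum (tensor R AR M) (\<lambda>k. ext_map T M (i k) (ext_map M T (p k) (tens R AR M a x))) {..<n} =
        tens R AR M a x" by (simp add: sum x)
    qed
    have comp: "compose (carrier U) (ext_map T M (i k)) (compose (carrier U) (ext_map M T (p k)) g) \<in> module_homs A U (tensor R AR M)"
      if "k < n" for k
      by (rule module_homs_compose[OF pg[OF that g] ext(1)[OF i[OF that]] U_module])
    have "ext_hom M (\<theta> g) = finsum (hom_module A UB (tensor R AR M))
      (\<lambda>k. ext_hom M (tens S BS (hom_module R TS M) (compose (carrier U) (ext_map M T (p k)) g) (i k))) {..<n}"
      unfolding \<theta>_def using i pg[OF _ g]
      by (intro add_hom_finsum[OF module_homs_add_hom[OF ext_hom_homs[OF M]]] BH.T.abelian_group_axioms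
          H'.abelian_group_axioms) (auto intro!: BH.tens_closed)
    also have "\<dots> = finsum (hom_module A UB (tensor R AR M))
      (\<lambda>k. compose (carrier U) (ext_map T M (i k)) (compose (carrier U) (ext_map M T (p k)) g)) {..<n}"
      using i pg[OF _ g] comp by (intro H'.finsum_cong') (auto simp: ext_hom_tens[OF M])
    also have "\<dots> = g"
    proof (rule module_homs_eqI[OF _ g])
      show "finsum (hom_module A UB (tensor R AR M))
        (\<lambda>k. compose (carrier U) (ext_map T M (i k)) (compose (carrier U) (ext_map M T (p k)) g)) {..<n} \<in> module_homs A U (tensor R AR M)"
        using comp H'.finsum_closed[of _ "{..<n}"] by auto
      fix u assume u: "u \<in> carrier U"
      have "finsum (hom_module A UB (tensor R AR M))
        (\<lambda>k. compose (carrier U) (ext_map T M (i k)) (compose (carrier U) (ext_map M T (p k)) g)) {..<n} u =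
        finsum (tensor R AR M)
        (\<lambda>k. compose (carrier U) (ext_map T M (i k)) (compose (carrier U) (ext_map M T (p k)) g) u) {..<n}"
        using u comp by (intro hom_module_finsum_apply[OF UB.bimod_axioms AM]) auto
      also have "\<dots> = finsum (tensor R AR M) (\<lambda>k. ext_map T M (i k) (ext_map M T (p k) (g u))) {..<n}"
        using u by (simp add: compose_def)
      also have "\<dots> = g u" using ext_sum module_homs_closed[OF g u] .
      finally show "finsum (hom_module A UB (tensor R AR M))
        (\<lambda>k. compose (carrier U) (ext_map T M (i k)) (compose (carrier U) (ext_map M T (p k)) g)) {..<n} u = g u" .
    qed
    finally show "ext_hom M (\<theta> g) = g" .
  next
    fix w assume w: "w \<in> carrier (tensor S BS (hom_module R TS M))"
    show "\<theta> (ext_hom M w) = w"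
    proof (rule BH.tensor_add_hom_eq[OF add_hom_compose[OF module_homs_add_hom[OF ext_hom_homs[OF M]] \<theta>] _ _ w])
      show "(\<lambda>w. w) \<in> add_hom (tensor S BS (hom_module R TS M)) (tensor S BS (hom_module R TS M))"
        by (rule add_homI) simp_all
      fix b f assume "b \<in> carrier BS" "f \<in> carrier (hom_module R TS M)"
      then have b: "b \<in> module_homs A U U" and f: "f \<in> module_homs R T M" by simp_all
      \<comment> \<open>Write s_k for this element of S. As (1 (x) p_k) (1 (x) f) = \<rho>(s_k), the
        k-th summand of the image is (b s_k) (x) i_k = b (x) (s_k i_k). Here s_k i_k sends t to
        i_k(p_k(f(t))), so these maps add up to f.\<close>
      let ?s = "\<lambda>k. compose (carrier T) (p k) f"
      have s: "?s k \<in> module_homs R T T" if "k < n" for k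
        using that p f by (intro module_homs_compose T_module)
      have si: "?s k \<odot>\<^bsub>hom_module R TS M\<^esub> i k \<in> module_homs R T M" if "k < n" for k
        using that s i H.smult_closed[of "?s k" "i k"] by simp
      have \<rho>_s: "ext_map M T (p k) (ext_map T M f v) = \<rho> (?s k) v" if k: "k < n" and v: "v \<in> carrier U" for k v
      proof -
        have "compose (carrier U) (ext_map M T (p k)) (ext_map T M f) = \<rho> (?s k)"
          using module_homs_compose[OF ext(1)[OF f] ext(2)[OF p[OF k]] U_module]
          by (intro ext_homs_eqI[OF T_module U_module])
            (simp_all add: \<rho>_homs \<rho>_unit s k compose_eq ext_map_tens[OF T_module M f]
              ext_map_tens[OF M T_module p[OF k]] module_homs_closed[OF f])
        from fun_cong[OF this, of v] v show ?thesis by (simp add: compose_def)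
      qed
      have "\<theta> (ext_hom M (tens S BS (hom_module R TS M) b f)) =
        finsum (tensor S BS (hom_module R TS M)) (\<lambda>k. tens S BS (hom_module R TS M) b (?s k \<odot>\<^bsub>hom_module R TS M\<^esub> i k)) {..<n}"
        unfolding \<theta>_def
      proof (rule BH.T.finsum_cong')
        fix k assume "k \<in> {..<n}"
        then have k: "k < n" by simp
        have "compose (carrier U) (ext_map M T (p k)) (ext_hom M (tens S BS (hom_module R TS M) b f)) = rsmult BS b (?s k)"
          using b f k by (auto simp: ext_hom_tens[OF M] compose_def module_homs_closed \<rho>_s[unfolded compose_def] intro!: restrict_ext)
        then show "tens S BS (hom_module R TS M)
            (compose (carrier U) (ext_map M T (p k)) (ext_hom M (tens S BS (hom_module R TS M) b f))) (i k) =
          tens S BS (hom_module R TS M) b (?s k \<odot>\<^bsub>hom_module R TS M\<^esub> i k)"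
          using BH.tens_balanced[of b "?s k" "i k"] b s[OF k] i[OF k] by simp
      qed (use b si in \<open>auto intro!: BH.tens_closed\<close>)
      also have "\<dots> = tens S BS (hom_module R TS M) b (finsum (hom_module R TS M) (\<lambda>k. ?s k \<odot>\<^bsub>hom_module R TS M\<^esub> i k) {..<n})"
        using b si
        by (intro add_hom_finsum[OF BH.tens_right_add_hom, symmetric] H.abelian_group_axioms
            BH.T.abelian_group_axioms) auto
      also have "finsum (hom_module R TS M) (\<lambda>k. ?s k \<odot>\<^bsub>hom_module R TS M\<^esub> i k) {..<n} = f"
      proof (rule module_homs_eqI[OF _ f])
        show "finsum (hom_module R TS M) (\<lambda>k. ?s k \<odot>\<^bsub>hom_module R TS M\<^esub> i k) {..<n} \<in> module_homs R T M"
          using si H.finsum_closed[of _ "{..<n}"] by auto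
        fix t assume t: "t \<in> carrier T"
        have "finsum (hom_module R TS M) (\<lambda>k. ?s k \<odot>\<^bsub>hom_module R TS M\<^esub> i k) {..<n} t =
          finsum M (\<lambda>k. (?s k \<odot>\<^bsub>hom_module R TS M\<^esub> i k) t) {..<n}"
          using t si by (intro hom_module_finsum_apply[OF TS.bimod_axioms M]) auto
        also have "\<dots> = finsum M (\<lambda>k. i k (p k (f t))) {..<n}"
          using t by (simp add: compose_def)
        finally show "finsum (hom_module R TS M) (\<lambda>k. ?s k \<odot>\<^bsub>hom_module R TS M\<^esub> i k) {..<n} t = f t"
          by (simp add: sum module_homs_closed[OF f t])
      qed
      finally show "\<theta> (ext_hom M (tens S BS (hom_module R TS M) b f)) = tens S BS (hom_module R TS M) b f" .
    qed
  qed
qed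


text \<open>Naturality is functoriality of A (x) -: both ways round the square send b (x) f to (1
  (x) h f) b. No dual basis occurs in \<open>ext_hom\<close>, so the bases chosen for
  \<open>M\<close> and \<open>N\<close> need not be compatible.\<close>

theorem ext_hom_natural_iso:
  fixes C :: "('r, 'm) module set"
  assumes C: "\<And>M. M \<in> C \<Longrightarrow> left_module R M" "C \<subseteq> add_cat R T"
  shows "naturally_isomorphic R C B (tensor_functor S BS \<circ>\<^sub>F hom_functor R TS) (hom_functor A UB \<circ>\<^sub>F tensor_functor R AR)"
proof (rule naturally_isomorphicI[where \<eta> = ext_hom])
  show "ext_hom M \<in> module_isos B (obj (tensor_functor S BS \<circ>\<^sub>F hom_functor R TS) M)
    (obj (hom_functor A UB \<circ>\<^sub>F tensor_functor R AR) M)" if "M \<in> C" for M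
    using ext_hom_iso[of M] C that by auto
  fix M N h w assume "M \<in> C" "N \<in> C" and h: "h \<in> module_homs R M N"
    and "w \<in> carrier (obj (tensor_functor S BS \<circ>\<^sub>F hom_functor R TS) M)"
  then have M: "left_module R M" and N: "left_module R N"
    and w: "w \<in> carrier (tensor S BS (hom_module R TS M))" by (simp_all add: C)
  interpret AM: tensor_product A R AR M by (rule tensor_product[OF M])
  interpret AN: tensor_product A R AR N by (rule tensor_product[OF N])
  interpret HM: left_module S "hom_module R TS M" by (rule left_module_hom_module[OF TS.bimod_axioms M])
  interpret HN: left_module S "hom_module R TS N" by (rule left_module_hom_module[OF TS.bimod_axioms N])
  interpret BM: tensor_product B S BS "hom_module R TS M" ..
  interpret BN: tensor_product B S BS "hom_module R TS N" ..
  let ?h = "\<lambda>f\<in>module_homs R T M. compose (carrier T) h f"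
  let ?Bh = "tensor_map S BS (hom_module R TS M) BS (hom_module R TS N) (\<lambda>b. b) ?h"
  let ?h' = "\<lambda>g\<in>module_homs A U (tensor R AR M). compose (carrier U) (ext_map M N h) g"
  have hf: "compose (carrier T) h f \<in> module_homs R T N" if "f \<in> module_homs R T M" for f
    using that h by (rule module_homs_compose[OF _ _ T_module])
  have h_hom: "?h \<in> module_homs S (hom_module R TS M) (hom_module R TS N)"
    using HM.a_closed HM.smult_closed
    by (intro module_homsI add_homI)
      (auto simp: hf[unfolded compose_def] compose_def module_homs_closed module_homs_add[OF h] intro!: restrict_ext)
  note Bh = tensor_map_right_homs[OF BM.tensor_product_axioms BN.tensor_product_axioms h_hom]
    and Bh_tens = tensor_map_right_tens[OF BM.tensor_product_axioms BN.tensor_product_axioms h_hom]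
  note ext_h = ext_map_homs[OF M N h]
  have h'_hom: "?h' \<in> add_hom (hom_module A UB (tensor R AR M)) (hom_module A UB (tensor R AR N))"
  proof (intro add_homI)
    interpret H: left_module B "hom_module A UB (tensor R AR M)"
      by (rule left_module_hom_module[OF UB.bimod_axioms AM.T.left_module_axioms])
    show "?h' (f \<oplus>\<^bsub>hom_module A UB (tensor R AR M)\<^esub> g) = ?h' f \<oplus>\<^bsub>hom_module A UB (tensor R AR N)\<^esub> ?h' g"
      if "f \<in> carrier (hom_module A UB (tensor R AR M))" "g \<in> carrier (hom_module A UB (tensor R AR M))" for f g
      using that H.a_closed[OF that]
      by (auto simp: compose_def module_homs_closed module_homs_add[OF ext_h] intro!: restrict_ext)
  qed (simp add: module_homs_compose[OF _ ext_h U_module])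
  have "ext_hom N (?Bh w) = ?h' (ext_hom M w)"
  proof (rule BM.tensor_add_hom_eq[OF _ _ _ w])
    show "(\<lambda>w. ext_hom N (?Bh w)) \<in> add_hom (tensor S BS (hom_module R TS M)) (hom_module A UB (tensor R AR N))"
      by (rule add_hom_compose[OF module_homs_add_hom[OF Bh] module_homs_add_hom[OF ext_hom_homs[OF N]]])
    show "(\<lambda>w. ?h' (ext_hom M w)) \<in> add_hom (tensor S BS (hom_module R TS M)) (hom_module A UB (tensor R AR N))"
      by (rule add_hom_compose[OF module_homs_add_hom[OF ext_hom_homs[OF M]] h'_hom])
    fix b f assume "b \<in> carrier BS" "f \<in> carrier (hom_module R TS M)"
    then have b: "b \<in> module_homs A U U" and f: "f \<in> module_homs R T M" by simp_all
    have "compose (carrier U) (ext_map M N h) (ext_map T M f) = ext_map T N (compose (carrier T) h f)"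
      using module_homs_compose[OF ext_map_homs[OF T_module M f] ext_h U_module]
      by (intro ext_homs_eqI[OF T_module AN.T.left_module_axioms])
        (simp_all add: ext_map_homs[OF T_module N hf[OF f]] compose_eq ext_map_tens[OF T_module M f]
          ext_map_tens[OF T_module N hf[OF f]] ext_map_tens[OF M N h] module_homs_closed[OF f])
    then have "compose (carrier U) (ext_map M N h) (compose (carrier U) (ext_map T M f) b) =
      compose (carrier U) (ext_map T N (compose (carrier T) h f)) b"
      using compose_assoc[of b "carrier U" "carrier U"] module_homs_closed[OF b]
      by (metis Pi_I)
    moreover have "compose (carrier U) (ext_map T M f) b \<in> module_homs A U (tensor R AR M)"
      by (rule module_homs_compose[OF b ext_map_homs[OF T_module M f] U_module])
    ultimately show "ext_hom N (?Bh (tens S BS (hom_module R TS M) b f)) = ?h' (ext_hom M (tens S BS (hom_module R TS M) b f))"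
      using b f by (simp add: Bh_tens ext_hom_tens[OF M] ext_hom_tens[OF N] hf)
  qed
  then show "ext_hom N (mor (tensor_functor S BS \<circ>\<^sub>F hom_functor R TS) M N h w) =
    mor (hom_functor A UB \<circ>\<^sub>F tensor_functor R AR) M N h (ext_hom M w)"
    by simp
qed

section \<open>Compatibility with the tensor functors\<close>

definition res_tensor where
  "res_tensor Q = tensor_lift S TS (restrict_scalars \<rho> Q) (restrict_scalars \<iota> (tensor B UB Q))
    (\<lambda>t q. tens B UB Q (unit t) q)"

text \<open>Balanced over S because 1 (x) t s = (1 (x) t) \<rho>(s), and \<rho>(s) crosses the
  tensor sign over B. Linear over R because 1 (x) r t = \<iota>(r) (1 (x) t).\<close>

lemma
  assumes Q: "left_module B Q"
  shows res_tensor_homs: "res_tensor Q \<in> module_homs R (tensor S TS (restrict_scalars \<rho> Q))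
      (restrict_scalars \<iota> (tensor B UB Q))"
    and res_tensor_tens: "\<lbrakk>t \<in> carrier T; q \<in> carrier Q\<rbrakk>
      \<Longrightarrow> res_tensor Q (tens S TS (restrict_scalars \<rho> Q) t q) = tens B UB Q (unit t) q"
proof -
  interpret Q: left_module B Q by fact
  interpret rQ: left_module S "restrict_scalars \<rho> Q"
    by (rule left_module_restrict_scalars[OF Q TS.S.ring_axioms \<rho>])
  interpret TQ: tensor_product R S TS "restrict_scalars \<rho> Q" ..
  interpret UQ: tensor_product A B UB Q ..
  interpret rUQ: left_module R "restrict_scalars \<iota> (tensor B UB Q)"
    by (rule left_module_restrict_scalars[OF UQ.T.left_module_axioms R.ring_axioms \<iota>])
  have bal: "(\<lambda>t q. tens B UB Q (unit t) q) \<in>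
    balanced_maps S TS (restrict_scalars \<rho> Q) (restrict_scalars \<iota> (tensor B UB Q))"
  proof (rule balanced_mapsI)
    show "tens B UB Q (unit (rsmult TS t s)) q = tens B UB Q (unit t) (s \<odot>\<^bsub>restrict_scalars \<rho> Q\<^esub> q)"
      if "t \<in> carrier TS" "s \<in> carrier S" "q \<in> carrier (restrict_scalars \<rho> Q)" for t s q
      using that UQ.tens_balanced[of "unit t" "\<rho> s" q] by (simp add: \<rho>_homs \<rho>_unit)
    show "tens B UB Q (unit (t \<oplus>\<^bsub>TS\<^esub> t')) q = tens B UB Q (unit t) q \<oplus>\<^bsub>restrict_scalars \<iota> (tensor B UB Q)\<^esub> tens B UB Q (unit t') q"
      if "t \<in> carrier TS" "t' \<in> carrier TS" "q \<in> carrier (restrict_scalars \<rho> Q)" for t t' q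
      using that UQ.tens_add_left[of "unit t" "unit t'" q] by (simp add: U.tens_add_right)
  qed (simp_all add: UQ.tens_add_right)
  show "res_tensor Q \<in> module_homs R (tensor S TS (restrict_scalars \<rho> Q)) (restrict_scalars \<iota> (tensor B UB Q))"
    unfolding res_tensor_def
  proof (rule TQ.tensor_lift_module_homs[OF rUQ.left_module_axioms bal])
    show "tens B UB Q (unit (r \<odot>\<^bsub>TS\<^esub> t)) q = r \<odot>\<^bsub>restrict_scalars \<iota> (tensor B UB Q)\<^esub> tens B UB Q (unit t) q"
      if "r \<in> carrier R" "t \<in> carrier TS" "q \<in> carrier (restrict_scalars \<rho> Q)" for r t q
      using that ring_hom_closed[OF \<iota> that(1)]
      by (simp add: unit_tens_linear[OF T_module] UQ.smult_tens)
  qed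
  show "res_tensor Q (tens S TS (restrict_scalars \<rho> Q) t q) = tens B UB Q (unit t) q"
    if "t \<in> carrier T" "q \<in> carrier Q"
    unfolding res_tensor_def using that
    by (subst TQ.tensor_lift_tens[OF rUQ.abelian_group_axioms bal]) simp_all
qed

text \<open>The transpose of the identity of \<open>U\<close>. As the map \<open>h\<close> in the
  formula for \<omega> below, it has adjunct 1 and so recovers t (x) q from 1 (x) t and q.\<close>

lemma unit_homs: "(\<lambda>t\<in>carrier T. unit t) \<in> module_homs R T (restrict_scalars \<iota> U)"
proof -
  have "(\<lambda>u\<in>carrier U. u) \<in> module_homs A U U" using UB.S.one_closed by simp
  from unit_restrict_homs[OF T_module U_module this] show ?thesis
    by (auto simp: restrict_def cong: if_cong)
qed

text \<open>In essence this is the cancellation of T (x) B over S to U. By the dual basis, the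
  elements \<beta>_k generate B as a left S-module along \<rho>, the extension of h having
  coefficient p_k h at \<beta>_k. Hence a scalar from B can be rewritten through scalars from S,
  which are the only ones that cross the tensor sign in the source.\<close>

lemma res_tensor_iso:
  assumes Q: "left_module B Q" and U_add: "restrict_scalars \<iota> U \<in> add_cat R T"
  shows "res_tensor Q \<in> module_isos R (tensor S TS (restrict_scalars \<rho> Q)) (restrict_scalars \<iota> (tensor B UB Q))"
proof -
  obtain n :: nat and i p where i: "\<And>k. k < n \<Longrightarrow> i k \<in> module_homs R T (restrict_scalars \<iota> U)"
    and p: "\<And>k. k < n \<Longrightarrow> p k \<in> module_homs R (restrict_scalars \<iota> U) T"
    and sum_res: "\<And>x. x \<in> carrier (restrict_scalars \<iota> U) \<Longrightarrow>
      finsum (restrict_scalars \<iota> U) (\<lambda>k. i k (p k x)) {..<n} = x"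
    using add_cat_dual_basis[OF T_module U_add] by blast
  have ic: "i k t \<in> carrier U" if "k < n" "t \<in> carrier T" for k t
    using module_homs_closed[OF i that(2)] that by simp
  have pc: "p k u \<in> carrier T" if "k < n" "u \<in> carrier U" for k u
    using module_homs_closed[OF p] that by simp
  have p_add: "p k (u \<oplus>\<^bsub>U\<^esub> v) = p k u \<oplus>\<^bsub>T\<^esub> p k v" if "k < n" "u \<in> carrier U" "v \<in> carrier U" for k u v
    using module_homs_add[OF p] that by simp
  have sum: "finsum U (\<lambda>k. i k (p k u)) {..<n} = u" if "u \<in> carrier U" for u
    using sum_res[of u] that
      finsum_restrict_scalars[OF U.T.abelian_group_axioms, of "{..<n}" "\<lambda>k. i k (p k u)" \<iota>]
    by (simp add: ic pc)
  interpret Q: left_module B Q by fact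
  interpret rQ: left_module S "restrict_scalars \<rho> Q"
    by (rule left_module_restrict_scalars[OF Q TS.S.ring_axioms \<rho>])
  interpret TQ: tensor_product R S TS "restrict_scalars \<rho> Q" ..
  interpret UQ: tensor_product A B UB Q ..
  interpret rUQ: left_module R "restrict_scalars \<iota> (tensor B UB Q)"
    by (rule left_module_restrict_scalars[OF UQ.T.left_module_axioms R.ring_axioms \<iota>])
  let ?TQ = "tensor S TS (restrict_scalars \<rho> Q)" and ?tens = "tens S TS (restrict_scalars \<rho> Q)"
  note adj = adjunct_homs[OF T_module U_module] adjunct_unit[OF T_module U_module]
  define \<beta> where "\<beta> k = adjunct T U (i k)" for k
  have \<beta>: "\<beta> k \<in> module_homs A U U" "t \<in> carrier T \<Longrightarrow> \<beta> k (unit t) = i k t" if "k < n" for k t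
    using adj(1)[OF i[OF that]] adj(2)[OF i[OF that]] by (simp_all add: \<beta>_def)
  have s: "compose (carrier T) (p k) h \<in> module_homs R T T"
    if "k < n" "h \<in> module_homs R T (restrict_scalars \<iota> U)" for k h
    by (rule module_homs_compose[OF that(2) p[OF that(1)] T_module])
  \<comment> \<open>The map h is the sum of the composites of p_k h with i_k, and p_k h lies in S.
    Transposing turns this into an identity in \<open>B\<close>, whose product is reversed:
    \<rho>(p_k h) \<beta>_k means \<beta>_k after \<rho>(p_k h). At 1 (x) t it reads h(t) = sum_k
    i_k(p_k(h(t))).\<close>
  have adjunct_expand: "adjunct T U h = finsum B (\<lambda>k. \<rho> (compose (carrier T) (p k) h) \<otimes>\<^bsub>B\<^esub> \<beta> k) {..<n}"
    if h: "h \<in> module_homs R T (restrict_scalars \<iota> U)" for h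
  proof (rule ext_homs_eqI[OF T_module U_module adj(1)[OF h]])
    have b: "\<rho> (compose (carrier T) (p k) h) \<otimes>\<^bsub>B\<^esub> \<beta> k \<in> carrier B" if "k < n" for k
      using \<rho>_homs[OF s[OF that h]] \<beta>(1)[OF that] by (intro UB.S.m_closed) simp_all
    then show "finsum B (\<lambda>k. \<rho> (compose (carrier T) (p k) h) \<otimes>\<^bsub>B\<^esub> \<beta> k) {..<n} \<in> module_homs A U U"
      using UB.S.finsum_closed[of _ "{..<n}"] by auto
    fix t assume t: "t \<in> carrier T"
    have ht: "h t \<in> carrier U" using module_homs_closed[OF h t] by simp
    have "(\<lambda>b. b (unit t)) \<in> add_hom B U"
      using t by (intro add_homI) (simp_all add: module_homs_closed)
    from add_hom_finsum[OF this UB.S.abelian_group_axioms U.T.abelian_group_axioms finite_lessThan b]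
    have "finsum B (\<lambda>k. \<rho> (compose (carrier T) (p k) h) \<otimes>\<^bsub>B\<^esub> \<beta> k) {..<n} (unit t) =
      finsum U (\<lambda>k. (\<rho> (compose (carrier T) (p k) h) \<otimes>\<^bsub>B\<^esub> \<beta> k) (unit t)) {..<n}" by simp
    also have "\<dots> = finsum U (\<lambda>k. i k (p k (h t))) {..<n}"
      using t ht by (intro U.T.finsum_cong') (auto simp: compose_eq \<rho>_unit s[OF _ h] \<beta>(2) pc ic)
    finally show "adjunct T U h (unit t) = finsum B (\<lambda>k. \<rho> (compose (carrier T) (p k) h) \<otimes>\<^bsub>B\<^esub> \<beta> k) {..<n} (unit t)"
      by (simp add: sum ht adj(2)[OF h t])
  qed
  \<comment> \<open>That \<open>\<omega>\<close> is balanced over \<open>B\<close> and induces a left inverse both follow from \<open>\<omega>_hom\<close> below,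
    applied to \<open>b \<circ> i j\<close> and to the unit \<open>t \<mapsto> 1 \<otimes> t\<close>, respectively.\<close>
  define \<omega> where "\<omega> u q = finsum ?TQ (\<lambda>k. ?tens (p k u) (\<beta> k \<odot>\<^bsub>Q\<^esub> q)) {..<n}" for u q
  have \<beta>q: "\<beta> k \<odot>\<^bsub>Q\<^esub> q \<in> carrier Q" if "k < n" "q \<in> carrier Q" for k q
    using that \<beta>(1) by (simp add: Q.smult_closed)
  have \<omega>_left: "(\<lambda>u. \<omega> u q) \<in> add_hom U ?TQ" if q: "q \<in> carrier Q" for q
    unfolding \<omega>_def
    by (intro finsum_add_hom TQ.T.abelian_group_axioms add_homI)
      (use q \<beta>q TQ.tens_add_left in \<open>simp_all add: pc p_add\<close>)
  have \<omega>_right: "\<omega> u \<in> add_hom Q ?TQ" if u: "u \<in> carrier U" for u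
    unfolding \<omega>_def[abs_def]
    by (intro finsum_add_hom TQ.T.abelian_group_axioms add_homI)
      (use u \<beta>q TQ.tens_add_right in \<open>simp_all add: pc \<beta>(1) Q.smult_r_distr\<close>)
  \<comment> \<open>Once the adjunct is expanded, each coefficient \<rho>(p_k h) is a scalar from S
    and crosses over to t, where t (p_k h) = p_k(h(t)).\<close>
  have \<omega>_hom: "\<omega> (h t) q = ?tens t (adjunct T U h \<odot>\<^bsub>Q\<^esub> q)"
    if h: "h \<in> module_homs R T (restrict_scalars \<iota> U)" and t: "t \<in> carrier T" and q: "q \<in> carrier Q" for h t q
  proof -
    let ?s = "\<lambda>k. compose (carrier T) (p k) h"
    have \<rho>s: "\<rho> (?s k) \<in> carrier B" if "k < n" for k using \<rho>_homs[OF s[OF that h]] by simp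
    have \<rho>sb: "\<rho> (?s k) \<otimes>\<^bsub>B\<^esub> \<beta> k \<in> carrier B" if "k < n" for k
      using \<rho>s[OF that] \<beta>(1)[OF that] by (intro UB.S.m_closed) simp_all
    have "(\<lambda>b. b \<odot>\<^bsub>Q\<^esub> q) \<in> add_hom B Q"
      using q by (intro add_homI) (simp_all only: Q.smult_closed Q.smult_l_distr)
    from add_hom_compose[OF this, of "?tens t" ?TQ]
    have "(\<lambda>b. ?tens t (b \<odot>\<^bsub>Q\<^esub> q)) \<in> add_hom B ?TQ"
      using TQ.tens_right_add_hom[of t] t by (simp add: hom_def)
    from add_hom_finsum[OF this UB.S.abelian_group_axioms TQ.T.abelian_group_axioms finite_lessThan \<rho>sb]
    have "?tens t (adjunct T U h \<odot>\<^bsub>Q\<^esub> q) = finsum ?TQ (\<lambda>k. ?tens t ((\<rho> (?s k) \<otimes>\<^bsub>B\<^esub> \<beta> k) \<odot>\<^bsub>Q\<^esub> q)) {..<n}"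
      unfolding adjunct_expand[OF h] by simp
    also have "\<dots> = \<omega> (h t) q"
      unfolding \<omega>_def
    proof (rule TQ.T.finsum_cong')
      fix k assume "k \<in> {..<n}"
      then have k: "k < n" by simp
      have "(\<rho> (?s k) \<otimes>\<^bsub>B\<^esub> \<beta> k) \<odot>\<^bsub>Q\<^esub> q = ?s k \<odot>\<^bsub>restrict_scalars \<rho> Q\<^esub> (\<beta> k \<odot>\<^bsub>Q\<^esub> q)"
        using \<rho>s[OF k] \<beta>(1)[OF k] q Q.smult_assoc[of "\<rho> (?s k)" "\<beta> k" q] by simp
      then show "?tens t ((\<rho> (?s k) \<otimes>\<^bsub>B\<^esub> \<beta> k) \<odot>\<^bsub>Q\<^esub> q) = ?tens (p k (h t)) (\<beta> k \<odot>\<^bsub>Q\<^esub> q)"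
        using TQ.tens_balanced[of t "?s k" "\<beta> k \<odot>\<^bsub>Q\<^esub> q"] t s[OF k h] \<beta>q[OF k q] by (simp add: compose_eq)
    qed (use t q module_homs_closed[OF h t] in \<open>auto simp: pc \<beta>q\<close>)
    finally show ?thesis ..
  qed
  have \<omega>_bal: "\<omega> (b u) q = \<omega> u (b \<odot>\<^bsub>Q\<^esub> q)"
    if b: "b \<in> module_homs A U U" and u: "u \<in> carrier U" and q: "q \<in> carrier Q" for b u q
  proof -
    have bh: "compose (carrier T) b (i j) \<in> module_homs R T (restrict_scalars \<iota> U)" if "j < n" for j
      by (rule module_homs_compose[OF i[OF that] module_homs_restrict_scalars[OF b \<iota>] T_module])
    have bi: "adjunct T U (compose (carrier T) b (i j)) = \<beta> j \<otimes>\<^bsub>B\<^esub> b" if j: "j < n" for j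
      using UB.S.m_closed[of "\<beta> j" b] \<beta>(1)[OF j] b
      by (intro ext_homs_eqI[OF T_module U_module adj(1)[OF bh[OF j]]])
        (simp_all add: adj(2)[OF bh[OF j]] compose_eq \<beta>(2) j)
    have closed: "b (i j (p j u)) \<in> carrier U" if "j < n" for j
      using module_homs_closed[OF b ic[OF that pc[OF that u]]] .
    \<comment> \<open>The element u need not be of the form h(t), but it is the sum of the elements
      i_j(p_j(u)), which are of this form with t = p_j(u). After applying b the maps in question are
      b after i_j, with adjunct the product \<beta>_j b in \<open>B\<close>, so b ends up next to
      q.\<close>
    have "b u = b (finsum U (\<lambda>j. i j (p j u)) {..<n})"
      by (simp add: sum u)
    also have "\<dots> = finsum U (\<lambda>j. b (i j (p j u))) {..<n}"
      using u by (intro add_hom_finsum[OF module_homs_add_hom[OF b]] U.T.abelian_group_axioms) (simp_all add: ic pc)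
    finally have "\<omega> (b u) q = \<omega> (finsum U (\<lambda>j. b (i j (p j u))) {..<n}) q" by simp
    also have "\<dots> = finsum ?TQ (\<lambda>j. \<omega> (b (i j (p j u))) q) {..<n}"
      using closed by (intro add_hom_finsum[OF \<omega>_left[OF q]] U.T.abelian_group_axioms TQ.T.abelian_group_axioms) simp_all
    also have "\<dots> = finsum ?TQ (\<lambda>j. ?tens (p j u) (\<beta> j \<odot>\<^bsub>Q\<^esub> (b \<odot>\<^bsub>Q\<^esub> q))) {..<n}"
    proof (rule TQ.T.finsum_cong')
      fix j assume "j \<in> {..<n}"
      then have j: "j < n" by simp
      have "\<omega> (b (i j (p j u))) q = ?tens (p j u) ((\<beta> j \<otimes>\<^bsub>B\<^esub> b) \<odot>\<^bsub>Q\<^esub> q)"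
        using \<omega>_hom[OF bh[OF j] pc[OF j u] q] by (simp only: bi[OF j] compose_eq[OF pc[OF j u]])
      also have "(\<beta> j \<otimes>\<^bsub>B\<^esub> b) \<odot>\<^bsub>Q\<^esub> q = \<beta> j \<odot>\<^bsub>Q\<^esub> (b \<odot>\<^bsub>Q\<^esub> q)"
        using \<beta>(1)[OF j] b q by (intro Q.smult_assoc) simp_all
      finally show "\<omega> (b (i j (p j u))) q = ?tens (p j u) (\<beta> j \<odot>\<^bsub>Q\<^esub> (b \<odot>\<^bsub>Q\<^esub> q))" .
    qed (use u q b in \<open>auto simp: pc \<beta>q Q.smult_closed\<close>)
    finally show ?thesis by (simp add: \<omega>_def)
  qed
  have bal: "\<omega> \<in> balanced_maps B UB Q ?TQ"
    using \<omega>_left \<omega>_right \<omega>_bal by (auto simp: balanced_maps_def hom_def)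
  define \<theta> where "\<theta> = tensor_lift B UB Q ?TQ \<omega>"
  note \<theta> = UQ.tensor_lift_add_hom[OF TQ.T.abelian_group_axioms bal, folded \<theta>_def]
    and \<theta>_tens = UQ.tensor_lift_tens[OF TQ.T.abelian_group_axioms bal, folded \<theta>_def]
  note res_add = module_homs_add_hom[OF res_tensor_homs[OF Q]]
  have res_add': "res_tensor Q \<in> add_hom ?TQ (tensor B UB Q)"
    using res_add by (simp add: hom_def)
  show ?thesis
  proof (rule module_isosI[OF res_tensor_homs[OF Q], where g = \<theta>])
    show "\<theta> w \<in> carrier ?TQ" if "w \<in> carrier (restrict_scalars \<iota> (tensor B UB Q))" for w
      using add_hom_closed[OF \<theta>] that by simp
    show "\<theta> (res_tensor Q w) = w" if w: "w \<in> carrier ?TQ" for w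
    proof (rule TQ.tensor_add_hom_eq[OF add_hom_compose[OF res_add' \<theta>] _ _ w])
      show "(\<lambda>w. w) \<in> add_hom ?TQ ?TQ" by (rule add_homI) simp_all
      fix t q assume "t \<in> carrier TS" "q \<in> carrier (restrict_scalars \<rho> Q)"
      then have t: "t \<in> carrier T" and q: "q \<in> carrier Q" by simp_all
      have "adjunct T U (\<lambda>t\<in>carrier T. unit t) = \<one>\<^bsub>B\<^esub>"
        using UB.S.one_closed
        by (intro ext_homs_eqI[OF T_module U_module]) (simp_all add: adj unit_homs)
      then have "\<omega> (unit t) q = ?tens t q"
        using \<omega>_hom[OF unit_homs t q] Q.smult_one[OF q] t by simp
      then show "\<theta> (res_tensor Q (?tens t q)) = ?tens t q"
        using t q by (simp add: res_tensor_tens[OF Q] \<theta>_tens)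
    qed
    show "res_tensor Q (\<theta> w) = w" if "w \<in> carrier (restrict_scalars \<iota> (tensor B UB Q))" for w
    proof (rule UQ.tensor_add_hom_eq[OF add_hom_compose[OF \<theta> res_add']])
      show "w \<in> carrier (tensor B UB Q)" using that by simp
      show "(\<lambda>w. w) \<in> add_hom (tensor B UB Q) (tensor B UB Q)" by (rule add_homI) simp_all
      fix u q assume "u \<in> carrier UB" "q \<in> carrier Q"
      then have u: "u \<in> carrier U" and q: "q \<in> carrier Q" by simp_all
      have "res_tensor Q (\<theta> (tens B UB Q u q)) = res_tensor Q (\<omega> u q)"
        using u q by (simp add: \<theta>_tens)
      also have "\<dots> = finsum (tensor B UB Q) (\<lambda>k. res_tensor Q (?tens (p k u) (\<beta> k \<odot>\<^bsub>Q\<^esub> q))) {..<n}"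
        unfolding \<omega>_def
        by (intro add_hom_finsum[OF res_add'] TQ.T.abelian_group_axioms UQ.T.abelian_group_axioms)
          (use u q in \<open>simp_all add: pc \<beta>q\<close>)
      also have "\<dots> = finsum (tensor B UB Q) (\<lambda>k. tens B UB Q (i k (p k u)) q) {..<n}"
      proof (rule UQ.T.finsum_cong')
        fix k assume "k \<in> {..<n}"
        then have k: "k < n" by simp
        \<comment> \<open>Over B the factor \<beta>_k crosses back: (1 (x) p_k(u)) (x) \<beta>_k q =
          \<beta>_k(1 (x) p_k(u)) (x) q, and \<beta>_k extends i_k.\<close>
        show "res_tensor Q (?tens (p k u) (\<beta> k \<odot>\<^bsub>Q\<^esub> q)) = tens B UB Q (i k (p k u)) q"
          using UQ.tens_balanced[of "unit (p k u)" "\<beta> k" q] u q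
          by (simp add: res_tensor_tens[OF Q] pc k \<beta>q \<beta>)
      qed (use u q in \<open>auto simp: ic pc\<close>)
      also have "\<dots> = tens B UB Q (finsum U (\<lambda>k. i k (p k u)) {..<n}) q"
      proof -
        have "(\<lambda>u. tens B UB Q u q) \<in> add_hom U (tensor B UB Q)"
          using UQ.tens_left_add_hom[OF q] by (simp add: hom_def)
        from add_hom_finsum[OF this U.T.abelian_group_axioms UQ.T.abelian_group_axioms finite_lessThan]
        show ?thesis using u by (simp add: ic pc)
      qed
      finally show "res_tensor Q (\<theta> (tens B UB Q u q)) = tens B UB Q u q" by (simp add: sum u)
    qed
  qed
qed

text \<open>Both ways round the naturality square send t (x) q to (1 (x) t) (x) g(q).\<close>

theorem res_tensor_natural_iso:
  fixes C :: "(('a \<times> 't \<Rightarrow>\<^sub>0 int) set \<Rightarrow> ('a \<times> 't \<Rightarrow>\<^sub>0 int) set, 'q) module set"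
  assumes C: "\<And>Q. Q \<in> C \<Longrightarrow> left_module B Q" and U_add: "restrict_scalars \<iota> U \<in> add_cat R T"
  shows "naturally_isomorphic B C R (tensor_functor S TS \<circ>\<^sub>F res_functor \<rho>) (res_functor \<iota> \<circ>\<^sub>F tensor_functor B UB)"
proof (rule naturally_isomorphicI[where \<eta> = res_tensor])
  show "res_tensor Q \<in> module_isos R (obj (tensor_functor S TS \<circ>\<^sub>F res_functor \<rho>) Q)
    (obj (res_functor \<iota> \<circ>\<^sub>F tensor_functor B UB) Q)" if "Q \<in> C" for Q
    using res_tensor_iso[OF C U_add] that by simp
  fix Q Q' g w assume "Q \<in> C" "Q' \<in> C" and g: "g \<in> module_homs B Q Q'"
    and "w \<in> carrier (obj (tensor_functor S TS \<circ>\<^sub>F res_functor \<rho>) Q)"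
  then have Q: "left_module B Q" and Q': "left_module B Q'"
    and w: "w \<in> carrier (tensor S TS (restrict_scalars \<rho> Q))" by (simp_all add: C)
  have TQ: "tensor_product R S TS (restrict_scalars \<rho> Q)" and TQ': "tensor_product R S TS (restrict_scalars \<rho> Q')"
    by (intro tensor_product.intro TS.bimod_axioms left_module_restrict_scalars[OF _ TS.S.ring_axioms \<rho>] Q Q')+
  have UQ: "tensor_product A B UB Q" and UQ': "tensor_product A B UB Q'"
    by (intro tensor_product.intro UB.bimod_axioms Q Q')+
  note g' = module_homs_restrict_scalars[OF g \<rho>]
  let ?Tg = "tensor_map S TS (restrict_scalars \<rho> Q) TS (restrict_scalars \<rho> Q') (\<lambda>t. t) g"
  let ?Ug = "tensor_map B UB Q UB Q' (\<lambda>u. u) g"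
  have "res_tensor Q' (?Tg w) = ?Ug (res_tensor Q w)"
  proof (rule tensor_product.tensor_add_hom_eq[OF TQ _ _ _ w])
    show "(\<lambda>w. res_tensor Q' (?Tg w)) \<in> add_hom (tensor S TS (restrict_scalars \<rho> Q)) (restrict_scalars \<iota> (tensor B UB Q'))"
      by (rule add_hom_compose[OF module_homs_add_hom[OF tensor_map_right_homs[OF TQ TQ' g']]
            module_homs_add_hom[OF res_tensor_homs[OF Q']]])
    show "(\<lambda>w. ?Ug (res_tensor Q w)) \<in> add_hom (tensor S TS (restrict_scalars \<rho> Q)) (restrict_scalars \<iota> (tensor B UB Q'))"
      by (rule add_hom_compose[OF module_homs_add_hom[OF res_tensor_homs[OF Q]]
            module_homs_add_hom[OF module_homs_restrict_scalars[OF tensor_map_right_homs[OF UQ UQ' g] \<iota>]]])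
    show "res_tensor Q' (?Tg (tens S TS (restrict_scalars \<rho> Q) t q)) = ?Ug (res_tensor Q (tens S TS (restrict_scalars \<rho> Q) t q))"
      if "t \<in> carrier TS" "q \<in> carrier (restrict_scalars \<rho> Q)" for t q
      using that
      by (simp add: tensor_map_right_tens[OF TQ TQ' g'] tensor_map_right_tens[OF UQ UQ' g]
          res_tensor_tens[OF Q] res_tensor_tens[OF Q'] module_homs_closed[OF g])
  qed
  then show "res_tensor Q' (mor (tensor_functor S TS \<circ>\<^sub>F res_functor \<rho>) Q Q' g w) =
    mor (res_functor \<iota> \<circ>\<^sub>F tensor_functor B UB) Q Q' g (res_tensor Q w)"
    by simp
qed


section \<open>Statement (i): extension of scalars and the tensor functors\<close>

definition assoc_tensor where
  "assoc_tensor P = adjunct (tensor S TS P) (tensor B UB (tensor S BS P))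
    (tensor_lift S TS P (restrict_scalars \<iota> (tensor B UB (tensor S BS P)))
      (\<lambda>t p. tens B UB (tensor S BS P) (unit t) (tens S BS P \<one>\<^bsub>B\<^esub> p)))"

lemma one_B: "\<one>\<^bsub>B\<^esub> \<in> module_homs A U U"
  using UB.S.one_closed by simp

lemma
  assumes P: "left_module S P"
  shows tensor_product_TS: "tensor_product R S TS P"
    and tensor_product_BS: "tensor_product B S BS P"
    and tensor_product_ext: "tensor_product A R AR (tensor S TS P)"
    and tensor_product_UB: "tensor_product A B UB (tensor S BS P)"
proof -
  interpret P: left_module S P by fact
  interpret TP: tensor_product R S TS P ..
  interpret BP: tensor_product B S BS P ..
  interpret ATP: tensor_product A R AR "tensor S TS P"
    by (rule tensor_product[OF TP.T.left_module_axioms])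
  interpret UBP: tensor_product A B UB "tensor S BS P" ..
  show "tensor_product R S TS P" "tensor_product B S BS P" "tensor_product A R AR (tensor S TS P)"
    "tensor_product A B UB (tensor S BS P)" ..
qed

text \<open>Associativity of A (x) (T (x) P) followed by the identification of U with U (x) B over
  B, merged into one formula. The inner map is balanced because \<rho>(s) 1 = 1 \<rho>(s) in B: in
  (1 (x) t) \<rho>(s) (x) (1 (x) p) the scalar crosses first the tensor sign over B and then the one
  over S, reaching p.\<close>

lemma
  assumes P: "left_module S P"
  shows assoc_tensor_homs: "assoc_tensor P \<in> module_homs A (tensor R AR (tensor S TS P)) (tensor B UB (tensor S BS P))"
    and assoc_tensor_tens: "\<lbrakk>a \<in> carrier A; t \<in> carrier T; p \<in> carrier P\<rbrakk>
      \<Longrightarrow> assoc_tensor P (tens R AR (tensor S TS P) a (tens S TS P t p)) =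
        tens B UB (tensor S BS P) (tens R AR T a t) (tens S BS P \<one>\<^bsub>B\<^esub> p)"
proof -
  interpret TP: tensor_product R S TS P by (rule tensor_product_TS[OF P])
  interpret BP: tensor_product B S BS P by (rule tensor_product_BS[OF P])
  interpret UBP: tensor_product A B UB "tensor S BS P" by (rule tensor_product_UB[OF P])
  interpret r: left_module R "restrict_scalars \<iota> (tensor B UB (tensor S BS P))"
    by (rule left_module_restrict_scalars[OF UBP.T.left_module_axioms R.ring_axioms \<iota>])
  let ?\<beta> = "\<lambda>t p. tens B UB (tensor S BS P) (unit t) (tens S BS P \<one>\<^bsub>B\<^esub> p)"
  have B_tens: "tens S BS P \<one>\<^bsub>B\<^esub> p \<in> carrier (tensor S BS P)" if "p \<in> carrier P" for p
    using that one_B by (intro BP.tens_closed) simp_all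
  have bal: "?\<beta> \<in> balanced_maps S TS P (restrict_scalars \<iota> (tensor B UB (tensor S BS P)))"
  proof (rule balanced_mapsI)
    fix t s p assume t: "t \<in> carrier TS" and s: "s \<in> carrier S" and p: "p \<in> carrier P"
    have "?\<beta> (rsmult TS t s) p = tens B UB (tensor S BS P) (rsmult UB (unit t) (\<rho> s)) (tens S BS P \<one>\<^bsub>B\<^esub> p)"
      using t s by (simp add: \<rho>_unit)
    also have "\<dots> = tens B UB (tensor S BS P) (unit t) (\<rho> s \<odot>\<^bsub>tensor S BS P\<^esub> tens S BS P \<one>\<^bsub>B\<^esub> p)"
      using t s B_tens[OF p] by (intro UBP.tens_balanced) (simp_all add: \<rho>_homs)
    also have "\<rho> s \<odot>\<^bsub>tensor S BS P\<^esub> tens S BS P \<one>\<^bsub>B\<^esub> p = tens S BS P (rsmult BS \<one>\<^bsub>B\<^esub> s) p"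
      using s p one_B UB.S.l_one[of "\<rho> s"] UB.S.r_one[of "\<rho> s"] by (simp add: BP.smult_tens \<rho>_homs)
    also have "\<dots> = tens S BS P \<one>\<^bsub>B\<^esub> (s \<odot>\<^bsub>P\<^esub> p)"
      using s p one_B by (intro BP.tens_balanced) simp_all
    finally show "?\<beta> (rsmult TS t s) p = ?\<beta> t (s \<odot>\<^bsub>P\<^esub> p)" .
  next
    show "?\<beta> t (p \<oplus>\<^bsub>P\<^esub> p') = ?\<beta> t p \<oplus>\<^bsub>restrict_scalars \<iota> (tensor B UB (tensor S BS P))\<^esub> ?\<beta> t p'"
      if "t \<in> carrier TS" "p \<in> carrier P" "p' \<in> carrier P" for t p p'
      using that one_B BP.tens_add_right[of "\<one>\<^bsub>B\<^esub>" p p'] B_tens by (simp add: UBP.tens_add_right)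
    show "?\<beta> (t \<oplus>\<^bsub>TS\<^esub> t') p = ?\<beta> t p \<oplus>\<^bsub>restrict_scalars \<iota> (tensor B UB (tensor S BS P))\<^esub> ?\<beta> t' p"
      if "t \<in> carrier TS" "t' \<in> carrier TS" "p \<in> carrier P" for t t' p
      using that B_tens UBP.tens_add_left[of "unit t" "unit t'"] by (simp add: U.tens_add_right)
    show "?\<beta> t p \<in> carrier (restrict_scalars \<iota> (tensor B UB (tensor S BS P)))"
      if "t \<in> carrier TS" "p \<in> carrier P" for t p
      using that B_tens by simp
  qed
  let ?f = "tensor_lift S TS P (restrict_scalars \<iota> (tensor B UB (tensor S BS P))) ?\<beta>"
  have f: "?f \<in> module_homs R (tensor S TS P) (restrict_scalars \<iota> (tensor B UB (tensor S BS P)))"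
  proof (rule TP.tensor_lift_module_homs[OF r.left_module_axioms bal])
    show "?\<beta> (r \<odot>\<^bsub>TS\<^esub> t) p = r \<odot>\<^bsub>restrict_scalars \<iota> (tensor B UB (tensor S BS P))\<^esub> ?\<beta> t p"
      if "r \<in> carrier R" "t \<in> carrier TS" "p \<in> carrier P" for r t p
      using that ring_hom_closed[OF \<iota> that(1)] B_tens
      by (simp add: unit_tens_linear[OF T_module] UBP.smult_tens)
  qed
  have f_tens: "?f (tens S TS P t p) = ?\<beta> t p" if "t \<in> carrier T" "p \<in> carrier P" for t p
    using that by (subst TP.tensor_lift_tens[OF r.abelian_group_axioms bal]) simp_all
  show "assoc_tensor P \<in> module_homs A (tensor R AR (tensor S TS P)) (tensor B UB (tensor S BS P))"
    unfolding assoc_tensor_def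
    by (rule adjunct_homs[OF TP.T.left_module_axioms UBP.T.left_module_axioms f])
  show "assoc_tensor P (tens R AR (tensor S TS P) a (tens S TS P t p)) =
      tens B UB (tensor S BS P) (tens R AR T a t) (tens S BS P \<one>\<^bsub>B\<^esub> p)"
    if a: "a \<in> carrier A" and t: "t \<in> carrier T" and p: "p \<in> carrier P"
  proof -
    have "assoc_tensor P (tens R AR (tensor S TS P) a (tens S TS P t p)) =
        a \<odot>\<^bsub>tensor B UB (tensor S BS P)\<^esub> ?f (tens S TS P t p)"
      unfolding assoc_tensor_def using a t p
      by (intro adjunct_tens[OF TP.T.left_module_axioms UBP.T.left_module_axioms f]) simp_all
    also have "\<dots> = a \<odot>\<^bsub>tensor B UB (tensor S BS P)\<^esub> ?\<beta> t p"
      by (simp only: f_tens[OF t p])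
    also have "\<dots> = tens B UB (tensor S BS P) (tens R AR T a t) (tens S BS P \<one>\<^bsub>B\<^esub> p)"
      using a t B_tens[OF p] by (simp add: UBP.smult_tens unit_tens_smult[OF T_module])
    finally show ?thesis .
  qed
qed

text \<open>A sum in the inner tensor product splits by additivity in the right factor, so nesting
  two inductions produces no additional case.\<close>

lemma ext_tensor_induct [consumes 2, case_names tens add]:
  assumes P: "left_module S P" and w: "w \<in> carrier (tensor R AR (tensor S TS P))"
    and tens: "\<And>a t p. \<lbrakk>a \<in> carrier A; t \<in> carrier T; p \<in> carrier P\<rbrakk>
      \<Longrightarrow> Q (tens R AR (tensor S TS P) a (tens S TS P t p))"
    and add: "\<And>v w. \<lbrakk>v \<in> carrier (tensor R AR (tensor S TS P)); w \<in> carrier (tensor R AR (tensor S TS P)); Q v; Q w\<rbrakk>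
      \<Longrightarrow> Q (v \<oplus>\<^bsub>tensor R AR (tensor S TS P)\<^esub> w)"
  shows "Q w"
proof -
  interpret TP: tensor_product R S TS P by (rule tensor_product_TS[OF P])
  interpret ATP: tensor_product A R AR "tensor S TS P" by (rule tensor_product_ext[OF P])
  have *: "Q (tens R AR (tensor S TS P) a z)" if a: "a \<in> carrier A" and "z \<in> carrier (tensor S TS P)" for a z
    using that(2)
    by (induction rule: TP.tensor_induct) (simp_all add: a tens ATP.tens_add_right add)
  show ?thesis
    using w by (induction rule: ATP.tensor_induct) (simp_all add: * add)
qed

text \<open>The inverse starts at a tensor product whose right factor is itself a tensor product, so
  it is built from the inside. Each p gives an A-linear map \<gamma>(p) from U to the target; these
  induce a B-linear map \<Gamma> from B (x) P to the Hom module; evaluation u (x) w |->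
  \<Gamma>(w)(u) completes the construction.\<close>

lemma assoc_tensor_iso:
  assumes P: "left_module S P"
  shows "assoc_tensor P \<in> module_isos A (tensor R AR (tensor S TS P)) (tensor B UB (tensor S BS P))"
proof -
  interpret TP: tensor_product R S TS P by (rule tensor_product_TS[OF P])
  interpret BP: tensor_product B S BS P by (rule tensor_product_BS[OF P])
  interpret ATP: tensor_product A R AR "tensor S TS P" by (rule tensor_product_ext[OF P])
  interpret UBP: tensor_product A B UB "tensor S BS P" by (rule tensor_product_UB[OF P])
  let ?X = "tensor R AR (tensor S TS P)" and ?Y = "tensor B UB (tensor S BS P)"
  interpret H: left_module B "hom_module A UB ?X"
    by (rule left_module_hom_module[OF UB.bimod_axioms ATP.T.left_module_axioms])
  define g where "g p = (\<lambda>t\<in>carrier T. tens R AR (tensor S TS P) \<one>\<^bsub>A\<^esub> (tens S TS P t p))" for p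
  have g: "g p \<in> module_homs R T (restrict_scalars \<iota> ?X)" if p: "p \<in> carrier P" for p
    using p TP.tens_add_left TP.smult_tens ring_hom_closed[OF \<iota>]
    by (intro module_homsI add_homI)
      (simp_all add: g_def ATP.tens_add_right T.smult_closed
        unit_tens_linear[OF TP.T.left_module_axioms, symmetric])
  define \<gamma> where "\<gamma> p = adjunct T ?X (g p)" for p
  have \<gamma>: "\<gamma> p \<in> module_homs A U ?X" if "p \<in> carrier P" for p
    unfolding \<gamma>_def by (rule adjunct_homs[OF T_module ATP.T.left_module_axioms g[OF that]])
  have \<gamma>_tens: "\<gamma> p (tens R AR T a t) = tens R AR (tensor S TS P) a (tens S TS P t p)"
    if "p \<in> carrier P" "a \<in> carrier A" "t \<in> carrier T" for p a t
  proof -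
    have "\<gamma> p (tens R AR T a t) = a \<odot>\<^bsub>?X\<^esub> g p t"
      unfolding \<gamma>_def by (rule adjunct_tens[OF T_module ATP.T.left_module_axioms g[OF that(1)] that(2,3)])
    then show ?thesis
      using that by (simp add: g_def unit_tens_smult[OF TP.T.left_module_axioms])
  qed
  have \<gamma>_add: "\<gamma> (p \<oplus>\<^bsub>P\<^esub> p') = \<gamma> p \<oplus>\<^bsub>hom_module A UB ?X\<^esub> \<gamma> p'" if "p \<in> carrier P" "p' \<in> carrier P" for p p'
    using that H.a_closed[of "\<gamma> p" "\<gamma> p'"] TP.tens_add_right
    by (intro ext_homs_eqI[OF T_module ATP.T.left_module_axioms]) (simp_all add: \<gamma> \<gamma>_tens ATP.tens_add_right)
  \<comment> \<open>This is the relation t (x) s p = t s (x) p in the inner tensor product over S,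
    transported to maps out of \<open>U\<close>.\<close>
  have \<gamma>_smult: "\<gamma> (s \<odot>\<^bsub>P\<^esub> p) = \<rho> s \<odot>\<^bsub>hom_module A UB ?X\<^esub> \<gamma> p" if s: "s \<in> module_homs R T T" and p: "p \<in> carrier P" for s p
    using s p H.smult_closed[of "\<rho> s" "\<gamma> p"] TP.N.smult_closed[of s p] TP.tens_balanced[of _ s p]
    by (intro ext_homs_eqI[OF T_module ATP.T.left_module_axioms])
      (simp_all add: \<gamma> \<gamma>_tens \<rho>_homs \<rho>_unit module_homs_closed[OF s])
  have bal: "(\<lambda>b p. b \<odot>\<^bsub>hom_module A UB ?X\<^esub> \<gamma> p) \<in> balanced_maps S BS P (hom_module A UB ?X)"
  proof (rule balanced_mapsI)
    fix b p assume b: "b \<in> carrier BS" and p: "p \<in> carrier P"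
    have b': "b \<in> carrier B" and \<gamma>p: "\<gamma> p \<in> carrier (hom_module A UB ?X)" using b \<gamma>[OF p] by simp_all
    show "b \<odot>\<^bsub>hom_module A UB ?X\<^esub> \<gamma> p \<in> carrier (hom_module A UB ?X)"
      by (rule H.smult_closed[OF b' \<gamma>p])
    show "(b \<oplus>\<^bsub>BS\<^esub> b'') \<odot>\<^bsub>hom_module A UB ?X\<^esub> \<gamma> p = b \<odot>\<^bsub>hom_module A UB ?X\<^esub> \<gamma> p \<oplus>\<^bsub>hom_module A UB ?X\<^esub> b'' \<odot>\<^bsub>hom_module A UB ?X\<^esub> \<gamma> p"
      if "b'' \<in> carrier BS" for b''
      using H.smult_l_distr[OF b' _ \<gamma>p, of b''] that by (simp only: right_extension_bimodule_simps)
    show "b \<odot>\<^bsub>hom_module A UB ?X\<^esub> \<gamma> (p \<oplus>\<^bsub>P\<^esub> p') = b \<odot>\<^bsub>hom_module A UB ?X\<^esub> \<gamma> p \<oplus>\<^bsub>hom_module A UB ?X\<^esub> b \<odot>\<^bsub>hom_module A UB ?X\<^esub> \<gamma> p'"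
      if "p' \<in> carrier P" for p'
      using H.smult_r_distr[OF b' \<gamma>p, of "\<gamma> p'"] that \<gamma>[OF that] by (simp only: \<gamma>_add[OF p that] hom_module_simps module_homs_End_bimodule)
    show "rsmult BS b s \<odot>\<^bsub>hom_module A UB ?X\<^esub> \<gamma> p = b \<odot>\<^bsub>hom_module A UB ?X\<^esub> \<gamma> (s \<odot>\<^bsub>P\<^esub> p)" if "s \<in> carrier S" for s
      using H.smult_assoc[OF b' _ \<gamma>p, of "\<rho> s"] that \<rho>_homs[of s]
      by (simp only: \<gamma>_smult[OF _ p] right_extension_bimodule_simps End_ring_simps)
  qed
  define \<Gamma> where "\<Gamma> = tensor_lift S BS P (hom_module A UB ?X) (\<lambda>b p. b \<odot>\<^bsub>hom_module A UB ?X\<^esub> \<gamma> p)"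
  have \<Gamma>: "\<Gamma> \<in> module_homs B (tensor S BS P) (hom_module A UB ?X)"
    unfolding \<Gamma>_def
  proof (rule BP.tensor_lift_module_homs[OF H.left_module_axioms bal])
    show "(b \<odot>\<^bsub>BS\<^esub> b') \<odot>\<^bsub>hom_module A UB ?X\<^esub> \<gamma> p = b \<odot>\<^bsub>hom_module A UB ?X\<^esub> (b' \<odot>\<^bsub>hom_module A UB ?X\<^esub> \<gamma> p)"
      if "b \<in> carrier B" "b' \<in> carrier BS" "p \<in> carrier P" for b b' p
      using H.smult_assoc[of b b' "\<gamma> p"] that \<gamma>[of p]
      by (simp only: right_extension_bimodule_simps hom_module_simps(1) module_homs_End_bimodule)
  qed
  have \<Gamma>_tens: "\<Gamma> (tens S BS P b p) = b \<odot>\<^bsub>hom_module A UB ?X\<^esub> \<gamma> p" if "b \<in> module_homs A U U" "p \<in> carrier P" for b p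
    unfolding \<Gamma>_def using that
    by (subst BP.tensor_lift_tens[OF H.abelian_group_axioms bal]) simp_all
  have \<Gamma>w: "\<Gamma> w \<in> module_homs A U ?X" if "w \<in> carrier (tensor S BS P)" for w
    using module_homs_closed[OF \<Gamma> that] by simp
  have \<Gamma>_add: "\<Gamma> (v \<oplus>\<^bsub>tensor S BS P\<^esub> w) u = \<Gamma> v u \<oplus>\<^bsub>?X\<^esub> \<Gamma> w u"
    if "v \<in> carrier (tensor S BS P)" "w \<in> carrier (tensor S BS P)" "u \<in> carrier U" for v w u
    using that module_homs_add[OF \<Gamma>] by simp
  \<comment> \<open>On the Hom module (b f)(u) = f(u b), so B-linearity of \<open>\<Gamma>\<close>
    is exactly the balancing condition for evaluation.\<close>
  have bal': "(\<lambda>u w. \<Gamma> w u) \<in> balanced_maps B UB (tensor S BS P) ?X"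
    using module_homs_smult[OF \<Gamma>]
    by (intro balanced_mapsI) (simp_all add: \<Gamma>_add module_homs_closed[OF \<Gamma>w] module_homs_add[OF \<Gamma>w])
  define \<theta> where "\<theta> = tensor_lift B UB (tensor S BS P) ?X (\<lambda>u w. \<Gamma> w u)"
  have \<theta>: "\<theta> \<in> module_homs A ?Y ?X"
    unfolding \<theta>_def
    by (rule UBP.tensor_lift_module_homs[OF ATP.T.left_module_axioms bal'])
      (simp add: module_homs_smult[OF \<Gamma>w])
  have \<theta>_tens: "\<theta> (tens B UB (tensor S BS P) u w) = \<Gamma> w u" if "u \<in> carrier U" "w \<in> carrier (tensor S BS P)" for u w
    unfolding \<theta>_def using that
    by (subst UBP.tensor_lift_tens[OF ATP.T.abelian_group_axioms bal']) simp_all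
  note assoc = assoc_tensor_homs[OF P]
  have B_tens: "tens S BS P b p \<in> carrier (tensor S BS P)" if "b \<in> module_homs A U U" "p \<in> carrier P" for b p
    using that by (intro BP.tens_closed) simp_all
  \<comment> \<open>The case w = 1 (x) p of the identity for \<open>\<Gamma>\<close> that follows. A
    general generator b (x) p = b (1 (x) p) is reached from it by moving b across to u.\<close>
  have assoc_\<gamma>: "assoc_tensor P (\<gamma> p v) = tens B UB (tensor S BS P) v (tens S BS P \<one>\<^bsub>B\<^esub> p)"
    if v: "v \<in> carrier U" and p: "p \<in> carrier P" for v p
  proof -
    define e where "e = tens S BS P \<one>\<^bsub>B\<^esub> p"
    have e: "e \<in> carrier (tensor S BS P)" using B_tens[OF one_B p] by (simp only: e_def)
    have "assoc_tensor P (\<gamma> p v) = tens B UB (tensor S BS P) v e"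
      using v
    proof (induction rule: U.tensor_induct)
      case (tens a t)
      then show ?case using p by (simp add: \<gamma>_tens assoc_tensor_tens[OF P] e_def del: End_ring_simps)
    next
      case (add v w)
      then show ?case
        using e UBP.tens_add_left[of v w]
        by (simp add: module_homs_add[OF \<gamma>[OF p]] module_homs_closed[OF \<gamma>[OF p]] module_homs_add[OF assoc])
    qed
    then show ?thesis by (simp only: e_def)
  qed
  have assoc_\<Gamma>: "assoc_tensor P (\<Gamma> w u) = tens B UB (tensor S BS P) u w"
    if u: "u \<in> carrier U" and w: "w \<in> carrier (tensor S BS P)" for u w
    using w
  proof (induction rule: BP.tensor_induct)
    case (tens b p)
    then have b: "b \<in> module_homs A U U" and p: "p \<in> carrier P" by simp_all
    have "assoc_tensor P (\<Gamma> (tens S BS P b p) u) = tens B UB (tensor S BS P) (rsmult UB u b) (tens S BS P \<one>\<^bsub>B\<^esub> p)"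
      using u b p by (simp add: \<Gamma>_tens assoc_\<gamma> module_homs_closed[OF b])
    also have "\<dots> = tens B UB (tensor S BS P) u (b \<odot>\<^bsub>tensor S BS P\<^esub> tens S BS P \<one>\<^bsub>B\<^esub> p)"
      using u b B_tens[OF one_B p] by (intro UBP.tens_balanced) simp_all
    also have "b \<odot>\<^bsub>tensor S BS P\<^esub> tens S BS P \<one>\<^bsub>B\<^esub> p = tens S BS P b p"
      using BP.smult_tens[of b "\<one>\<^bsub>B\<^esub>" p] UB.S.r_one[of b] b p one_B by simp
    finally show ?case .
  next
    case (add v w)
    then show ?case
      using u by (simp add: \<Gamma>_add module_homs_closed[OF \<Gamma>w] module_homs_add[OF assoc] UBP.tens_add_right)
  qed
  show ?thesis
  proof (rule module_isosI[OF assoc, where g = \<theta>])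
    show "\<theta> w \<in> carrier ?X" if "w \<in> carrier ?Y" for w
      by (rule module_homs_closed[OF \<theta> that])
    show "\<theta> (assoc_tensor P w) = w" if "w \<in> carrier ?X" for w
      using P that
    proof (induction rule: ext_tensor_induct)
      case (tens a t p)
      then show ?case
        using B_tens[OF one_B] one_B
        by (simp add: assoc_tensor_tens[OF P] \<theta>_tens \<Gamma>_tens \<gamma>_tens)
    next
      case (add v w)
      then show ?case
        by (simp add: module_homs_add[OF assoc] module_homs_add[OF \<theta>] module_homs_closed[OF assoc])
    qed
    show "assoc_tensor P (\<theta> w) = w" if "w \<in> carrier ?Y" for w
      using that
    proof (induction rule: UBP.tensor_induct)
      case (tens u w)
      then show ?case by (simp add: \<theta>_tens assoc_\<Gamma>)
    next
      case (add v w)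
      then show ?case
        by (simp add: module_homs_add[OF assoc] module_homs_add[OF \<theta>] module_homs_closed[OF \<theta>])
    qed
  qed
qed

text \<open>Both ways round the naturality square send a (x) (t (x) p) to (a (x) t) (x) (1 (x)
  g(p)).\<close>

theorem assoc_tensor_natural_iso:
  fixes C :: "('t \<Rightarrow> 't, 'p) module set"
  assumes C: "\<And>P. P \<in> C \<Longrightarrow> left_module S P"
  shows "naturally_isomorphic S C A (tensor_functor R AR \<circ>\<^sub>F tensor_functor S TS) (tensor_functor B UB \<circ>\<^sub>F tensor_functor S BS)"
proof (rule naturally_isomorphicI[where \<eta> = assoc_tensor])
  show "assoc_tensor P \<in> module_isos A (obj (tensor_functor R AR \<circ>\<^sub>F tensor_functor S TS) P)
    (obj (tensor_functor B UB \<circ>\<^sub>F tensor_functor S BS) P)" if "P \<in> C" for P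
    using assoc_tensor_iso[OF C[OF that]] by simp
  fix P P' g w assume "P \<in> C" "P' \<in> C" and g: "g \<in> module_homs S P P'"
    and "w \<in> carrier (obj (tensor_functor R AR \<circ>\<^sub>F tensor_functor S TS) P)"
  then have P: "left_module S P" and P': "left_module S P'"
    and w: "w \<in> carrier (tensor R AR (tensor S TS P))" by (simp_all add: C)
  note [simp] = tensor_product.tens_closed[OF tensor_product_TS[OF P]]
    tensor_product.tens_closed[OF tensor_product_TS[OF P']]
  note Tg = tensor_map_right_homs[OF tensor_product_TS[OF P] tensor_product_TS[OF P'] g]
    and Tg_tens = tensor_map_right_tens[OF tensor_product_TS[OF P] tensor_product_TS[OF P'] g]
    and Bg = tensor_map_right_homs[OF tensor_product_BS[OF P] tensor_product_BS[OF P'] g]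
    and Bg_tens = tensor_map_right_tens[OF tensor_product_BS[OF P] tensor_product_BS[OF P'] g]
  note ATg = tensor_map_right_homs[OF tensor_product_ext[OF P] tensor_product_ext[OF P'] Tg]
    and ATg_tens = tensor_map_right_tens[OF tensor_product_ext[OF P] tensor_product_ext[OF P'] Tg]
    and UBg = tensor_map_right_homs[OF tensor_product_UB[OF P] tensor_product_UB[OF P'] Bg]
    and UBg_tens = tensor_map_right_tens[OF tensor_product_UB[OF P] tensor_product_UB[OF P'] Bg]
  have B_tens: "tens S BS P \<one>\<^bsub>B\<^esub> p \<in> carrier (tensor S BS P)" if "p \<in> carrier P" for p
    using that one_B by (intro tensor_product.tens_closed[OF tensor_product_BS[OF P]]) simp_all
  let ?Tg = "tensor_map S TS P TS P' (\<lambda>t. t) g" and ?Bg = "tensor_map S BS P BS P' (\<lambda>b. b) g"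
  let ?ATg = "tensor_map R AR (tensor S TS P) AR (tensor S TS P') (\<lambda>a. a) ?Tg"
    and ?UBg = "tensor_map B UB (tensor S BS P) UB (tensor S BS P') (\<lambda>u. u) ?Bg"
  have "assoc_tensor P' (?ATg w) = ?UBg (assoc_tensor P w)"
    using P w
  proof (induction rule: ext_tensor_induct)
    case (tens a t p)
    then show ?case
      using B_tens one_B
      by (simp add: ATg_tens Tg_tens UBg_tens Bg_tens assoc_tensor_tens[OF P] assoc_tensor_tens[OF P']
          module_homs_closed[OF g])
  next
    case (add v w)
    then show ?case
      by (simp add: module_homs_add[OF ATg] module_homs_add[OF UBg] module_homs_closed[OF ATg]
          module_homs_add[OF assoc_tensor_homs[OF P]] module_homs_add[OF assoc_tensor_homs[OF P']]
          module_homs_closed[OF assoc_tensor_homs[OF P]])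
  qed
  then show "assoc_tensor P' (mor (tensor_functor R AR \<circ>\<^sub>F tensor_functor S TS) P P' g w) =
    mor (tensor_functor B UB \<circ>\<^sub>F tensor_functor S BS) P P' g (assoc_tensor P w)"
    by simp
qed

end

theorem proposition4p1:
  fixes R :: "'r ring" and A :: "'a ring" and \<iota> :: "'r \<Rightarrow> 'a" and T :: "('r, 't) module"
    and S :: "('t \<Rightarrow> 't) ring"
    and U :: "('a, ('a \<times> 't \<Rightarrow>\<^sub>0 int) set) module"
    and B :: "(('a \<times> 't \<Rightarrow>\<^sub>0 int) set \<Rightarrow> ('a \<times> 't \<Rightarrow>\<^sub>0 int) set) ring"
    and \<rho> :: "('t \<Rightarrow> 't) \<Rightarrow> ('a \<times> 't \<Rightarrow>\<^sub>0 int) set \<Rightarrow> ('a \<times> 't \<Rightarrow>\<^sub>0 int) set"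
    and A\<^sub>R :: "('a, 'r, 'a) bimodule"
    and T\<^sub>S :: "('r, 't \<Rightarrow> 't, 't) bimodule"
    and U\<^sub>B :: "('a, ('a \<times> 't \<Rightarrow>\<^sub>0 int) set \<Rightarrow> ('a \<times> 't \<Rightarrow>\<^sub>0 int) set,
                ('a \<times> 't \<Rightarrow>\<^sub>0 int) set) bimodule"
    and B\<^sub>S :: "(('a \<times> 't \<Rightarrow>\<^sub>0 int) set \<Rightarrow> ('a \<times> 't \<Rightarrow>\<^sub>0 int) set, 't \<Rightarrow> 't,
                ('a \<times> 't \<Rightarrow>\<^sub>0 int) set \<Rightarrow> ('a \<times> 't \<Rightarrow>\<^sub>0 int) set) bimodule"
  assumes "frobenius_extension R A \<iota>"
    and "left_module R T"
    and "A\<^sub>R = right_extension_bimodule \<iota> A"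
    and "U = tensor R A\<^sub>R T"
    and "S = End_ring R T"
    and "B = End_ring A U"
    and "\<rho> = (\<lambda>s. tensor_map R A\<^sub>R T A\<^sub>R T (\<lambda>a. a) s)"
    and "T\<^sub>S = End_bimodule T"
    and "U\<^sub>B = End_bimodule U"
    and "B\<^sub>S = right_extension_bimodule \<rho> B"
    and "restrict_scalars \<iota> U \<in> add_cat R T"
  shows
    "naturally_isomorphic S (proj_cat S :: ('t \<Rightarrow> 't, 'p) module set) A
       (tensor_functor R A\<^sub>R \<circ>\<^sub>F tensor_functor S T\<^sub>S)
       (tensor_functor B U\<^sub>B \<circ>\<^sub>F tensor_functor S B\<^sub>S) \<and>
     naturally_isomorphic A (add_cat A U :: ('a, 'x) module set) S
       (hom_functor R T\<^sub>S \<circ>\<^sub>F res_functor \<iota>)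
       (res_functor \<rho> \<circ>\<^sub>F hom_functor A U\<^sub>B) \<and>
     naturally_isomorphic R (add_cat R T :: ('r, 'm) module set) B
       (tensor_functor S B\<^sub>S \<circ>\<^sub>F hom_functor R T\<^sub>S)
       (hom_functor A U\<^sub>B \<circ>\<^sub>F tensor_functor R A\<^sub>R) \<and>
     naturally_isomorphic B
       (proj_cat B :: (('a \<times> 't \<Rightarrow>\<^sub>0 int) set \<Rightarrow> ('a \<times> 't \<Rightarrow>\<^sub>0 int) set, 'q) module set) R
       (tensor_functor S T\<^sub>S \<circ>\<^sub>F res_functor \<rho>)
       (res_functor \<iota> \<circ>\<^sub>F tensor_functor B U\<^sub>B)"
proof -
  interpret endomorphism_extension R A \<iota> T
    using assms(1,2) unfolding frobenius_extension_def
    by (intro endomorphism_extension.intro scalar_extension.intro scalar_extension_axioms.intro) simp_all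
  \<comment> \<open>With \<open>U\<close> and \<open>A\<^sub>R\<close> expanded, the hypothesis on
    Res U takes the form of the premise that provides the dual basis in (iv).\<close>
  have "restrict_scalars \<iota> (tensor R (right_extension_bimodule \<iota> A) T) \<in> add_cat R T"
    using assms(11) unfolding assms(3,4) .
  then show ?thesis
    \<comment> \<open>The defining equations are expanded from the most derived notions downwards,
      so that each mentions only notions expanded after it.\<close>
    unfolding assms(8-10) assms(7) assms(6) assms(5) assms(4) assms(3)
    by (intro conjI assoc_tensor_natural_iso hom_res_natural_iso ext_hom_natural_iso res_tensor_natural_iso)
      (auto simp: proj_cat_def add_cat_def)
qed

end
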